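(* Let $E_0$ be a compact subset of $\mathbb{T}=\partial\mathbb{D}$ and let $\rho\ge0$ be an upper semicontinuous real-valued function on $E_0$; write $\rho(\theta)$ for its value at $e^{i\theta}\in E_0$. For $0\le r<1$, let $E(r)$ be the compact subset of $\mathbb{D}$ which is the union, over all $e^{i\theta}\in E_0$, of the intervals $[re^{i\theta},se^{i\theta}]$, where $s=s(r,\theta)$, $r\le s<1$, is such that $\ell_{\mathbb{D}}([r,s])=\rho(\theta)$. Then the conformal capacity $\mathrm{cap}(E(r))$ is an increasing (i.e. non-decreasing) function of $r$ on the interval $0\le r<1$.
   Context: $\mathbb{D}=\{z\in\mathbb{C}:|z|<1\}$. The hyperbolic length of a Borel subset $A$ of a rectifiable curve in $\mathbb{D}$ is $\ell_{\mathbb{D}}(A)=\int_A\frac{2|dz|}{1-|z|^2}$. $[z_1,z_2]$ denotes the closed Euclidean segment. For a compact set $E\subset\mathbb{D}$, the conformal capacity is $\mathrm{cap}(E)=\inf_u\int_{\mathbb{D}}|\nabla u|^2\,dm$, where $dm$ is two-dimensional Lebesgue measure and the infimum is over all Lipschitz functions $u$ with $u=0$ on $\partial\mathbb{D}$ and $u\ge1$ on $E$. *)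

theory Defs
  imports "HOL-Analysis.Analysis"
begin

(* The integral of 2|dz|/(1-|z|^2) over a subset A of the curve traced by g.  The parametrization
   g on [0,1] is meant to be absolutely continuous (e.g. proportional to arc length) and either
   constant or injective up to its end points, so that |dz| = |g'(t)| dt. *)
definition hyp_length :: "(real \<Rightarrow> complex) \<Rightarrow> complex set \<Rightarrow> real" where
  "hyp_length g A =
     (LINT t:{t\<in>{0..1}. g t \<in> A}|lebesgue.
        2 * norm (vector_derivative g (at t within {0..1})) / (1 - (norm (g t))\<^sup>2))"

abbreviation hyp_length_segment :: "complex \<Rightarrow> complex \<Rightarrow> real" where
  "hyp_length_segment a b \<equiv> hyp_length (linepath a b) (closed_segment a b)"

(* (u_x, u_y) as a complex number.  For Lipschitz u both partial derivatives exist almost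
   everywhere; on the exceptional null set the value is irrelevant. *)
definition gradient :: "(complex \<Rightarrow> real) \<Rightarrow> complex \<Rightarrow> complex" where
  "gradient u z = Complex (deriv (\<lambda>t. u (z + of_real t)) 0) (deriv (\<lambda>t. u (z + \<i> * of_real t)) 0)"

definition cap_admissible :: "complex set \<Rightarrow> (complex \<Rightarrow> real) set" where
  "cap_admissible E =
     {u. (\<exists>L. L-lipschitz_on (cball 0 1) u) \<and> (\<forall>z\<in>sphere 0 1. u z = 0) \<and> (\<forall>z\<in>E. 1 \<le> u z)}"

(* Intended for compact subsets E of the open unit disk. *)
definition conf_cap :: "complex set \<Rightarrow> ennreal" where
  "conf_cap E =
     (INF u\<in>cap_admissible E. \<integral>\<^sup>+ z\<in>ball 0 1. ennreal ((norm (gradient u z))\<^sup>2) \<partial>lebesgue)"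

definition upper_semicontinuous_on :: "'a::topological_space set \<Rightarrow> ('a \<Rightarrow> real) \<Rightarrow> bool" where
  "upper_semicontinuous_on S f \<longleftrightarrow>
     (\<forall>x\<in>S. \<forall>a. f x < a \<longrightarrow> eventually (\<lambda>y. f y < a) (at x within S))"

(* The s in [r,1) for which [r,s] has hyperbolic length l. *)
definition radial_end :: "real \<Rightarrow> real \<Rightarrow> real" where
  "radial_end r l = (THE s. r \<le> s \<and> s < 1 \<and> hyp_length_segment (of_real r) (of_real s) = l)"

(* The function rho is defined on points w = exp(i*theta) of the unit circle, not on angles. *)
definition radial_set :: "complex set \<Rightarrow> (complex \<Rightarrow> real) \<Rightarrow> real \<Rightarrow> complex set" where
  "radial_set E\<^sub>0 \<rho> r =
     (\<Union>w\<in>E\<^sub>0. closed_segment (of_real r * w) (of_real (radial_end r (\<rho> w)) * w))"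

end

theory Submission
  imports Defs
begin

text \<open>
  In geodesic polar coordinates about the origin, moving \<open>E(r)\<close> to \<open>E(r')\<close> with \<open>r \<le> r'\<close> is the map
  \<open>S\<close> that pushes every point outward along its ray by the hyperbolic distance between \<open>r\<close> and \<open>r'\<close>.
  This map does not decrease hyperbolic distances: with \<open>a\<close>, \<open>b\<close> half the hyperbolic distances of
  two points from the origin and \<open>\<theta>\<close> the angle between their rays, their hyperbolic distance \<open>d\<close> satisfies
  \<open>cosh\<^sup>2(d/2) = cosh\<^sup>2(a - b) + (1 - cos \<theta>) sinh(2a) sinh(2b) / 2\<close>
  (\<open>pseudo_dist2_polar\<close>), and increasing \<open>a\<close> and \<open>b\<close> by the same amount only increases the right-hand side.
  So the theorem is a case of a general principle (\<open>conf_cap_mono_expansion\<close>): capacity does not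
  decrease under maps that do not decrease hyperbolic distances.

  The principle is clear from potential theory. Up to a constant factor, capacity is the reciprocal of the least
  Green energy \<open>\<integral>\<integral> g(z,w) d\<mu>(z) d\<mu>(w)\<close> of a probability measure on the set, and the Green function
  \<open>g\<close> is a decreasing function of the hyperbolic distance, so transporting a measure by \<open>S\<close> lowers its
  energy. The proof below follows this idea with finite charges whose energy is
  nearly minimal. The singular kernel is replaced by
  \<open>g\<^sub>\<epsilon>(z,w) = ln ((1 + \<epsilon>) / (p(z,w) + \<epsilon>)) / 2\<close>, where \<open>p\<close> is the squared pseudo-hyperbolic distance.
  It is still a decreasing function of the hyperbolic distance and vanishes on the circle, but it is
  smooth, so suitably scaled combinations are admissible test functions. Writing \<open>\<langle>u,v\<rangle>\<close> for the
  Dirichlet form, three facts carry the argument.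

  \<^item> \<open>dirichlet_soft_green\<close>: \<open>\<langle>u, g\<^sub>\<epsilon>(z,\<cdot>)\<rangle>\<close> is \<open>2\<pi>\<close> times an average of \<open>u\<close> against an explicit density
    that concentrates at \<open>z\<close> as \<open>\<epsilon> \<rightarrow> 0\<close>, for every Lipschitz \<open>u\<close> vanishing on the circle.
  \<^item> \<open>dirichlet_soft_green_le\<close>: \<open>\<langle>g\<^sub>\<epsilon>(z,\<cdot>), g\<^sub>\<epsilon>(w,\<cdot>)\<rangle> \<le> 2\<pi> g\<^sub>\<epsilon>(z,w)\<close>, a mean value inequality for
    superharmonic functions.
  \<^item> \<open>near_equilibrium\<close>: a charge on \<open>E\<close> whose energy \<open>Q\<close> is close to the infimum has a potential
    that is at least \<open>Q - \<eta>\<close> everywhere on \<open>E\<close>.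

  Take such a charge on \<open>E\<close>. Its potential divided by \<open>Q - \<eta>\<close> is admissible for \<open>E\<close>, so the
  capacity of \<open>E\<close> is at most \<open>2\<pi>Q / (Q - \<eta>)\<^sup>2\<close>. The image charge on \<open>S(E)\<close> has energy at most \<open>Q\<close>; testing
  an admissible function \<open>u\<close> for \<open>E'\<close> against the potential of the image charge gives, by the
  Cauchy-Schwarz inequality, a Dirichlet energy of \<open>u\<close> of at least \<open>2\<pi>\<sigma>\<^sup>2 / Q\<close>, where \<open>\<sigma>\<close>
  bounds the averages of \<open>u\<close> from below and is close to \<open>1\<close> for small \<open>\<epsilon>\<close>. Letting \<open>\<eta> \<rightarrow> 0\<close> and then \<open>\<epsilon> \<rightarrow> 0\<close>
  compares the two capacities.

  Since the gradient of a competitor is defined through pointwise partial derivatives, the Green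
  identity for Lipschitz functions rests on their almost everywhere differentiability along
  lines, which is derived from the Vitali covering theorem.
\<close>

section \<open>Directional derivatives of Lipschitz functions\<close>

lemma vitali_open_intervals:
  fixes S G :: "real set"
  assumes "open G" "S \<subseteq> G"
    and "\<And>x \<delta>. x \<in> S \<Longrightarrow> 0 < \<delta> \<Longrightarrow> \<exists>a b. a < x \<and> x < b \<and> b - a < \<delta> \<and> P a b"
  obtains C where "countable C" "\<And>a b. (a, b) \<in> C \<Longrightarrow> a < b \<and> {a<..<b} \<subseteq> G \<and> P a b"
    "disjoint_family_on (\<lambda>(a, b). {a<..<b}) C"
    "S - (\<Union>(a, b)\<in>C. {a<..<b}) \<in> null_sets lebesgue"
proof -
  define K where "K = {(a, b). a < b \<and> {a<..<b} \<subseteq> G \<and> P a b}"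
  define m where "m = (\<lambda>(a, b). (a + b) / (2::real))"
  define r where "r = (\<lambda>(a, b). (b - a) / (2::real))"
  have ball: "ball (m (a, b)) (r (a, b)) = {a<..<b}" for a b
    unfolding m_def r_def by (simp add: ball_eq_greaterThanLessThan field_simps)
  have cov: "\<exists>i. i \<in> K \<and> x \<in> ball (m i) (r i) \<and> r i < d" if xS: "x \<in> S" and d: "0 < d" for x d
  proof -
    obtain \<epsilon> where \<epsilon>: "\<epsilon> > 0" "ball x \<epsilon> \<subseteq> G"
      using openE[OF assms(1)] assms(2) xS by (metis subsetD)
    obtain a b where ab: "a < x" "x < b" "b - a < min d \<epsilon>" "P a b"
      using assms(3)[OF xS, of "min d \<epsilon>"] \<epsilon>(1) d by auto
    have "{a<..<b} \<subseteq> ball x \<epsilon>"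
      using ab by (auto simp: dist_real_def)
    then have "(a, b) \<in> K" using ab \<epsilon> by (auto simp: K_def)
    moreover have "r (a, b) < d" using ab by (auto simp: r_def)
    ultimately show ?thesis using ball ab by (intro exI[of _ "(a, b)"]) auto
  qed
  obtain C where C: "countable C" "C \<subseteq> K"
      "pairwise (\<lambda>i j. disjnt (ball (m i) (r i)) (ball (m j) (r j))) C"
      "negligible (S - (\<Union>i\<in>C. ball (m i) (r i)))"
    by (rule Vitali_covering_theorem_balls[of S K m r]) ((rule cov; assumption), blast)
  have eq: "(\<lambda>i. ball (m i) (r i)) = (\<lambda>(a, b). {a<..<b})"
    using ball by (auto simp: fun_eq_iff)
  show ?thesis
  proof (rule that[of C])
    show "disjoint_family_on (\<lambda>(a, b). {a<..<b}) C"
      using C(3) unfolding eq[symmetric] disjoint_family_on_def pairwise_def disjnt_def by auto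
    show "S - (\<Union>(a, b)\<in>C. {a<..<b}) \<in> null_sets lebesgue"
      using C(4) unfolding fun_cong[OF eq] negligible_iff_null_sets by auto
  qed (use C K_def in auto)
qed

text \<open>The classical double covering argument. Cover \<open>S\<close> by intervals on which \<open>f\<close> grows by less than
  \<open>p\<close> per unit length, staying inside an open set barely larger than \<open>S\<close>; inside these, cover \<open>S\<close>
  again by intervals on which \<open>f\<close> grows by more than \<open>q\<close> per unit length. The Stieltjes measure of \<open>f\<close>
  then gives \<open>q |S| \<le> p |S|\<close>.\<close>
lemma null_set_between_slopes:
  fixes f :: "real \<Rightarrow> real" and S :: "real set"
  assumes mono: "\<And>x y. x \<le> y \<Longrightarrow> f x \<le> f y" and cont: "continuous_on UNIV f"
    and S: "S \<in> sets borel" "bounded S" and pq: "0 < p" "p < q"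
    and low: "\<And>x \<delta>. x \<in> S \<Longrightarrow> 0 < \<delta> \<Longrightarrow> \<exists>a b. a < x \<and> x < b \<and> b - a < \<delta> \<and> f b - f a < p * (b - a)"
    and high: "\<And>x \<delta>. x \<in> S \<Longrightarrow> 0 < \<delta> \<Longrightarrow> \<exists>a b. a < x \<and> x < b \<and> b - a < \<delta> \<and> q * (b - a) < f b - f a"
  shows "emeasure lborel S = 0"
proof -
  define \<nu> where "\<nu> = interval_measure f"
  have sets_\<nu> [simp]: "sets \<nu> = sets borel" by (simp add: \<nu>_def)
  have \<nu>_Icc: "emeasure \<nu> {a..b} = ennreal (f b - f a)" if "a \<le> b" for a b
    unfolding \<nu>_def using that mono cont by (intro emeasure_interval_measure_Icc) auto
  have \<nu>: "emeasure \<nu> {a<..<b} = ennreal (f b - f a)" if "a < b" for a b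
  proof -
    have "{a} \<union> {b} \<in> null_sets \<nu>"
      using \<nu>_Icc[of a a] \<nu>_Icc[of b b] by (intro null_sets.Un) auto
    then have "emeasure \<nu> ({a..b} - ({a} \<union> {b})) = emeasure \<nu> {a..b}"
      by (intro emeasure_Diff_null_set) auto
    moreover have "{a..b} - ({a} \<union> {b}) = {a<..<b}" by auto
    ultimately show ?thesis using \<nu>_Icc that by simp
  qed
  have "emeasure lborel S < \<infinity>" using S(2) emeasure_bounded_finite by blast
  then obtain m where m: "emeasure lborel S = ennreal m" "m \<ge> 0"
    by (metis ennreal_cases infinity_ennreal_def less_irrefl)
  have step: "q * m \<le> p * (m + \<eta>)" if \<eta>: "\<eta> > 0" for \<eta>
  proof -
    obtain G where G: "open G" "S \<subseteq> G" "emeasure lborel (G - S) < ennreal \<eta>"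
      using outer_regular_lborel[OF S(1) \<eta>] by blast
    have "emeasure lborel G = emeasure lborel S + emeasure lborel (G - S)"
      using G S(1) by (subst plus_emeasure) (auto simp: Un_absorb1)
    also have "\<dots> \<le> ennreal (m + \<eta>)"
      using G(3) m \<eta> by (simp add: ennreal_plus less_imp_le)
    finally have G_le: "emeasure lborel G \<le> ennreal (m + \<eta>)" .
    obtain C where C: "countable C"
      "\<And>a b. (a, b) \<in> C \<Longrightarrow> a < b \<and> {a<..<b} \<subseteq> G \<and> f b - f a < p * (b - a)"
      "disjoint_family_on (\<lambda>(a, b). {a<..<b}) C"
      "S - (\<Union>(a, b)\<in>C. {a<..<b}) \<in> null_sets lebesgue"
      by (rule vitali_open_intervals[OF G(1,2), of "\<lambda>a b. f b - f a < p * (b - a)"])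
        (use low in auto)
    define G1 where "G1 = (\<Union>(a, b)\<in>C. {a<..<b})"
    have G1: "open G1" "G1 \<subseteq> G" unfolding G1_def using C(2) by auto
    obtain D where D: "countable D"
      "\<And>a b. (a, b) \<in> D \<Longrightarrow> a < b \<and> {a<..<b} \<subseteq> G1 \<and> q * (b - a) < f b - f a"
      "disjoint_family_on (\<lambda>(a, b). {a<..<b}) D"
      "S \<inter> G1 - (\<Union>(a, b)\<in>D. {a<..<b}) \<in> null_sets lebesgue"
      by (rule vitali_open_intervals[OF G1(1), of "S \<inter> G1" "\<lambda>a b. q * (b - a) < f b - f a"])
        (use high in auto)
    define G2 where "G2 = (\<Union>(a, b)\<in>D. {a<..<b})"
    have G2: "open G2" "G2 \<subseteq> G1" unfolding G2_def using D(2) by auto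
    have bor: "G1 \<in> sets borel" "G2 \<in> sets borel" using G1 G2 by auto
    have "(S - G1) \<union> (S \<inter> G1 - G2) \<in> null_sets lebesgue"
      using C(4) D(4) unfolding G1_def G2_def by (rule null_sets.Un)
    moreover have "(S - G1) \<union> (S \<inter> G1 - G2) = S - G2" using G2 by auto
    ultimately have "S - G2 \<in> null_sets lborel"
      using S(1) bor null_sets_completion_iff[of "S - G2" lborel] by auto
    then have "emeasure lborel (S - (S - G2)) = emeasure lborel S"
      using S(1) by (intro emeasure_Diff_null_set) auto
    moreover have "emeasure lborel (S - (S - G2)) \<le> emeasure lborel G2"
      using bor by (intro emeasure_mono) auto
    ultimately have m_le: "ennreal m \<le> emeasure lborel G2" using m by simp
    have sum: "emeasure M (\<Union>(a, b)\<in>X. {a<..<b}) = (\<integral>\<^sup>+(a, b). emeasure M {a<..<b} \<partial>count_space X)"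
      if "countable X" "disjoint_family_on (\<lambda>(a, b). {a<..<b::real}) X" "sets M = sets borel" for M X
      using that by (subst emeasure_UN_countable) (auto simp: case_prod_beta')
    have "ennreal q * ennreal m \<le> ennreal q * emeasure lborel G2"
      using m_le by (intro mult_left_mono) auto
    also have "\<dots> = (\<integral>\<^sup>+(a, b). ennreal q * emeasure lborel {a<..<b} \<partial>count_space D)"
      unfolding G2_def using D by (subst sum) (auto simp: nn_integral_cmult case_prod_beta')
    also have "\<dots> \<le> (\<integral>\<^sup>+(a, b). emeasure \<nu> {a<..<b} \<partial>count_space D)"
    proof (rule nn_integral_mono, clarsimp, goal_cases)
      case (1 a b)
      then have *: "a < b" "q * (b - a) < f b - f a" using D(2) by auto
      then show ?case using pq by (simp add: \<nu> ennreal_mult'[symmetric] ennreal_leI less_imp_le)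
    qed
    also have "\<dots> = emeasure \<nu> G2" unfolding G2_def using D by (subst sum) auto
    also have "\<dots> \<le> emeasure \<nu> G1" using G2 bor by (intro emeasure_mono) auto
    also have "\<dots> = (\<integral>\<^sup>+(a, b). emeasure \<nu> {a<..<b} \<partial>count_space C)"
      unfolding G1_def using C by (subst sum) auto
    also have "\<dots> \<le> (\<integral>\<^sup>+(a, b). ennreal p * emeasure lborel {a<..<b} \<partial>count_space C)"
    proof (rule nn_integral_mono, clarsimp, goal_cases)
      case (1 a b)
      then have *: "a < b" "f b - f a < p * (b - a)" using C(2) by auto
      then show ?case using pq by (simp add: \<nu> ennreal_mult'[symmetric] ennreal_leI less_imp_le)
    qed
    also have "\<dots> = ennreal p * emeasure lborel G1"
      unfolding G1_def using C by (subst sum) (auto simp: nn_integral_cmult case_prod_beta')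
    also have "\<dots> \<le> ennreal p * emeasure lborel G"
      using G1 G by (intro mult_left_mono emeasure_mono) auto
    also have "\<dots> \<le> ennreal p * ennreal (m + \<eta>)"
      using G_le by (intro mult_left_mono) auto
    finally have "ennreal (q * m) \<le> ennreal (p * (m + \<eta>))"
      using pq m \<eta> by (simp only: ennreal_mult)
    then show ?thesis using pq m \<eta> by (subst (asm) ennreal_le_iff) auto
  qed
  have "q * m \<le> p * m"
  proof (rule field_le_epsilon)
    fix e :: real assume "e > 0"
    then show "q * m \<le> p * m + e" using step[of "e / p"] pq by (simp add: distrib_left)
  qed
  then have "(q - p) * m \<le> 0" by (simp add: algebra_simps)
  then have "m = 0" using pq m(2) by (simp add: mult_le_0_iff)
  then show ?thesis using m by simp
qed

text \<open>The increments are taken over segments that contain \<open>z\<close> in their interior. The condition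
  at each scale is then open in \<open>z\<close>, so the set is a \<open>G\<^sub>\<delta>\<close> and measurability is immediate; for continuous
  \<open>U\<close> nothing is lost in comparison with one-sided difference quotients.\<close>
definition steep :: "('a::euclidean_space \<Rightarrow> real) \<Rightarrow> 'a \<Rightarrow> real \<Rightarrow> 'a set" where
  "steep U e q = {z. \<forall>n. \<exists>c d. c < 0 \<and> 0 < d \<and> d - c < inverse (real (Suc n)) \<and>
     q * (d - c) < U (z + d *\<^sub>R e) - U (z + c *\<^sub>R e)}"

lemma steep_borel:
  assumes "continuous_on UNIV U"
  shows "steep U e q \<in> sets borel"
proof -
  have shift: "continuous_on UNIV (\<lambda>z. U (z + d *\<^sub>R e))" for d
    by (rule continuous_on_compose2[OF assms]) (auto intro!: continuous_intros)
  have "steep U e q = (\<Inter>n. {z. \<exists>c d. c < 0 \<and> 0 < d \<and> d - c < inverse (real (Suc n)) \<and>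
     q * (d - c) < U (z + d *\<^sub>R e) - U (z + c *\<^sub>R e)})"
    unfolding steep_def by (rule Collect_all_eq)
  also have "\<dots> \<in> sets borel"
    by (intro sets.countable_INT'' borel_open open_Collect_ex open_Collect_conj open_Collect_const
        open_Collect_less continuous_intros shift) auto
  finally show ?thesis .
qed

text \<open>A form of Fubini's theorem that does not depend on coordinates: the measure of \<open>N\<close> equals the
  measure of each translate by \<open>t *\<^sub>R e\<close>, hence also their average over \<open>t \<in> [0,1]\<close>, and
  exchanging the integrals measures \<open>N\<close> along lines in direction \<open>e\<close>.\<close>
lemma null_set_by_lines:
  fixes N :: "'a::euclidean_space set"
  assumes N [measurable]: "N \<in> sets borel" and "\<And>z. AE t in lborel. z + t *\<^sub>R e \<notin> N"
  shows "N \<in> null_sets lborel"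
proof -
  have trans: "(\<integral>\<^sup>+z. indicator N (z + t *\<^sub>R e) \<partial>lborel) = emeasure lborel N" for t
  proof -
    have "emeasure lborel N = (\<integral>\<^sup>+z. indicator N z \<partial>distr lborel borel ((+) (t *\<^sub>R e)))"
      by (subst lborel_distr_plus) simp
    also have "\<dots> = (\<integral>\<^sup>+z. indicator N (t *\<^sub>R e + z) \<partial>lborel)"
      by (subst nn_integral_distr) auto
    finally show ?thesis by (simp add: add.commute)
  qed
  have "emeasure lborel N = (\<integral>\<^sup>+t. emeasure lborel N * indicator {0..1::real} t \<partial>lborel)"
    by (simp add: nn_integral_cmult_indicator)
  also have "\<dots> = (\<integral>\<^sup>+t. (\<integral>\<^sup>+z. indicator N (z + t *\<^sub>R e) * indicator {0..1} t \<partial>lborel) \<partial>lborel)"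
    by (subst nn_integral_multc) (auto simp: trans)
  also have "\<dots> = (\<integral>\<^sup>+z. (\<integral>\<^sup>+t. indicator N (z + t *\<^sub>R e) * indicator {0..1} t \<partial>lborel) \<partial>lborel)"
    by (rule lborel_pair.Fubini'[symmetric]) measurable
  also have "\<dots> = (\<integral>\<^sup>+(z::'a). 0 \<partial>lborel)"
  proof (rule nn_integral_cong)
    fix z
    have "(\<integral>\<^sup>+t. indicator N (z + t *\<^sub>R e) * indicator {0..1} t \<partial>lborel) = (\<integral>\<^sup>+(t::real). 0 \<partial>lborel)"
      using assms(2)[of z] by (intro nn_integral_cong_AE) auto
    then show "(\<integral>\<^sup>+t. indicator N (z + t *\<^sub>R e) * indicator {0..1} t \<partial>lborel) = 0" by simp
  qed
  finally show ?thesis using N by (auto simp: null_sets_def)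
qed

lemma steep_gap_null:
  fixes U :: "'a::euclidean_space \<Rightarrow> real"
  assumes lip: "L-lipschitz_on UNIV U" and pq: "p < q"
  shows "steep U e q \<inter> steep (\<lambda>z. - U z) e (- p) \<in> null_sets lborel"
proof (rule null_set_by_lines[where e = e])
  have cont: "continuous_on UNIV U" using lip by (rule lipschitz_on_continuous_on)
  let ?N = "steep U e q \<inter> steep (\<lambda>z. - U z) e (- p)"
  show N: "?N \<in> sets borel"
    using cont by (intro sets.Int steep_borel continuous_intros) auto
  fix z
(* The linear term makes the restriction of U to the line monotone and the lower slope positive. *)
  define K where "K = L * norm e + \<bar>p\<bar> + 1"
  define f where "f t = U (z + t *\<^sub>R e) + K * t" for t
  have f_diff: "f b - f a = (U (z + b *\<^sub>R e) - U (z + a *\<^sub>R e)) + K * (b - a)" for a b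
    by (simp add: f_def algebra_simps)
  have mono: "f x \<le> f y" if "x \<le> y" for x y
  proof -
    have "\<bar>U (z + x *\<^sub>R e) - U (z + y *\<^sub>R e)\<bar> \<le> L * dist (z + x *\<^sub>R e) (z + y *\<^sub>R e)"
      using lipschitz_onD[OF lip, of "z + x *\<^sub>R e" "z + y *\<^sub>R e"] by (simp add: dist_real_def)
    also have "dist (z + x *\<^sub>R e) (z + y *\<^sub>R e) = (y - x) * norm e"
      using that by (simp add: dist_norm scaleR_diff_left[symmetric])
    also have "L * ((y - x) * norm e) \<le> K * (y - x)"
      using that mult_right_mono[of x y "\<bar>p\<bar>"] by (simp add: K_def algebra_simps)
    finally show ?thesis using f_diff[of y x] by linarith
  qed
  have contf: "continuous_on UNIV f"
    unfolding f_def
    by (intro continuous_on_add continuous_on_compose2[OF cont, of UNIV "\<lambda>t. z + t *\<^sub>R e"]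
        continuous_intros) auto
  let ?S = "{t. z + t *\<^sub>R e \<in> ?N}"
  have S: "?S \<in> sets borel"
  proof -
    have "(\<lambda>t. z + t *\<^sub>R e) -` ?N \<inter> space borel \<in> sets borel"
      using N by (intro measurable_sets[of _ borel borel]) auto
    then show ?thesis by (simp add: vimage_def)
  qed
  have "emeasure lborel (?S \<inter> {-real n..real n}) = 0" for n
  proof (rule null_set_between_slopes[OF mono contf, where p = "p + K" and q = "q + K"])
    have L: "L \<ge> 0" using lip by (rule lipschitz_on_nonneg)
    show "0 < p + K" using L by (simp add: K_def add_nonneg_pos)
        (smt (verit) mult_nonneg_nonneg norm_ge_zero)
    fix x \<delta> :: real assume x: "x \<in> ?S \<inter> {-real n..real n}" and \<delta>: "\<delta> > 0"
    obtain k where k: "inverse (real (Suc k)) < \<delta>" using reals_Archimedean[OF \<delta>] by blast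
    have sh: "z + x *\<^sub>R e + c *\<^sub>R e = z + (x + c) *\<^sub>R e" for c by (simp add: algebra_simps)
    {
      obtain c d where "c < 0" "0 < d" "d - c < inverse (real (Suc k))"
         "q * (d - c) < U (z + (x + d) *\<^sub>R e) - U (z + (x + c) *\<^sub>R e)"
        using x unfolding steep_def Int_iff mem_Collect_eq sh by blast
      then have "x + c < x \<and> x < x + d \<and> (x + d) - (x + c) < \<delta> \<and>
         (q + K) * ((x + d) - (x + c)) < f (x + d) - f (x + c)"
        using k f_diff[of "x + d" "x + c"] by (auto simp: algebra_simps)
      then show "\<exists>a b. a < x \<and> x < b \<and> b - a < \<delta> \<and> (q + K) * (b - a) < f b - f a" by blast
    }
    {
      obtain c d where "c < 0" "0 < d" "d - c < inverse (real (Suc k))"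
         "- p * (d - c) < - U (z + (x + d) *\<^sub>R e) - - U (z + (x + c) *\<^sub>R e)"
        using x unfolding steep_def Int_iff mem_Collect_eq sh by blast
      then have "x + c < x \<and> x < x + d \<and> (x + d) - (x + c) < \<delta> \<and>
         f (x + d) - f (x + c) < (p + K) * ((x + d) - (x + c))"
        using k f_diff[of "x + d" "x + c"] by (auto simp: algebra_simps)
      then show "\<exists>a b. a < x \<and> x < b \<and> b - a < \<delta> \<and> f b - f a < (p + K) * (b - a)" by blast
    }
  qed (use S pq bounded_Int in auto)
  then have "(\<Union>n. ?S \<inter> {-real n..real n}) \<in> null_sets lborel"
    using S by (intro null_sets_UN) auto
  moreover have "(\<Union>n. ?S \<inter> {-real n..real n}) = ?S"
  proof -
    have "\<exists>n. x \<in> {-real n..real n}" for x :: real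
      using real_arch_simple[of "\<bar>x\<bar>"] by (auto simp: abs_le_iff) (smt (verit))
    then show ?thesis by blast
  qed
  ultimately have "?S \<in> null_sets lborel" by simp
  from AE_not_in[OF this] show "AE t in lborel. z + t *\<^sub>R e \<notin> ?N" by simp
qed

text \<open>The derivative is the supremum of the slopes that are exceeded at arbitrarily small scales. Slopes
  above it are not exceeded eventually; slopes below it are not undercut eventually, because
  otherwise two rational slopes in between would form a gap.\<close>
lemma has_derivative_of_no_steep_gap:
  fixes U :: "'a::euclidean_space \<Rightarrow> real"
  assumes lip: "L-lipschitz_on UNIV U"
    and gap: "\<And>p q. p \<in> \<rat> \<Longrightarrow> q \<in> \<rat> \<Longrightarrow> p < q \<Longrightarrow> z \<notin> steep U e q \<inter> steep (\<lambda>z. - U z) e (- p)"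
  shows "\<exists>D. ((\<lambda>t. U (z + t *\<^sub>R e)) has_real_derivative D) (at 0)"
proof -
  define g where "g t = U (z + t *\<^sub>R e)" for t
  define A where "A = {q. z \<in> steep U e q}"
  have gl: "\<bar>g d - g c\<bar> \<le> L * norm e * (d - c)" if "c \<le> d" for c d
  proof -
    have "\<bar>g d - g c\<bar> \<le> L * dist (z + d *\<^sub>R e) (z + c *\<^sub>R e)"
      using lipschitz_onD[OF lip, of "z + d *\<^sub>R e" "z + c *\<^sub>R e"] by (simp add: dist_real_def g_def)
    also have "dist (z + d *\<^sub>R e) (z + c *\<^sub>R e) = (d - c) * norm e"
      using that by (simp add: dist_norm scaleR_diff_left[symmetric])
    finally show ?thesis by (simp add: mult_ac)
  qed
  have steepD: "\<exists>n. \<forall>c d. c < 0 \<longrightarrow> 0 < d \<longrightarrow> d - c < inverse (real (Suc n)) \<longrightarrow> g d - g c \<le> q * (d - c)"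
    if "q \<notin> A" for q
    using that unfolding A_def steep_def g_def mem_Collect_eq by (meson not_le)
  have steepD': "\<exists>n. \<forall>c d. c < 0 \<longrightarrow> 0 < d \<longrightarrow> d - c < inverse (real (Suc n)) \<longrightarrow> p * (d - c) \<le> g d - g c"
    if ns: "z \<notin> steep (\<lambda>z. - U z) e (- p)" for p
  proof -
    obtain n where n: "\<And>c d. c < 0 \<Longrightarrow> 0 < d \<Longrightarrow> d - c < inverse (real (Suc n)) \<Longrightarrow>
        \<not> - p * (d - c) < - U (z + d *\<^sub>R e) - - U (z + c *\<^sub>R e)"
      using ns unfolding steep_def mem_Collect_eq by blast
    have "p * (d - c) \<le> g d - g c" if "c < 0" "0 < d" "d - c < inverse (real (Suc n))" for c d
      using n[OF that] by (simp add: g_def)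
    then show ?thesis by blast
  qed
  have bd: "q \<le> L * norm e" if "q \<in> A" for q
  proof -
    obtain c d where "c < 0" "0 < d" "q * (d - c) < g d - g c"
      using \<open>q \<in> A\<close> by (auto simp: A_def steep_def g_def)
    then have "q * (d - c) < L * norm e * (d - c)" using gl[of c d] by linarith
    then show ?thesis using \<open>c < 0\<close> \<open>0 < d\<close> by (simp add: mult_less_cancel_right)
  qed
  have ne: "- (L * norm e) - 1 \<in> A"
    unfolding A_def steep_def mem_Collect_eq
  proof
    fix n
    define h where "h = inverse (real (Suc n)) / 3"
    have h: "h > 0" by (simp add: h_def)
    have "\<bar>g h - g (- h)\<bar> \<le> L * norm e * (2 * h)" using gl[of "- h" h] h by simp
    then have "(- (L * norm e) - 1) * (h - - h) < g h - g (- h)" using h by (simp add: algebra_simps)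
    moreover have "h - - h < inverse (real (Suc n))" using h by (simp add: h_def)
    ultimately show "\<exists>c d. c < 0 \<and> 0 < d \<and> d - c < inverse (real (Suc n)) \<and>
      (- (L * norm e) - 1) * (d - c) < U (z + d *\<^sub>R e) - U (z + c *\<^sub>R e)"
      using h by (intro exI[of _ "- h"] exI[of _ h]) (auto simp: g_def)
  qed
  have bdd: "bdd_above A" using bd by (rule bdd_aboveI)
  define D where "D = Sup A"
  have down: "p \<in> A" if "q \<in> A" "p \<le> q" for p q
    unfolding A_def steep_def mem_Collect_eq
  proof
    fix n
    obtain c d where cd: "c < 0" "0 < d" "d - c < inverse (real (Suc n))" "q * (d - c) < g d - g c"
      using \<open>q \<in> A\<close> unfolding A_def steep_def g_def mem_Collect_eq by blast
    have "p * (d - c) \<le> q * (d - c)" using that cd by (intro mult_right_mono) auto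
    then have "p * (d - c) < g d - g c" using cd(4) by linarith
    with cd show "\<exists>c d. c < 0 \<and> 0 < d \<and> d - c < inverse (real (Suc n)) \<and>
        p * (d - c) < U (z + d *\<^sub>R e) - U (z + c *\<^sub>R e)" unfolding g_def by blast
  qed
  have main: "\<exists>\<delta>>0. \<forall>c d. c < 0 \<longrightarrow> 0 < d \<longrightarrow> d - c < \<delta> \<longrightarrow> \<bar>g d - g c - D * (d - c)\<bar> \<le> \<epsilon> * (d - c)"
    if \<epsilon>: "\<epsilon> > 0" for \<epsilon>
  proof -
    have "D + \<epsilon> \<notin> A" using cSup_upper[OF _ bdd, of "D + \<epsilon>"] \<epsilon> by (auto simp: D_def)
    then obtain n where n: "\<And>c d. c < 0 \<Longrightarrow> 0 < d \<Longrightarrow> d - c < inverse (real (Suc n)) \<Longrightarrow>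
        g d - g c \<le> (D + \<epsilon>) * (d - c)" using steepD by blast
    obtain q' where q': "q' \<in> A" "D - \<epsilon> / 2 < q'"
      using less_cSupE[of "D - \<epsilon> / 2" A] ne \<epsilon> by (auto simp: D_def)
    obtain p where p: "p \<in> \<rat>" "D - \<epsilon> < p" "p < D - \<epsilon> / 2"
      using Rats_dense_in_real[of "D - \<epsilon>" "D - \<epsilon> / 2"] \<epsilon> by auto
    obtain q where q: "q \<in> \<rat>" "D - \<epsilon> / 2 < q" "q < q'"
      using Rats_dense_in_real[OF q'(2)] by auto
    have "q \<in> A" using down[OF q'(1), of q] q by simp
    then have "z \<notin> steep (\<lambda>z. - U z) e (- p)" using gap[OF p(1) q(1)] p q by (auto simp: A_def)
    then obtain k where k: "\<And>c d. c < 0 \<Longrightarrow> 0 < d \<Longrightarrow> d - c < inverse (real (Suc k)) \<Longrightarrow>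
        p * (d - c) \<le> g d - g c" using steepD' by blast
    show ?thesis
    proof (intro exI[of _ "min (inverse (real (Suc n))) (inverse (real (Suc k)))"] conjI allI impI)
      fix c d :: real
      assume cd: "c < 0" "0 < d" "d - c < min (inverse (real (Suc n))) (inverse (real (Suc k)))"
      have "(D - \<epsilon>) * (d - c) \<le> p * (d - c)" using p cd by (intro mult_right_mono) auto
      with n[of c d] k[of c d] cd show "\<bar>g d - g c - D * (d - c)\<bar> \<le> \<epsilon> * (d - c)"
        by (auto simp: abs_le_iff algebra_simps)
    qed auto
  qed
  have contg: "continuous_on UNIV g"
    unfolding g_def
    by (rule continuous_on_compose2[OF lipschitz_on_continuous_on[OF lip]])
      (auto intro!: continuous_intros)
  have lim0: "(g \<longlongrightarrow> g 0) (at 0 within S)" for S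
    using contg by (meson UNIV_I continuous_on_def subset_UNIV tendsto_within_subset)
(* One end of the segment tends to the point itself, which turns straddling increments into ordinary ones. *)
  have est: "\<exists>\<delta>>0. \<forall>h. \<bar>h\<bar> < \<delta> \<longrightarrow> \<bar>g h - g 0 - D * h\<bar> \<le> \<epsilon> * \<bar>h\<bar>" if \<epsilon>: "\<epsilon> > 0" for \<epsilon>
  proof -
    obtain \<delta> where \<delta>: "\<delta> > 0" "\<And>c d. c < 0 \<Longrightarrow> 0 < d \<Longrightarrow> d - c < \<delta> \<Longrightarrow>
       \<bar>g d - g c - D * (d - c)\<bar> \<le> \<epsilon> * (d - c)" using main[OF \<epsilon>] by blast
    have pos: "\<bar>g h - g 0 - D * h\<bar> \<le> \<epsilon> * h" if h: "0 < h" "h < \<delta>" for h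
    proof (rule tendsto_le[of "at_left 0"])
      show "((\<lambda>c. \<bar>g h - g c - D * (h - c)\<bar>) \<longlongrightarrow> \<bar>g h - g 0 - D * h\<bar>) (at_left 0)"
        by (rule tendsto_eq_intros lim0 refl | simp)+
      show "((\<lambda>c. \<epsilon> * (h - c)) \<longlongrightarrow> \<epsilon> * h) (at_left 0)"
        by (rule tendsto_eq_intros refl | simp)+
      show "\<forall>\<^sub>F c in at_left 0. \<bar>g h - g c - D * (h - c)\<bar> \<le> \<epsilon> * (h - c)"
        using h eventually_at_left_real[of "h - \<delta>" 0]
        by (auto elim!: eventually_mono intro!: \<delta>(2))
    qed auto
    have neg: "\<bar>g 0 - g h - D * (0 - h)\<bar> \<le> \<epsilon> * (0 - h)" if h: "h < 0" "- h < \<delta>" for h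
    proof (rule tendsto_le[of "at_right 0"])
      show "((\<lambda>c. \<bar>g c - g h - D * (c - h)\<bar>) \<longlongrightarrow> \<bar>g 0 - g h - D * (0 - h)\<bar>) (at_right 0)"
        by (rule tendsto_eq_intros lim0 refl | simp)+
      show "((\<lambda>c. \<epsilon> * (c - h)) \<longlongrightarrow> \<epsilon> * (0 - h)) (at_right 0)"
        by (rule tendsto_eq_intros refl | simp)+
      show "\<forall>\<^sub>F c in at_right 0. \<bar>g c - g h - D * (c - h)\<bar> \<le> \<epsilon> * (c - h)"
        using h eventually_at_right_real[of 0 "h + \<delta>"]
        by (auto elim!: eventually_mono intro!: \<delta>(2))
    qed auto
    show ?thesis
    proof (intro exI[of _ \<delta>] conjI allI impI)
      fix h assume "\<bar>h\<bar> < \<delta>"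
      then show "\<bar>g h - g 0 - D * h\<bar> \<le> \<epsilon> * \<bar>h\<bar>"
        using pos[of h] neg[of h] by (cases "h = 0"; cases "h > 0") (auto simp: abs_if split: if_splits)
    qed (rule \<delta>(1))
  qed
  have "(g has_real_derivative D) (at 0)"
    unfolding has_field_derivative_def has_derivative_at_alt
    using est by (auto simp: bounded_linear_mult_right mult.commute)
  then show ?thesis unfolding g_def by blast
qed

lemma lipschitz_AE_directional_derivative:
  fixes U :: "'a::euclidean_space \<Rightarrow> real"
  assumes lip: "L-lipschitz_on UNIV U"
  shows "AE z in lborel. \<exists>D. ((\<lambda>t. U (z + t *\<^sub>R e)) has_real_derivative D) (at 0)"
proof -
  let ?N = "\<lambda>p q. steep U e q \<inter> steep (\<lambda>z. - U z) e (- p)"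
  have "AE z in lborel. \<forall>p\<in>\<rat>. \<forall>q\<in>\<rat>. p < q \<longrightarrow> z \<notin> ?N p q"
    using steep_gap_null[OF lip]
    by (subst AE_ball_countable[OF countable_rat], intro ballI)+
      (intro AE_impI AE_not_in)
  then show ?thesis
    by (rule AE_mp) (auto intro!: AE_I2 has_derivative_of_no_steep_gap[OF lip])
qed

section \<open>Integration by parts on a ball\<close>

abbreviation dir_deriv :: "('a::real_normed_vector \<Rightarrow> real) \<Rightarrow> 'a \<Rightarrow> 'a \<Rightarrow> real" where
  "dir_deriv U e z \<equiv> deriv (\<lambda>t. U (z + t *\<^sub>R e)) 0"

lemma lipschitz_dir_deriv_bound:
  assumes lip: "L-lipschitz_on UNIV U"
    and D: "((\<lambda>t. U (z + t *\<^sub>R e)) has_real_derivative D) (at 0)"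
  shows "\<bar>D\<bar> \<le> L * norm e"
proof -
  have "((\<lambda>t. (U (z + t *\<^sub>R e) - U z) / t) \<longlongrightarrow> D) (at 0)"
    using D by (simp add: has_field_derivative_iff)
  then have "((\<lambda>t. \<bar>(U (z + t *\<^sub>R e) - U z) / t\<bar>) \<longlongrightarrow> \<bar>D\<bar>) (at 0)"
    by (rule tendsto_rabs)
  moreover have "\<bar>(U (z + t *\<^sub>R e) - U z) / t\<bar> \<le> L * norm e" if "t \<noteq> 0" for t
  proof -
    have "\<bar>U (z + t *\<^sub>R e) - U z\<bar> \<le> L * (\<bar>t\<bar> * norm e)"
      using lipschitz_onD[OF lip, of "z + t *\<^sub>R e" z] by (simp add: dist_norm)
    then show ?thesis using that by (simp add: field_simps)
  qed
  ultimately show ?thesis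
    by (intro tendsto_upperbound[of _ "\<bar>D\<bar>" "at 0"]) (auto simp: eventually_at_filter)
qed

lemma difference_quotients_tendsto:
  fixes U :: "'a::real_normed_vector \<Rightarrow> real"
  assumes D: "((\<lambda>t. U (z + t *\<^sub>R e)) has_real_derivative D) (at 0)"
  shows "(\<lambda>n. (U (z + inverse (real (Suc n)) *\<^sub>R e) - U z) * real (Suc n)) \<longlonglongrightarrow> D"
proof -
  have "((\<lambda>t. (U (z + t *\<^sub>R e) - U z) / t) \<longlongrightarrow> D) (at 0)"
    using D by (simp add: has_field_derivative_iff)
  moreover have "filterlim (\<lambda>n. inverse (real (Suc n))) (at 0) sequentially"
    unfolding filterlim_at using LIMSEQ_inverse_real_of_nat by auto
  ultimately have "(\<lambda>n. (U (z + inverse (real (Suc n)) *\<^sub>R e) - U z) / inverse (real (Suc n))) \<longlonglongrightarrow> D"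
    by (rule filterlim_compose)
  then show ?thesis by (simp add: divide_inverse)
qed

lemma lipschitz_dir_deriv_measurable:
  fixes U :: "'a::euclidean_space \<Rightarrow> real"
  assumes lip: "L-lipschitz_on UNIV U"
  shows "dir_deriv U e \<in> borel_measurable lebesgue"
proof -
  have [measurable]: "U \<in> borel_measurable borel"
    using lipschitz_on_continuous_on[OF lip] by (rule borel_measurable_continuous_onI)
  have "(\<lambda>z. lim (\<lambda>n. (U (z + inverse (real (Suc n)) *\<^sub>R e) - U z) * real (Suc n))) \<in> borel_measurable lborel"
    by measurable
  then have "(\<lambda>z. lim (\<lambda>n. (U (z + inverse (real (Suc n)) *\<^sub>R e) - U z) * real (Suc n))) \<in> borel_measurable lebesgue"
    by (rule measurable_completion)
  then show ?thesis
  proof (rule borel_measurable_AE)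
    show "AE z in lebesgue. lim (\<lambda>n. (U (z + inverse (real (Suc n)) *\<^sub>R e) - U z) * real (Suc n)) = dir_deriv U e z"
      using AE_completion[OF lipschitz_AE_directional_derivative[OF lip, of e]]
    proof eventually_elim
      case (elim z)
      then obtain D where D: "((\<lambda>t. U (z + t *\<^sub>R e)) has_real_derivative D) (at 0)" by blast
      show ?case using limI[OF difference_quotients_tendsto[OF D]] DERIV_imp_deriv[OF D] by simp
    qed
  qed
qed

text \<open>Difference quotients have integral zero by translation invariance, and they converge boundedly to
  the derivative.\<close>
lemma integral_dir_deriv_zero:
  fixes W :: "'a::euclidean_space \<Rightarrow> real"
  assumes lip: "L-lipschitz_on UNIV W" and supp: "\<And>z. R < norm z \<Longrightarrow> W z = 0"
  shows "integral\<^sup>L lebesgue (dir_deriv W e) = 0"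
proof -
  define s where "s n z = (W (z + inverse (real (Suc n)) *\<^sub>R e) - W z) * real (Suc n)" for n z
  have L: "L \<ge> 0" using lip by (rule lipschitz_on_nonneg)
  have [measurable]: "W \<in> borel_measurable borel"
    using lipschitz_on_continuous_on[OF lip] by (rule borel_measurable_continuous_onI)
  have intW: "integrable lborel W"
  proof -
    have "integrable lborel (\<lambda>z. indicator (cball 0 R) z *\<^sub>R W z)"
      by (intro borel_integrable_compact continuous_on_subset[OF lipschitz_on_continuous_on[OF lip]]) auto
    also have "(\<lambda>z. indicator (cball 0 R) z *\<^sub>R W z) = W"
      using supp by (auto simp: fun_eq_iff indicator_def not_le)
    finally show ?thesis .
  qed
  have shift: "integrable lborel (\<lambda>z. W (z + v))" "(\<integral>z. W (z + v) \<partial>lborel) = (\<integral>z. W z \<partial>lborel)" for v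
  proof -
    have "integrable (distr lborel borel ((+) v)) W" using intW by (simp add: lborel_distr_plus)
    then show "integrable lborel (\<lambda>z. W (z + v))"
      by (subst (asm) integrable_distr_eq) (auto simp: add.commute)
    have "(\<integral>z. W z \<partial>distr lborel borel ((+) v)) = (\<integral>z. W (z + v) \<partial>lborel)"
      by (subst integral_distr) (auto simp: add.commute)
    then show "(\<integral>z. W (z + v) \<partial>lborel) = (\<integral>z. W z \<partial>lborel)" by (simp add: lborel_distr_plus)
  qed
  have s_meas: "s n \<in> borel_measurable lborel" for n unfolding s_def by measurable
  have s0: "integral\<^sup>L lebesgue (s n) = 0" for n
  proof -
    have "integral\<^sup>L lebesgue (s n) = integral\<^sup>L lborel (s n)"
      using s_meas by (intro integral_completion) auto
    also have "\<dots> = 0" unfolding s_def using shift intW by simp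
    finally show ?thesis .
  qed
  have bound: "norm (s n z) \<le> L * norm e * indicator (cball 0 (R + norm e)) z" for n z
  proof (cases "z \<in> cball 0 (R + norm e)")
    case True
    have "\<bar>W (z + inverse (real (Suc n)) *\<^sub>R e) - W z\<bar> \<le> L * (inverse (real (Suc n)) * norm e)"
      using lipschitz_onD[OF lip, of "z + inverse (real (Suc n)) *\<^sub>R e" z] by (simp add: dist_norm)
    then have "\<bar>W (z + inverse (real (Suc n)) *\<^sub>R e) - W z\<bar> * real (Suc n)
        \<le> L * (inverse (real (Suc n)) * norm e) * real (Suc n)" by (rule mult_right_mono) simp
    also have "\<dots> = L * norm e" by (simp add: field_simps)
    finally show ?thesis using True by (simp add: s_def abs_mult)
  next
    case False
    then have z: "norm z > R + norm e" by simp
    have "norm (inverse (real (Suc n)) *\<^sub>R e) \<le> norm e"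
      by (simp add: mult_left_le_one_le inverse_le_1_iff)
    moreover have "norm z \<le> norm (z + inverse (real (Suc n)) *\<^sub>R e) + norm (inverse (real (Suc n)) *\<^sub>R e)"
      by (metis add_diff_cancel_right' norm_triangle_ineq4)
    ultimately have "norm (z + inverse (real (Suc n)) *\<^sub>R e) > R" using z by linarith
    moreover have "norm z > R" using z norm_ge_zero[of e] by linarith
    ultimately show ?thesis using supp L by (simp add: s_def indicator_def)
  qed
  have "(\<lambda>n. integral\<^sup>L lebesgue (s n)) \<longlonglongrightarrow> integral\<^sup>L lebesgue (dir_deriv W e)"
  proof (rule integral_dominated_convergence)
    show "dir_deriv W e \<in> borel_measurable lebesgue" using lip by (rule lipschitz_dir_deriv_measurable)
    show "s n \<in> borel_measurable lebesgue" for n using s_meas by (rule measurable_completion)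
    show "integrable lebesgue (\<lambda>z::'a. L * norm e * indicator (cball 0 (R + norm e)) z)"
      by (intro integrable_mult_right integrable_real_indicator)
        (use emeasure_lborel_cball_finite[of "0::'a" "R + norm e"] in auto)
    show "AE z in lebesgue. (\<lambda>n. s n z) \<longlonglongrightarrow> dir_deriv W e z"
      using AE_completion[OF lipschitz_AE_directional_derivative[OF lip, of e]]
    proof eventually_elim
      case (elim z)
      then obtain D where D: "((\<lambda>t. W (z + t *\<^sub>R e)) has_real_derivative D) (at 0)" by blast
      show ?case
        using difference_quotients_tendsto[OF D] DERIV_imp_deriv[OF D] unfolding s_def by simp
    qed
  qed (use bound in auto)
  then show ?thesis by (simp add: s0 LIMSEQ_const_iff)
qed

text \<open>The competitors for the capacity before the condition on the set is imposed. General balls are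
  allowed because the mass of the Green density near a point is computed on a small disk.\<close>
definition lipschitz_vanishing :: "'a::euclidean_space \<Rightarrow> real \<Rightarrow> ('a \<Rightarrow> real) set" where
  "lipschitz_vanishing c r = {u. (\<exists>L. L-lipschitz_on (cball c r) u) \<and> (\<forall>z\<in>sphere c r. u z = 0)}"

lemma lipschitz_zero_extension:
  fixes u :: "'a::euclidean_space \<Rightarrow> real"
  assumes lip: "L-lipschitz_on (cball c r) u" and zero: "\<forall>z\<in>sphere c r. u z = 0"
  shows "L-lipschitz_on UNIV (\<lambda>z. if z \<in> cball c r then u z else 0)" (is "L-lipschitz_on _ ?U")
proof (rule lipschitz_onI)
  show "0 \<le> L" using lip by (rule lipschitz_on_nonneg)
  have out: "dist (u x) 0 \<le> L * dist x y" if xy: "x \<in> cball c r" "y \<notin> cball c r" for x y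
  proof -
    have "closed_segment x y \<inter> frontier (cball c r) \<noteq> {}"
      using xy by (intro connected_Int_frontier) auto
    then obtain b where b: "b \<in> closed_segment x y" "b \<in> sphere c r"
      unfolding frontier_cball by blast
    have "dist (u x) (u b) \<le> L * dist x b"
      using b xy by (intro lipschitz_onD[OF lip]) auto
    also have "\<dots> \<le> L * dist x y"
      using b(1) segment_bound[OF b(1)] \<open>0 \<le> L\<close>
      by (intro mult_left_mono) (auto simp: dist_norm norm_minus_commute)
    finally show ?thesis using zero b(2) by simp
  qed
  fix x y
  show "dist (?U x) (?U y) \<le> L * dist x y"
    using lipschitz_onD[OF lip, of x y] out[of x y] out[of y x] \<open>0 \<le> L\<close>
    by (auto simp: dist_commute)
qed

lemma eventually_line_in_ball:
  fixes z :: "'a::real_normed_vector"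
  assumes "z \<in> ball c r"
  shows "\<forall>\<^sub>F t in nhds 0. z + t *\<^sub>R e \<in> ball c r"
proof -
  have "((\<lambda>t. z + t *\<^sub>R e) \<longlongrightarrow> z + 0 *\<^sub>R e) (nhds 0)" by (intro tendsto_intros filterlim_ident)
  then show ?thesis using assms by (auto dest: topological_tendstoD)
qed

lemma DERIV_line_cong:
  fixes z :: "'a::real_normed_vector" and U V :: "'a \<Rightarrow> real"
  assumes "z \<in> ball c r" "\<And>w. w \<in> ball c r \<Longrightarrow> U w = V w"
  shows "((\<lambda>t. U (z + t *\<^sub>R e)) has_real_derivative D) (at 0) \<longleftrightarrow>
         ((\<lambda>t. V (z + t *\<^sub>R e)) has_real_derivative D) (at 0)"
  using eventually_line_in_ball[OF assms(1), of e] assms(2)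
  by (intro DERIV_cong_ev) (auto elim!: eventually_mono)

lemma dir_deriv_cong:
  fixes z :: "'a::real_normed_vector"
  assumes "z \<in> ball c r" "\<And>w. w \<in> ball c r \<Longrightarrow> U w = V w"
  shows "dir_deriv U e z = dir_deriv V e z"
  using eventually_line_in_ball[OF assms(1), of e] assms(2)
  by (intro deriv_cong_ev) (auto elim!: eventually_mono)

lemma lipschitz_vanishing_AE:
  fixes u :: "'a::euclidean_space \<Rightarrow> real"
  assumes lip: "L-lipschitz_on (cball c r) u" and zero: "\<forall>z\<in>sphere c r. u z = 0"
  shows "AE z in lebesgue. z \<in> ball c r \<longrightarrow>
    ((\<lambda>t. u (z + t *\<^sub>R e)) has_real_derivative dir_deriv u e z) (at 0) \<and> \<bar>dir_deriv u e z\<bar> \<le> L * norm e"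
proof -
  have ext: "L-lipschitz_on UNIV (\<lambda>z. if z \<in> cball c r then u z else 0)"
    using lip zero by (rule lipschitz_zero_extension)
  show ?thesis
    using AE_completion[OF lipschitz_AE_directional_derivative[OF ext, of e]]
  proof eventually_elim
    case (elim z)
    then obtain D where D:
      "((\<lambda>t. if z + t *\<^sub>R e \<in> cball c r then u (z + t *\<^sub>R e) else 0) has_real_derivative D) (at 0)" by auto
    show ?case
    proof
      assume z: "z \<in> ball c r"
      have 1: "((\<lambda>t. u (z + t *\<^sub>R e)) has_real_derivative D) (at 0)"
        using D DERIV_line_cong[OF z, of "\<lambda>z. if z \<in> cball c r then u z else 0" u] by auto
      then have "dir_deriv u e z = D" by (rule DERIV_imp_deriv)
      then show "((\<lambda>t. u (z + t *\<^sub>R e)) has_real_derivative dir_deriv u e z) (at 0) \<and>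
          \<bar>dir_deriv u e z\<bar> \<le> L * norm e" using 1 lipschitz_dir_deriv_bound[OF ext D] by simp
    qed
  qed
qed

lemma lipschitz_vanishing_dir_deriv_measurable:
  fixes u :: "'a::euclidean_space \<Rightarrow> real"
  assumes "u \<in> lipschitz_vanishing c r"
  shows "(\<lambda>z. indicator (ball c r) z * dir_deriv u e z) \<in> borel_measurable lebesgue"
proof -
  obtain L where "L-lipschitz_on (cball c r) u" "\<forall>z\<in>sphere c r. u z = 0"
    using assms by (auto simp: lipschitz_vanishing_def)
  then have "L-lipschitz_on UNIV (\<lambda>z. if z \<in> cball c r then u z else 0)"
    by (rule lipschitz_zero_extension)
  then have meas: "(\<lambda>z. indicator (ball c r) z * dir_deriv (\<lambda>z. if z \<in> cball c r then u z else 0) e z)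
      \<in> borel_measurable lebesgue"
    by (intro borel_measurable_times borel_measurable_indicator lipschitz_dir_deriv_measurable) auto
  have "dir_deriv (\<lambda>z. if z \<in> cball c r then u z else 0) e z = dir_deriv u e z" if "z \<in> ball c r" for z
    using that by (rule dir_deriv_cong) auto
  then have "(\<lambda>z. indicator (ball c r) z * dir_deriv (\<lambda>z. if z \<in> cball c r then u z else 0) e z) =
    (\<lambda>z. indicator (ball c r) z * dir_deriv u e z)"
    by (intro ext) (simp add: indicator_def del: mem_ball mem_cball)
  with meas show ?thesis by (simp only:)
qed

lemma lipschitz_vanishing_continuous: "u \<in> lipschitz_vanishing c r \<Longrightarrow> continuous_on (cball c r) u"
  by (auto simp: lipschitz_vanishing_def intro: lipschitz_on_continuous_on)

lemma set_integrable_ball_bounded: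
  fixes f :: "'a::euclidean_space \<Rightarrow> real"
  assumes "(\<lambda>z. indicator (ball c r) z * f z) \<in> borel_measurable lebesgue"
    and "AE z in lebesgue. z \<in> ball c r \<longrightarrow> \<bar>f z\<bar> \<le> B"
  shows "set_integrable lebesgue (ball c r) f"
  unfolding set_integrable_def
proof (rule integrableI_bounded_set[where A = "ball c r" and B = B])
  show "emeasure lebesgue (ball c r) < \<infinity>" using emeasure_lborel_ball_finite by simp
  show "AE z in lebesgue. z \<in> ball c r \<longrightarrow> norm (indicator (ball c r) z *\<^sub>R f z) \<le> B"
    using assms(2) by eventually_elim auto
qed (use assms(1) in auto)

lemma set_integrable_ball_continuous:
  fixes f :: "'a::euclidean_space \<Rightarrow> real"
  assumes "continuous_on (cball c r) f"
  shows "set_integrable lebesgue (ball c r) f"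
proof -
  have "integrable lborel (\<lambda>z. indicator (cball c r) z *\<^sub>R f z)"
    using assms by (intro borel_integrable_compact) auto
  then have "set_integrable lebesgue (cball c r) f"
    unfolding set_integrable_def by (simp add: integrable_completion borel_measurable_integrable)
  then show ?thesis by (rule set_integrable_subset) auto
qed

lemma set_integrable_dir_deriv_mult:
  fixes u :: "'a::euclidean_space \<Rightarrow> real"
  assumes "u \<in> lipschitz_vanishing c r" "continuous_on (cball c r) f"
  shows "set_integrable lebesgue (ball c r) (\<lambda>z. dir_deriv u e z * f z)"
proof -
  obtain L where L: "L-lipschitz_on (cball c r) u" "\<forall>z\<in>sphere c r. u z = 0"
    using assms by (auto simp: lipschitz_vanishing_def)
  obtain K where K: "\<And>z. z \<in> cball c r \<Longrightarrow> \<bar>f z\<bar> \<le> K"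
    using compact_imp_bounded[OF compact_continuous_image[OF assms(2) compact_cball]]
    unfolding bounded_iff real_norm_def by blast
  show ?thesis
  proof (rule set_integrable_ball_bounded)
    have "(\<lambda>z. (indicator (ball c r) z * dir_deriv u e z) * (indicator (ball c r) z *\<^sub>R f z)) \<in> borel_measurable lebesgue"
      using lipschitz_vanishing_dir_deriv_measurable[OF assms(1)]
        borel_measurable_integrable[OF set_integrable_ball_continuous[OF assms(2), unfolded set_integrable_def]]
      by (rule borel_measurable_times)
    also have "(\<lambda>z. (indicator (ball c r) z * dir_deriv u e z) * (indicator (ball c r) z *\<^sub>R f z)) =
       (\<lambda>z. indicator (ball c r) z * (dir_deriv u e z * f z))"
      by (auto simp: fun_eq_iff indicator_def)
    finally show "(\<lambda>z. indicator (ball c r) z * (dir_deriv u e z * f z)) \<in> borel_measurable lebesgue" .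
    show "AE z in lebesgue. z \<in> ball c r \<longrightarrow> \<bar>dir_deriv u e z * f z\<bar> \<le> (L * norm e) * K"
      using lipschitz_vanishing_AE[OF L, of e]
    proof eventually_elim
      case (elim z)
      then show ?case
        using K[of z] by (auto simp: abs_mult intro!: mult_mono intro: order_trans[OF abs_ge_zero])
    qed
  qed
qed

lemma lipschitz_on_times:
  fixes f g :: "'a::metric_space \<Rightarrow> real"
  assumes f: "L-lipschitz_on X f" and g: "K-lipschitz_on X g"
    and "\<And>x. x \<in> X \<Longrightarrow> \<bar>f x\<bar> \<le> A" "\<And>x. x \<in> X \<Longrightarrow> \<bar>g x\<bar> \<le> B" "0 \<le> A" "0 \<le> B"
  shows "(A * K + B * L)-lipschitz_on X (\<lambda>x. f x * g x)"
proof (rule lipschitz_onI)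
  have LK: "0 \<le> L" "0 \<le> K" using f g by (auto dest: lipschitz_on_nonneg)
  then show "0 \<le> A * K + B * L" using assms by simp
  fix x y assume xy: "x \<in> X" "y \<in> X"
  have "f x * g x - f y * g y = f x * (g x - g y) + g y * (f x - f y)" by (simp add: algebra_simps)
  also have "\<bar>\<dots>\<bar> \<le> \<bar>f x\<bar> * \<bar>g x - g y\<bar> + \<bar>g y\<bar> * \<bar>f x - f y\<bar>"
    by (metis abs_mult abs_triangle_ineq)
  also have "\<dots> \<le> A * (K * dist x y) + B * (L * dist x y)"
    using assms xy lipschitz_onD[OF f xy] lipschitz_onD[OF g xy]
    by (intro add_mono mult_mono) (auto simp: dist_real_def)
  finally show "dist (f x * g x) (f y * g y) \<le> (A * K + B * L) * dist x y"
    by (simp add: dist_real_def algebra_simps)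
qed

lemma lipschitz_times_compact:
  fixes f g :: "'a::metric_space \<Rightarrow> real"
  assumes "compact X" "\<exists>L. L-lipschitz_on X f" "\<exists>L. L-lipschitz_on X g"
  shows "\<exists>L. L-lipschitz_on X (\<lambda>x. f x * g x)"
proof -
  obtain L K where LK: "L-lipschitz_on X f" "K-lipschitz_on X g" using assms by blast
  have bd: "\<exists>A\<ge>0. \<forall>x\<in>X. \<bar>h x\<bar> \<le> A" if "C-lipschitz_on X h" for C and h :: "'a \<Rightarrow> real"
  proof -
    have "bounded (h ` X)"
      using that assms(1) by (intro compact_imp_bounded compact_continuous_image lipschitz_on_continuous_on)
    then obtain A where "A > 0" "\<forall>x\<in>X. \<bar>h x\<bar> \<le> A" by (auto simp: bounded_pos)
    then show ?thesis by (intro exI[of _ A]) auto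
  qed
  obtain A B where "A \<ge> 0" "B \<ge> 0" "\<forall>x\<in>X. \<bar>f x\<bar> \<le> A" "\<forall>x\<in>X. \<bar>g x\<bar> \<le> B"
    using bd[OF LK(1)] bd[OF LK(2)] by blast
  then show ?thesis using lipschitz_on_times[OF LK, of A B] by blast
qed

text \<open>The product of \<open>u\<close> and \<open>\<phi>\<close>, extended by zero, is Lipschitz on the whole space, and its directional
  derivative has integral zero.\<close>
lemma integration_by_parts_ball:
  fixes u \<phi> :: "'a::euclidean_space \<Rightarrow> real"
  assumes u: "u \<in> lipschitz_vanishing c r" and \<phi>: "\<exists>K. K-lipschitz_on (cball c r) \<phi>"
    and deriv: "\<And>z. z \<in> ball c r \<Longrightarrow> ((\<lambda>t. \<phi> (z + t *\<^sub>R e)) has_real_derivative \<phi>' z) (at 0)"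
    and cont: "continuous_on (cball c r) \<phi>'"
  shows "(LINT z:ball c r|lebesgue. dir_deriv u e z * \<phi> z) = - (LINT z:ball c r|lebesgue. u z * \<phi>' z)"
proof -
  obtain L where L: "L-lipschitz_on (cball c r) u" "\<forall>z\<in>sphere c r. u z = 0"
    using u by (auto simp: lipschitz_vanishing_def)
  obtain K where K: "K-lipschitz_on (cball c r) (\<lambda>z. u z * \<phi> z)"
    using lipschitz_times_compact[OF compact_cball _ \<phi>, of u] L(1) by blast
  define W where "W z = (if z \<in> cball c r then u z * \<phi> z else 0)" for z
  have W: "K-lipschitz_on UNIV W"
    unfolding W_def using L(2) by (intro lipschitz_zero_extension K) simp
  have int: "set_integrable lebesgue (ball c r) (\<lambda>z. dir_deriv u e z * \<phi> z)"
      "set_integrable lebesgue (ball c r) (\<lambda>z. u z * \<phi>' z)"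
  proof -
    have "continuous_on (cball c r) \<phi>" using \<phi> lipschitz_on_continuous_on by blast
    then show "set_integrable lebesgue (ball c r) (\<lambda>z. dir_deriv u e z * \<phi> z)"
      by (rule set_integrable_dir_deriv_mult[OF u])
    show "set_integrable lebesgue (ball c r) (\<lambda>z. u z * \<phi>' z)"
      by (intro set_integrable_ball_continuous continuous_on_mult lipschitz_vanishing_continuous u cont)
  qed
  have "integral\<^sup>L lebesgue (dir_deriv W e) = 0"
  proof (rule integral_dir_deriv_zero[OF W, where R = "norm c + r"])
    fix z :: 'a assume "norm c + r < norm z"
    then have "z \<notin> cball c r"
      using norm_triangle_ineq2[of z c] by (auto simp: dist_norm norm_minus_commute)
    then show "W z = 0" by (simp add: W_def)
  qed
  also have "integral\<^sup>L lebesgue (dir_deriv W e) =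
    (LINT z:ball c r|lebesgue. dir_deriv u e z * \<phi> z + u z * \<phi>' z)"
    unfolding set_lebesgue_integral_def
  proof (rule integral_cong_AE)
    have sum_int: "set_integrable lebesgue (ball c r) (\<lambda>z. dir_deriv u e z * \<phi> z + u z * \<phi>' z)"
      using int by (rule set_integral_add)
    then show "(\<lambda>z. indicator (ball c r) z *\<^sub>R (dir_deriv u e z * \<phi> z + u z * \<phi>' z)) \<in> borel_measurable lebesgue"
      by (auto simp: set_integrable_def dest: borel_measurable_integrable)
    show "dir_deriv W e \<in> borel_measurable lebesgue" using W by (rule lipschitz_dir_deriv_measurable)
    have "negligible (sphere c r)" by (rule negligible_sphere)
    then have "AE z in lebesgue. z \<notin> sphere c r"
      unfolding negligible_iff_null_sets by (rule AE_not_in)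
    then show "AE z in lebesgue. dir_deriv W e z = indicator (ball c r) z *\<^sub>R (dir_deriv u e z * \<phi> z + u z * \<phi>' z)"
      using lipschitz_vanishing_AE[OF L, of e]
    proof eventually_elim
      case (elim z)
      show ?case
      proof (cases "z \<in> ball c r")
        case True
        then have "((\<lambda>t. u (z + t *\<^sub>R e) * \<phi> (z + t *\<^sub>R e)) has_real_derivative
            dir_deriv u e z * \<phi> z + u z * \<phi>' z) (at 0)"
          using elim deriv[OF True] by (auto intro!: derivative_eq_intros)
        then have "((\<lambda>t. W (z + t *\<^sub>R e)) has_real_derivative dir_deriv u e z * \<phi> z + u z * \<phi>' z) (at 0)"
          by (subst DERIV_line_cong[OF True, of W "\<lambda>z. u z * \<phi> z"]) (auto simp: W_def)
        then show ?thesis using True by (auto dest: DERIV_imp_deriv)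
      next
        case False
        then have "z \<in> - cball c r" using elim by auto
        then have ev: "\<forall>\<^sub>F w in nhds z. W w = 0"
          by (intro eventually_nhds[THEN iffD2] exI[of _ "- cball c r"]) (auto simp: W_def)
        have "((\<lambda>t. z + t *\<^sub>R e) \<longlongrightarrow> z + 0 *\<^sub>R e) (nhds 0)"
          by (intro tendsto_intros filterlim_ident)
        then have "filterlim (\<lambda>t. z + t *\<^sub>R e) (nhds z) (nhds 0)" by simp
        from eventually_compose_filterlim[OF ev this]
        have "\<forall>\<^sub>F t in nhds 0. W (z + t *\<^sub>R e) = 0" .
        then have "dir_deriv W e z = deriv (\<lambda>t. 0) (0::real)" by (intro deriv_cong_ev) auto
        then show ?thesis using False by simp
      qed
    qed
  qed
  also have "\<dots> = (LINT z:ball c r|lebesgue. dir_deriv u e z * \<phi> z) + (LINT z:ball c r|lebesgue. u z * \<phi>' z)"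
    using int by (rule set_integral_add)
  finally show ?thesis by linarith
qed

section \<open>Logarithms of quadratic functions\<close>

abbreviation lipschitzian_on :: "'a::metric_space set \<Rightarrow> ('a \<Rightarrow> real) \<Rightarrow> bool" where
  "lipschitzian_on X f \<equiv> \<exists>L. L-lipschitz_on X f"

lemma lipschitzian_inverse:
  assumes f: "lipschitzian_on X f" and X: "compact X" and pos: "\<And>x. x \<in> X \<Longrightarrow> 0 < f x"
  shows "lipschitzian_on X (\<lambda>x. 1 / f x)" "lipschitzian_on X (\<lambda>x. ln (f x))"
proof -
  obtain L where L: "L-lipschitz_on X f" using f by blast
  have L0: "L \<ge> 0" using L by (rule lipschitz_on_nonneg)
  have "\<exists>c>0. \<forall>x\<in>X. c \<le> f x"
  proof (cases "X = {}")
    case False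
    then obtain x where x: "x \<in> X" "\<forall>y\<in>X. f x \<le> f y"
      using continuous_attains_inf[OF X _ lipschitz_on_continuous_on[OF L]] by blast
    then show ?thesis using pos by blast
  qed (auto intro: exI[of _ 1])
  then obtain c where c: "c > 0" "\<And>x. x \<in> X \<Longrightarrow> c \<le> f x" by blast
  have fd: "\<bar>f x - f y\<bar> \<le> L * dist x y" if "x \<in> X" "y \<in> X" for x y
    using lipschitz_onD[OF L that] by (simp add: dist_real_def)
  have "(L / c\<^sup>2)-lipschitz_on X (\<lambda>x. 1 / f x)"
  proof (rule lipschitz_onI)
    fix x y assume xy: "x \<in> X" "y \<in> X"
    have "1 / f x - 1 / f y = (f y - f x) / (f x * f y)"
      using pos[OF xy(1)] pos[OF xy(2)] by (simp add: field_simps)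
    then have "dist (1 / f x) (1 / f y) = \<bar>f y - f x\<bar> / (f x * f y)"
      using pos[OF xy(1)] pos[OF xy(2)] by (simp add: dist_real_def abs_mult)
    also have "\<dots> \<le> (L * dist x y) / (c * c)"
      using fd[of y x] xy c L0 by (intro frac_le mult_mono) (auto simp: dist_commute intro: less_imp_le pos)
    finally show "dist (1 / f x) (1 / f y) \<le> L / c\<^sup>2 * dist x y" by (simp add: power2_eq_square)
  qed (use L0 c in auto)
  then show "lipschitzian_on X (\<lambda>x. 1 / f x)" by blast
  have ln_le: "ln (f x) - ln (f y) \<le> \<bar>f x - f y\<bar> / c" if xy: "x \<in> X" "y \<in> X" for x y
  proof -
    have p: "0 < f x" "0 < f y" using pos xy by auto
    then have "ln (f x) - ln (f y) = ln (f x / f y)" by (simp add: ln_div)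
    also have "\<dots> \<le> f x / f y - 1" using p by (intro ln_le_minus_one) simp
    also have "\<dots> = (f x - f y) / f y" using p by (simp add: field_simps)
    also have "\<dots> \<le> \<bar>f x - f y\<bar> / c" using c xy by (intro frac_le) auto
    finally show ?thesis .
  qed
  have "(L / c)-lipschitz_on X (\<lambda>x. ln (f x))"
  proof (rule lipschitz_onI)
    fix x y assume xy: "x \<in> X" "y \<in> X"
    have "\<bar>ln (f x) - ln (f y)\<bar> \<le> \<bar>f x - f y\<bar> / c"
      using ln_le[OF xy] ln_le[OF xy(2,1)] by (auto simp: abs_minus_commute abs_le_iff)
    also have "\<dots> \<le> L * dist x y / c" using fd[OF xy] c by (intro divide_right_mono) auto
    finally show "dist (ln (f x)) (ln (f y)) \<le> L / c * dist x y" by (simp add: dist_real_def)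
  qed (use L0 c in auto)
  then show "lipschitzian_on X (\<lambda>x. ln (f x))" by blast
qed

lemma lipschitzian_add: "lipschitzian_on X f \<Longrightarrow> lipschitzian_on X g \<Longrightarrow> lipschitzian_on X (\<lambda>x. f x + g x)"
  using lipschitz_on_add by blast

lemma lipschitzian_cmult: "lipschitzian_on X f \<Longrightarrow> lipschitzian_on X (\<lambda>x. a * f x)"
  using lipschitz_on_cmult_real by blast

lemma lipschitzian_const: "lipschitzian_on X (\<lambda>x. a)"
  using lipschitz_on_constant by blast

lemma lipschitzian_inner:
  fixes X :: "'a::real_inner set"
  shows "lipschitzian_on X (\<lambda>x. x \<bullet> e)"
proof -
  have "(norm e)-lipschitz_on X (\<lambda>x. x \<bullet> e)"
  proof (rule lipschitz_onI)
    fix x y :: 'a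
    show "dist (x \<bullet> e) (y \<bullet> e) \<le> norm e * dist x y"
      using Cauchy_Schwarz_ineq2[of "x - y" e]
      by (simp add: dist_norm inner_diff_left mult.commute)
  qed simp
  then show ?thesis by blast
qed

text \<open>Both terms of the softened Green function are logarithms of functions of this form, so that one
  computation of the Laplacian serves for both.\<close>
definition quad :: "real \<Rightarrow> complex \<Rightarrow> real \<Rightarrow> complex \<Rightarrow> real" where
  "quad \<alpha> b \<kappa> w = \<alpha> * (w \<bullet> w) + w \<bullet> b + \<kappa>"

lemma quad_derivative:
  "((\<lambda>t. quad \<alpha> b \<kappa> (w + t *\<^sub>R e)) has_real_derivative (2 * \<alpha> * (w \<bullet> e) + e \<bullet> b)) (at 0)"
proof -
  have "((\<lambda>t. \<alpha> * (w \<bullet> w + 2 * t * (w \<bullet> e) + t\<^sup>2 * (e \<bullet> e)) + (w \<bullet> b + t * (e \<bullet> b)) + \<kappa>)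
     has_real_derivative (2 * \<alpha> * (w \<bullet> e) + e \<bullet> b)) (at 0)"
    by (auto intro!: derivative_eq_intros)
  then show ?thesis
    by (simp add: quad_def inner_add_left inner_add_right inner_commute power2_eq_square algebra_simps)
qed

lemma quad_lipschitzian:
  fixes X :: "complex set"
  assumes X: "compact X"
  shows "lipschitzian_on X (quad \<alpha> b \<kappa>)"
proof -
  have nrm: "lipschitzian_on X norm"
    by (intro exI[of _ 1] lipschitz_onI) (auto simp: dist_real_def dist_norm norm_triangle_ineq3)
  have "lipschitzian_on X (\<lambda>w. \<alpha> * (norm w * norm w) + w \<bullet> b + \<kappa>)"
    by (intro lipschitzian_add lipschitzian_cmult lipschitzian_const lipschitzian_inner lipschitz_times_compact X nrm)
  moreover have "quad \<alpha> b \<kappa> = (\<lambda>w. \<alpha> * (norm w * norm w) + w \<bullet> b + \<kappa>)"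
    by (simp add: quad_def fun_eq_iff power2_norm_eq_inner[symmetric] power2_eq_square)
  ultimately show ?thesis by simp
qed

lemma continuous_on_quad [continuous_intros]:
  "continuous_on X f \<Longrightarrow> continuous_on X (\<lambda>x. quad \<alpha> b \<kappa> (f x))"
  unfolding quad_def by (intro continuous_intros)

text \<open>The derivative of the logarithm of \<open>quad \<alpha> b \<kappa>\<close> in direction \<open>e\<close>.\<close>
definition dlog_quad :: "real \<Rightarrow> complex \<Rightarrow> real \<Rightarrow> complex \<Rightarrow> complex \<Rightarrow> real" where
  "dlog_quad \<alpha> b \<kappa> e w = (2 * \<alpha> * (w \<bullet> e) + e \<bullet> b) / quad \<alpha> b \<kappa> w"

lemma ln_quad_derivative:
  assumes "quad \<alpha> b \<kappa> w > 0"
  shows "((\<lambda>t. ln (quad \<alpha> b \<kappa> (w + t *\<^sub>R e))) has_real_derivative dlog_quad \<alpha> b \<kappa> e w) (at 0)"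
  using assms quad_derivative[of \<alpha> b \<kappa> w e] unfolding dlog_quad_def
  by (auto intro!: derivative_eq_intros)

lemma complex_inner_basis: "(x \<bullet> 1) * (y \<bullet> 1) + (x \<bullet> \<i>) * (y \<bullet> \<i>) = x \<bullet> (y::complex)"
  by (simp add: inner_complex_def)

lemma dlog_quad_lipschitzian:
  assumes "\<And>w. w \<in> cball 0 1 \<Longrightarrow> 0 < quad \<alpha> b \<kappa> w"
  shows "lipschitzian_on (cball 0 1) (dlog_quad \<alpha> b \<kappa> e)"
proof -
  have "lipschitzian_on (cball 0 1) (\<lambda>w. (2 * \<alpha> * (w \<bullet> e) + e \<bullet> b) * (1 / quad \<alpha> b \<kappa> w))"
    using assms
    by (intro lipschitz_times_compact lipschitzian_add lipschitzian_cmult lipschitzian_const lipschitzian_inner lipschitzian_inverse quad_lipschitzian) auto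
  then show ?thesis by (simp add: dlog_quad_def[abs_def])
qed

text \<open>Since \<open>q = quad \<alpha> b \<kappa>\<close> has constant Laplacian, \<open>q \<Delta>q - |\<nabla>q|\<^sup>2\<close> is constant, and the Laplacian of
  \<open>ln q\<close> is \<open>(4 \<alpha> \<kappa> - |b|\<^sup>2) / q\<^sup>2\<close>.\<close>
lemma green_identity_ln_quad:
  fixes u :: "complex \<Rightarrow> real"
  assumes u: "u \<in> lipschitz_vanishing 0 1" and pos: "\<And>w. w \<in> cball 0 1 \<Longrightarrow> 0 < quad \<alpha> b \<kappa> w"
  shows "(LINT w:ball 0 1|lebesgue. dir_deriv u 1 w * dlog_quad \<alpha> b \<kappa> 1 w + dir_deriv u \<i> w * dlog_quad \<alpha> b \<kappa> \<i> w) =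
    - (4 * \<alpha> * \<kappa> - b \<bullet> b) * (LINT w:ball 0 1|lebesgue. u w / (quad \<alpha> b \<kappa> w)\<^sup>2)"
proof -
  let ?q = "quad \<alpha> b \<kappa>"
  define \<phi>' where "\<phi>' e w = (2 * \<alpha> * (e \<bullet> e) * ?q w - (2 * \<alpha> * (w \<bullet> e) + e \<bullet> b)\<^sup>2) / (?q w)\<^sup>2" for e w
  have q0: "?q w \<noteq> 0" if "w \<in> cball 0 1" for w using pos[OF that] by simp
  have cont': "continuous_on (cball 0 1) (\<phi>' e)" for e
    unfolding \<phi>'_def by (intro continuous_intros) (use q0 in auto)
  have deriv: "((\<lambda>t. dlog_quad \<alpha> b \<kappa> e (w + t *\<^sub>R e)) has_real_derivative \<phi>' e w) (at 0)"
    if "w \<in> ball 0 1" for e w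
  proof -
    have "((\<lambda>t. (2 * \<alpha> * (w \<bullet> e + t * (e \<bullet> e)) + e \<bullet> b) / ?q (w + t *\<^sub>R e)) has_real_derivative \<phi>' e w) (at 0)"
      using quad_derivative[of \<alpha> b \<kappa> w e] q0[of w] that unfolding \<phi>'_def
      by (auto intro!: derivative_eq_intros simp: power2_eq_square)
    then show ?thesis by (simp add: dlog_quad_def inner_add_left)
  qed
  have lipsq: "lipschitzian_on (cball 0 1) (dlog_quad \<alpha> b \<kappa> e)" for e using pos by (rule dlog_quad_lipschitzian)
  have ibp: "(LINT w:ball 0 1|lebesgue. dir_deriv u e w * dlog_quad \<alpha> b \<kappa> e w) =
      - (LINT w:ball 0 1|lebesgue. u w * \<phi>' e w)" for e
    using u lipsq deriv cont' by (rule integration_by_parts_ball)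
  have int1: "set_integrable lebesgue (ball 0 1) (\<lambda>w. dir_deriv u e w * dlog_quad \<alpha> b \<kappa> e w)" for e
    using lipsq[of e] lipschitz_on_continuous_on by (blast intro: set_integrable_dir_deriv_mult[OF u])
  have int2: "set_integrable lebesgue (ball 0 1) (\<lambda>w. u w * \<phi>' e w)" for e
    by (intro set_integrable_ball_continuous continuous_on_mult lipschitz_vanishing_continuous u cont')
  have "(LINT w:ball 0 1|lebesgue. dir_deriv u 1 w * dlog_quad \<alpha> b \<kappa> 1 w + dir_deriv u \<i> w * dlog_quad \<alpha> b \<kappa> \<i> w) =
     - (LINT w:ball 0 1|lebesgue. u w * \<phi>' 1 w + u w * \<phi>' \<i> w)"
    using int1 int2 by (simp add: set_integral_add ibp)
  also have "(LINT w:ball 0 1|lebesgue. u w * \<phi>' 1 w + u w * \<phi>' \<i> w) =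
     (LINT w:ball 0 1|lebesgue. (4 * \<alpha> * \<kappa> - b \<bullet> b) * (u w / (?q w)\<^sup>2))"
  proof (rule set_lebesgue_integral_cong)
    show "\<forall>w. w \<in> ball 0 1 \<longrightarrow> u w * \<phi>' 1 w + u w * \<phi>' \<i> w = (4 * \<alpha> * \<kappa> - b \<bullet> b) * (u w / (?q w)\<^sup>2)"
    proof (intro allI impI)
      fix w :: complex assume "w \<in> ball 0 1"
      have "\<phi>' 1 w + \<phi>' \<i> w = (4 * \<alpha> * \<kappa> - b \<bullet> b) / (?q w)\<^sup>2"
        unfolding \<phi>'_def add_divide_distrib[symmetric]
        by (rule arg_cong[of _ _ "\<lambda>x. x / (?q w)\<^sup>2"])
          (simp add: quad_def inner_complex_def power2_eq_square algebra_simps)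
      then show "u w * \<phi>' 1 w + u w * \<phi>' \<i> w = (4 * \<alpha> * \<kappa> - b \<bullet> b) * (u w / (?q w)\<^sup>2)"
        by (simp add: distrib_left[symmetric])
    qed
  qed auto
  also have "\<dots> = (4 * \<alpha> * \<kappa> - b \<bullet> b) * (LINT w:ball 0 1|lebesgue. u w / (?q w)\<^sup>2)"
    by (rule set_integral_mult_right)
  finally show ?thesis by (simp only: minus_mult_left)
qed

section \<open>A softened Green function of the unit disk\<close>

text \<open>The square of the pseudo-hyperbolic distance, that is \<open>tanh\<^sup>2(d/2)\<close> for the hyperbolic distance \<open>d\<close>.\<close>
definition pseudo_dist2 :: "complex \<Rightarrow> complex \<Rightarrow> real" where
  "pseudo_dist2 z w = (norm (z - w))\<^sup>2 / (norm (1 - cnj z * w))\<^sup>2"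

text \<open>For \<open>\<epsilon> = 0\<close> this is the Green function \<open>ln |(1 - cnj z * w) / (z - w)|\<close> of the disk. The shift
  removes the singularity and the factor \<open>1 + \<epsilon>\<close> restores the boundary values zero.\<close>
definition soft_green :: "real \<Rightarrow> complex \<Rightarrow> complex \<Rightarrow> real" where
  "soft_green \<epsilon> z w = ln ((1 + \<epsilon>) / (pseudo_dist2 z w + \<epsilon>)) / 2"

text \<open>The squared moduli that make up the pseudo-hyperbolic distance, written as quadratic functions of
  \<open>w\<close>; the first has a harmonic logarithm.\<close>
abbreviation quad_num :: "complex \<Rightarrow> complex \<Rightarrow> real" where
  "quad_num z \<equiv> quad (z \<bullet> z) (- 2 * z) 1"

abbreviation quad_den :: "real \<Rightarrow> complex \<Rightarrow> complex \<Rightarrow> real" where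
  "quad_den \<epsilon> z \<equiv> quad (1 + \<epsilon> * (z \<bullet> z)) (- of_real (2 * (1 + \<epsilon>)) * z) (z \<bullet> z + \<epsilon>)"

lemma quad_num_eq: "quad_num z w = (norm (1 - cnj z * w))\<^sup>2"
  unfolding quad_def cmod_power2 by (simp add: inner_complex_def power2_eq_square algebra_simps)

lemma quad_den_eq: "quad_den \<epsilon> z w = (norm (z - w))\<^sup>2 + \<epsilon> * (norm (1 - cnj z * w))\<^sup>2"
  unfolding quad_def cmod_power2 by (simp add: inner_complex_def power2_eq_square algebra_simps)

lemma one_minus_cnj_nonzero:
  assumes "z \<in> ball 0 1" "w \<in> cball 0 1"
  shows "1 - cnj z * w \<noteq> 0"
proof
  assume "1 - cnj z * w = 0"
  then have "norm (cnj z * w) = 1" by simp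
  moreover have "norm z * norm w \<le> norm z * 1" using assms by (intro mult_left_mono) auto
  ultimately show False using assms by (simp add: norm_mult)
qed

lemma quad_num_pos: "z \<in> ball 0 1 \<Longrightarrow> w \<in> cball 0 1 \<Longrightarrow> 0 < quad_num z w"
  using one_minus_cnj_nonzero[of z w] by (simp only: quad_num_eq) simp

lemma quad_den_pos: "0 < \<epsilon> \<Longrightarrow> z \<in> ball 0 1 \<Longrightarrow> w \<in> cball 0 1 \<Longrightarrow> 0 < quad_den \<epsilon> z w"
  using one_minus_cnj_nonzero[of z w] by (simp only: quad_den_eq) (simp add: add_nonneg_pos)

lemma soft_green_eq_ln_quad:
  assumes "0 < \<epsilon>" "z \<in> ball 0 1" "w \<in> cball 0 1"
  shows "soft_green \<epsilon> z w = (ln (1 + \<epsilon>) + ln (quad_num z w) - ln (quad_den \<epsilon> z w)) / 2"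
proof -
  have "pseudo_dist2 z w + \<epsilon> = quad_den \<epsilon> z w / quad_num z w"
    using one_minus_cnj_nonzero[OF assms(2,3)] unfolding quad_num_eq quad_den_eq pseudo_dist2_def
    by (simp add: field_simps)
  then show ?thesis
    using quad_num_pos[OF assms(2,3)] quad_den_pos[OF assms] assms(1)
    unfolding soft_green_def by (simp add: ln_div ln_mult)
qed

lemma soft_green_derivative:
  assumes "0 < \<epsilon>" "z \<in> ball 0 1" "w \<in> ball 0 1"
  shows "((\<lambda>t. soft_green \<epsilon> z (w + t *\<^sub>R e)) has_real_derivative
     (dlog_quad (z \<bullet> z) (- 2 * z) 1 e w
      - dlog_quad (1 + \<epsilon> * (z \<bullet> z)) (- of_real (2 * (1 + \<epsilon>)) * z) (z \<bullet> z + \<epsilon>) e w) / 2) (at 0)"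
proof -
  have w: "w \<in> cball 0 1" using assms(3) by simp
  have "((\<lambda>t. (ln (1 + \<epsilon>) + ln (quad_num z (w + t *\<^sub>R e)) - ln (quad_den \<epsilon> z (w + t *\<^sub>R e))) / 2) has_real_derivative
     (0 + dlog_quad (z \<bullet> z) (- 2 * z) 1 e w
      - dlog_quad (1 + \<epsilon> * (z \<bullet> z)) (- of_real (2 * (1 + \<epsilon>)) * z) (z \<bullet> z + \<epsilon>) e w) / 2) (at 0)"
    by (intro DERIV_cdivide DERIV_diff DERIV_add DERIV_const ln_quad_derivative quad_num_pos quad_den_pos assms w)
  then have "((\<lambda>t. (ln (1 + \<epsilon>) + ln (quad_num z (w + t *\<^sub>R e)) - ln (quad_den \<epsilon> z (w + t *\<^sub>R e))) / 2) has_real_derivative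
     (dlog_quad (z \<bullet> z) (- 2 * z) 1 e w
      - dlog_quad (1 + \<epsilon> * (z \<bullet> z)) (- of_real (2 * (1 + \<epsilon>)) * z) (z \<bullet> z + \<epsilon>) e w) / 2) (at 0)"
    by (simp only: add_0_left)
  then show ?thesis
    by (subst DERIV_line_cong[OF assms(3), of _ "\<lambda>w. (ln (1 + \<epsilon>) + ln (quad_num z w) - ln (quad_den \<epsilon> z w)) / 2"])
      (use soft_green_eq_ln_quad[OF assms(1,2)] in auto)
qed

lemma soft_green_lipschitz_vanishing:
  assumes "0 < \<epsilon>" "z \<in> ball 0 1"
  shows "soft_green \<epsilon> z \<in> lipschitz_vanishing 0 1"
proof -
  have "lipschitzian_on (cball 0 1) (\<lambda>w. (1/2) * (ln (1 + \<epsilon>) + ln (quad_num z w) + (-1) * ln (quad_den \<epsilon> z w)))"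
    by (intro lipschitzian_cmult lipschitzian_add lipschitzian_const lipschitzian_inverse quad_lipschitzian compact_cball quad_num_pos quad_den_pos assms)
  then obtain L where "L-lipschitz_on (cball 0 1) (\<lambda>w. (1/2) * (ln (1 + \<epsilon>) + ln (quad_num z w) + (-1) * ln (quad_den \<epsilon> z w)))"
    by blast
  then have "L-lipschitz_on (cball 0 1) (soft_green \<epsilon> z)"
    by (rule lipschitz_on_transform) (use soft_green_eq_ln_quad[OF assms] in auto)
  moreover have "soft_green \<epsilon> z w = 0" if "w \<in> sphere 0 1" for w
  proof -
    have w: "norm w = 1" using that by simp
    have "1 - cnj z * w = w * cnj w - cnj z * w" using w by (simp add: complex_norm_square[symmetric])
    also have "\<dots> = w * cnj (w - z)" by (simp add: algebra_simps)
    finally have "norm (1 - cnj z * w) = norm (z - w)"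
      using w by (simp add: norm_mult norm_minus_commute del: complex_cnj_diff)
    moreover have "norm (z - w) \<noteq> 0" using w assms(2) by auto
    ultimately show ?thesis using assms(1) by (simp add: soft_green_def pseudo_dist2_def)
  qed
  ultimately show ?thesis by (auto simp: lipschitz_vanishing_def)
qed

lemma pseudo_dist2_commute: "pseudo_dist2 z w = pseudo_dist2 w z"
proof -
  have "norm (1 - cnj z * w) = norm (cnj (1 - cnj z * w))" by (rule complex_mod_cnj[symmetric])
  then show ?thesis by (simp add: pseudo_dist2_def norm_minus_commute mult.commute)
qed

lemma pseudo_dist2_nonneg: "0 \<le> pseudo_dist2 z w" by (simp add: pseudo_dist2_def)

text \<open>The left-hand side is \<open>1 / cosh\<^sup>2(d/2)\<close> for the hyperbolic distance \<open>d\<close>; this is the form in which distances are compared.\<close>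
lemma one_minus_pseudo_dist2:
  assumes "z \<in> ball 0 1" "w \<in> cball 0 1"
  shows "1 - pseudo_dist2 z w = (1 - (norm z)\<^sup>2) * (1 - (norm w)\<^sup>2) / (norm (1 - cnj z * w))\<^sup>2"
proof -
  have "(norm (1 - cnj z * w))\<^sup>2 - (norm (z - w))\<^sup>2 = (1 - (norm z)\<^sup>2) * (1 - (norm w)\<^sup>2)"
    unfolding cmod_power2 by (simp add: power2_eq_square algebra_simps)
  moreover have "(norm (1 - cnj z * w))\<^sup>2 \<noteq> 0" using one_minus_cnj_nonzero[OF assms] by simp
  ultimately show ?thesis unfolding pseudo_dist2_def by (simp add: field_simps)
qed

lemma pseudo_dist2_less_1:
  assumes "z \<in> ball 0 1" "w \<in> ball 0 1" shows "pseudo_dist2 z w < 1"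
proof -
  have "0 < (1 - (norm z)\<^sup>2) * (1 - (norm w)\<^sup>2) / (norm (1 - cnj z * w))\<^sup>2"
    using assms one_minus_cnj_nonzero[of z w] by (simp add: power_less_one_iff)
  then show ?thesis using one_minus_pseudo_dist2[of z w] assms by simp
qed

lemma soft_green_commute: "soft_green \<epsilon> z w = soft_green \<epsilon> w z"
  by (simp add: soft_green_def pseudo_dist2_commute)

lemma soft_green_pos:
  assumes "0 < \<epsilon>" "z \<in> ball 0 1" "w \<in> ball 0 1"
  shows "0 < soft_green \<epsilon> z w"
proof -
  have "0 < pseudo_dist2 z w + \<epsilon>" "pseudo_dist2 z w + \<epsilon> < 1 + \<epsilon>"
    using pseudo_dist2_less_1[OF assms(2,3)] pseudo_dist2_nonneg[of z w] assms(1) by auto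
  then show ?thesis by (simp add: soft_green_def ln_gt_zero)
qed

lemma soft_green_le:
  assumes "0 < \<epsilon>"
  shows "soft_green \<epsilon> z w \<le> ln ((1 + \<epsilon>) / \<epsilon>) / 2"
proof -
  have "(1 + \<epsilon>) / (pseudo_dist2 z w + \<epsilon>) \<le> (1 + \<epsilon>) / \<epsilon>" "0 < (1 + \<epsilon>) / (pseudo_dist2 z w + \<epsilon>)"
    using pseudo_dist2_nonneg[of z w] assms by (auto intro!: frac_le divide_pos_pos)
  then show ?thesis unfolding soft_green_def by (intro divide_right_mono) auto
qed

lemma soft_green_antimono_pseudo_dist2:
  assumes "0 < \<epsilon>" "pseudo_dist2 z w \<le> pseudo_dist2 z' w'"
  shows "soft_green \<epsilon> z' w' \<le> soft_green \<epsilon> z w"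
proof -
  have "(1 + \<epsilon>) / (pseudo_dist2 z' w' + \<epsilon>) \<le> (1 + \<epsilon>) / (pseudo_dist2 z w + \<epsilon>)"
      "0 < (1 + \<epsilon>) / (pseudo_dist2 z' w' + \<epsilon>)"
    using pseudo_dist2_nonneg[of z w] pseudo_dist2_nonneg[of z' w'] assms by (auto intro!: frac_le divide_pos_pos)
  then show ?thesis unfolding soft_green_def by (intro divide_right_mono) auto
qed

lemma soft_green_antimono:
  assumes "0 < \<epsilon>'" "\<epsilon>' \<le> \<epsilon>" "z \<in> ball 0 1" "w \<in> ball 0 1"
  shows "soft_green \<epsilon> z w \<le> soft_green \<epsilon>' z w"
proof -
  let ?p = "pseudo_dist2 z w"
  have p: "0 \<le> ?p" "?p < 1" using pseudo_dist2_nonneg pseudo_dist2_less_1 assms by auto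
  have "(1 + \<epsilon>) * (?p + \<epsilon>') \<le> (1 + \<epsilon>') * (?p + \<epsilon>)"
    using mult_right_mono[of "\<epsilon>'" "\<epsilon>" "1 - ?p"] p assms by (simp add: algebra_simps)
  then have "(1 + \<epsilon>) / (?p + \<epsilon>) \<le> (1 + \<epsilon>') / (?p + \<epsilon>')"
    using p assms by (simp add: divide_le_eq field_simps)
  then show ?thesis
    unfolding soft_green_def using p assms by (intro divide_right_mono ln_mono) (auto simp: add_nonneg_pos)
qed

section \<open>The Dirichlet form\<close>

definition dirichlet :: "(complex \<Rightarrow> real) \<Rightarrow> (complex \<Rightarrow> real) \<Rightarrow> real" where
  "dirichlet u v = (LINT w:ball 0 1|lebesgue. gradient u w \<bullet> gradient v w)"

lemma dirichlet_commute: "dirichlet u v = dirichlet v u"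
  by (simp add: dirichlet_def inner_commute)

lemma gradient_eq: "gradient u w = Complex (dir_deriv u 1 w) (dir_deriv u \<i> w)"
  by (simp add: gradient_def scaleR_conv_of_real mult.commute)

lemma gradient_inner: "gradient u w \<bullet> gradient v w = dir_deriv u 1 w * dir_deriv v 1 w + dir_deriv u \<i> w * dir_deriv v \<i> w"
  by (simp add: gradient_eq inner_complex_def)

lemma gradient_inner_integrable:
  assumes u: "u \<in> lipschitz_vanishing 0 1" and v: "v \<in> lipschitz_vanishing 0 1"
  shows "set_integrable lebesgue (ball 0 1) (\<lambda>w. gradient u w \<bullet> gradient v w)"
proof -
  have int: "set_integrable lebesgue (ball 0 1) (\<lambda>w. dir_deriv u e w * dir_deriv v e w)" for e
  proof -
    obtain L where L: "L-lipschitz_on (cball 0 1) u" "\<forall>z\<in>sphere 0 1. u z = 0"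
      using u by (auto simp: lipschitz_vanishing_def)
    obtain K where K: "K-lipschitz_on (cball 0 1) v" "\<forall>z\<in>sphere 0 1. v z = 0"
      using v by (auto simp: lipschitz_vanishing_def)
    have LK: "0 \<le> L" "0 \<le> K" using L K by (auto dest: lipschitz_on_nonneg)
    show ?thesis
    proof (rule set_integrable_ball_bounded)
      have "(\<lambda>z. (indicator (ball 0 1) z * dir_deriv u e z) * (indicator (ball 0 1) z * dir_deriv v e z)) \<in> borel_measurable lebesgue"
        using lipschitz_vanishing_dir_deriv_measurable[OF u] lipschitz_vanishing_dir_deriv_measurable[OF v] by (rule borel_measurable_times)
      also have "(\<lambda>z. (indicator (ball 0 1) z * dir_deriv u e z) * (indicator (ball 0 1) z * dir_deriv v e z)) =
        (\<lambda>z. indicator (ball 0 1) z * (dir_deriv u e z * dir_deriv v e z))"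
        by (auto simp: fun_eq_iff indicator_def)
      finally show "(\<lambda>z. indicator (ball 0 1) z * (dir_deriv u e z * dir_deriv v e z)) \<in> borel_measurable lebesgue" .
      show "AE z in lebesgue. z \<in> ball 0 1 \<longrightarrow> \<bar>dir_deriv u e z * dir_deriv v e z\<bar> \<le> (L * norm e) * (K * norm e)"
        using lipschitz_vanishing_AE[OF L, of e] lipschitz_vanishing_AE[OF K, of e]
      proof eventually_elim
        case (elim z)
        then show ?case unfolding abs_mult using LK by (auto intro!: mult_mono)
      qed
    qed
  qed
  show ?thesis unfolding gradient_inner using int by (intro set_integral_add)
qed

lemma energy_eq_dirichlet:
  assumes u: "u \<in> lipschitz_vanishing 0 1"
  shows "(\<integral>\<^sup>+ z\<in>ball 0 1. ennreal ((norm (gradient u z))\<^sup>2) \<partial>lebesgue) = ennreal (dirichlet u u)"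
proof -
  have "(\<integral>\<^sup>+ z\<in>ball 0 1. ennreal ((norm (gradient u z))\<^sup>2) \<partial>lebesgue) =
    (\<integral>\<^sup>+ z. ennreal (indicator (ball 0 1) z *\<^sub>R (gradient u z \<bullet> gradient u z)) \<partial>lebesgue)"
    by (intro nn_integral_cong) (auto simp: indicator_def power2_norm_eq_inner)
  also have "\<dots> = ennreal (dirichlet u u)"
    unfolding dirichlet_def set_lebesgue_integral_def
    using gradient_inner_integrable[OF u u] unfolding set_integrable_def
    by (intro nn_integral_eq_integral) (auto simp: indicator_def)
  finally show ?thesis .
qed

lemma dirichlet_nonneg: "0 \<le> dirichlet u u"
  unfolding dirichlet_def set_lebesgue_integral_def
  by (intro integral_nonneg_AE AE_I2) (simp add: indicator_def)

text \<open>The Cauchy-Schwarz inequality in the form that comes from \<open>|\<nabla>u - c \<nabla>v|\<^sup>2 \<ge> 0\<close>; optimising over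
  \<open>c\<close> is left to the application.\<close>
lemma dirichlet_young:
  assumes u: "u \<in> lipschitz_vanishing 0 1" and v: "v \<in> lipschitz_vanishing 0 1"
  shows "2 * c * dirichlet u v - c\<^sup>2 * dirichlet v v \<le> dirichlet u u"
proof -
  note int = gradient_inner_integrable[OF u v] gradient_inner_integrable[OF v v] gradient_inner_integrable[OF u u]
  have "2 * c * dirichlet u v - c\<^sup>2 * dirichlet v v =
    (LINT w:ball 0 1|lebesgue. 2 * c * (gradient u w \<bullet> gradient v w) - c\<^sup>2 * (gradient v w \<bullet> gradient v w))"
    unfolding dirichlet_def
    using int by (simp only: set_integral_diff set_integral_mult_right set_integrable_mult_right)
  also have "\<dots> \<le> dirichlet u u"
    unfolding dirichlet_def
  proof (rule set_integral_mono)
    show "set_integrable lebesgue (ball 0 1) (\<lambda>w. 2 * c * (gradient u w \<bullet> gradient v w) - c\<^sup>2 * (gradient v w \<bullet> gradient v w))"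
      using int by (intro set_integral_diff set_integrable_mult_right) auto
    fix w
    have "0 \<le> (gradient u w - c *\<^sub>R gradient v w) \<bullet> (gradient u w - c *\<^sub>R gradient v w)" by simp
    then show "2 * c * (gradient u w \<bullet> gradient v w) - c\<^sup>2 * (gradient v w \<bullet> gradient v w) \<le> gradient u w \<bullet> gradient u w"
      by (simp add: inner_diff_left inner_diff_right inner_commute power2_eq_square algebra_simps)
  qed (rule int)
  finally show ?thesis .
qed

text \<open>This is \<open>- \<Delta> (soft_green \<epsilon> z) / (2 \<pi>)\<close>, a smooth approximation of the point mass at \<open>z\<close>.\<close>
definition green_density :: "real \<Rightarrow> complex \<Rightarrow> complex \<Rightarrow> real" where
  "green_density \<epsilon> z w = \<epsilon> / pi * ((1 - (norm z)\<^sup>2) / ((norm (z - w))\<^sup>2 + \<epsilon> * (norm (1 - cnj z * w))\<^sup>2))\<^sup>2"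

lemma dirichlet_soft_green:
  assumes u: "u \<in> lipschitz_vanishing 0 1" and \<epsilon>: "0 < \<epsilon>" and z: "z \<in> ball 0 1"
  shows "dirichlet u (soft_green \<epsilon> z) = 2 * pi * (LINT w:ball 0 1|lebesgue. u w * green_density \<epsilon> z w)"
proof -
  let ?d1 = "dlog_quad (z \<bullet> z) (- 2 * z) 1"
  let ?d2 = "dlog_quad (1 + \<epsilon> * (z \<bullet> z)) (- of_real (2 * (1 + \<epsilon>)) * z) (z \<bullet> z + \<epsilon>)"
  let ?I1 = "LINT w:ball 0 1|lebesgue. dir_deriv u 1 w * ?d1 1 w + dir_deriv u \<i> w * ?d1 \<i> w"
  let ?I2 = "LINT w:ball 0 1|lebesgue. dir_deriv u 1 w * ?d2 1 w + dir_deriv u \<i> w * ?d2 \<i> w"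
  have lips1: "continuous_on (cball 0 1) (?d1 e)" for e
    using dlog_quad_lipschitzian[OF quad_num_pos[OF z]] lipschitz_on_continuous_on by blast
  have lips2: "continuous_on (cball 0 1) (?d2 e)" for e
    using dlog_quad_lipschitzian[OF quad_den_pos[OF \<epsilon> z]] lipschitz_on_continuous_on by blast
  have "dirichlet u (soft_green \<epsilon> z) = (LINT w:ball 0 1|lebesgue.
      ((dir_deriv u 1 w * ?d1 1 w + dir_deriv u \<i> w * ?d1 \<i> w) - (dir_deriv u 1 w * ?d2 1 w + dir_deriv u \<i> w * ?d2 \<i> w)) / 2)"
    unfolding dirichlet_def
  proof (rule set_lebesgue_integral_cong)
    show "\<forall>w. w \<in> ball 0 1 \<longrightarrow> gradient u w \<bullet> gradient (soft_green \<epsilon> z) w =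
      ((dir_deriv u 1 w * ?d1 1 w + dir_deriv u \<i> w * ?d1 \<i> w) - (dir_deriv u 1 w * ?d2 1 w + dir_deriv u \<i> w * ?d2 \<i> w)) / 2"
    proof (intro allI impI)
      fix w :: complex assume w: "w \<in> ball 0 1"
      have "dir_deriv (soft_green \<epsilon> z) e w = (?d1 e w - ?d2 e w) / 2" for e
        using soft_green_derivative[OF \<epsilon> z w] by (rule DERIV_imp_deriv)
      then show "gradient u w \<bullet> gradient (soft_green \<epsilon> z) w =
        ((dir_deriv u 1 w * ?d1 1 w + dir_deriv u \<i> w * ?d1 \<i> w) - (dir_deriv u 1 w * ?d2 1 w + dir_deriv u \<i> w * ?d2 \<i> w)) / 2"
        unfolding gradient_inner by (simp only:) (simp add: field_simps)
    qed
  qed auto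
  also have "\<dots> = (?I1 - ?I2) / 2"
    by (subst set_integral_divide_zero, subst set_integral_diff)
      (intro set_integral_add set_integrable_dir_deriv_mult u lips1 lips2 refl)+
  also have "?I1 = - (4 * (z \<bullet> z) * 1 - (- 2 * z) \<bullet> (- 2 * z)) * (LINT w:ball 0 1|lebesgue. u w / (quad_num z w)\<^sup>2)"
    by (rule green_identity_ln_quad[OF u quad_num_pos[OF z]])
  also have "4 * (z \<bullet> z) * 1 - (- 2 * z) \<bullet> (- 2 * z) = 0" by (simp add: inner_complex_def)
  also have "?I2 = - (4 * (1 + \<epsilon> * (z \<bullet> z)) * (z \<bullet> z + \<epsilon>)
      - (- of_real (2 * (1 + \<epsilon>)) * z) \<bullet> (- of_real (2 * (1 + \<epsilon>)) * z))
      * (LINT w:ball 0 1|lebesgue. u w / (quad_den \<epsilon> z w)\<^sup>2)"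
    by (rule green_identity_ln_quad[OF u quad_den_pos[OF \<epsilon> z]])
  also have "4 * (1 + \<epsilon> * (z \<bullet> z)) * (z \<bullet> z + \<epsilon>)
      - (- of_real (2 * (1 + \<epsilon>)) * z) \<bullet> (- of_real (2 * (1 + \<epsilon>)) * z) = 4 * \<epsilon> * (1 - z \<bullet> z)\<^sup>2"
    by (simp add: inner_complex_def power2_eq_square algebra_simps)
  also have "(- 0 * (LINT w:ball 0 1|lebesgue. u w / (quad_num z w)\<^sup>2) -
      - (4 * \<epsilon> * (1 - z \<bullet> z)\<^sup>2) * (LINT w:ball 0 1|lebesgue. u w / (quad_den \<epsilon> z w)\<^sup>2)) / 2 =
      2 * pi * (\<epsilon> / pi * (1 - z \<bullet> z)\<^sup>2 * (LINT w:ball 0 1|lebesgue. u w / (quad_den \<epsilon> z w)\<^sup>2))"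
    by simp
  also have "\<epsilon> / pi * (1 - z \<bullet> z)\<^sup>2 * (LINT w:ball 0 1|lebesgue. u w / (quad_den \<epsilon> z w)\<^sup>2) =
      (LINT w:ball 0 1|lebesgue. \<epsilon> / pi * (1 - z \<bullet> z)\<^sup>2 * (u w / (quad_den \<epsilon> z w)\<^sup>2))"
    by (rule set_integral_mult_right[symmetric])
  also have "\<dots> = (LINT w:ball 0 1|lebesgue. u w * green_density \<epsilon> z w)"
    by (simp only: green_density_def quad_den_eq power2_norm_eq_inner[of z] power_divide)
      (simp add: mult_ac)
  finally show ?thesis .
qed

section \<open>Averages against the Riesz mass of the softened Green function\<close>

lemma area_disk: "0 \<le> r \<Longrightarrow> measure lebesgue (ball (z::complex) r) = pi * r\<^sup>2"
  by (simp add: content_ball unit_ball_vol_2)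

lemma set_integral_const_ball:
  assumes "0 \<le> r"
  shows "(LINT w:ball (z::complex) r|lebesgue. (a::real)) = a * (pi * r\<^sup>2)"
proof -
  have "emeasure lebesgue (ball z r) < \<infinity>" using emeasure_lborel_ball_finite[of z r] by simp
  then have "(LINT w:ball z r|lebesgue. a) = measure lebesgue (ball z r) *\<^sub>R a"
    unfolding set_lebesgue_integral_def
    by (intro has_bochner_integral_integral_eq has_bochner_integral_indicator) auto
  then show ?thesis by (simp only: area_disk[OF assms] real_scaleR_def mult.commute)
qed

text \<open>The radial integral is computed by the divergence theorem. The field
  \<open>(w - z) \<psi>(w)\<close> with \<open>\<psi> = 1 / (|w - z|\<^sup>2 + K) - 1 / (\<delta>\<^sup>2 + K)\<close> vanishes on the boundary of the disk,
  and its divergence is twice the integrand minus a constant.\<close>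
lemma disk_mass:
  fixes z :: complex
  assumes \<delta>: "0 < \<delta>" and K: "0 < K"
  shows "(LINT w:ball z \<delta>|lebesgue. K / ((norm (z - w))\<^sup>2 + K)\<^sup>2) = pi * \<delta>\<^sup>2 / (\<delta>\<^sup>2 + K)"
proof -
  define q where "q = quad 1 (- 2 * z) (z \<bullet> z + K)"
  have q: "q w = (norm (z - w))\<^sup>2 + K" for w
    unfolding q_def quad_def cmod_power2 by (simp add: inner_complex_def power2_eq_square algebra_simps)
  have qpos: "0 < q w" for w using K unfolding q by (simp add: add_nonneg_pos)
  define \<psi> where "\<psi> w = 1 / q w - 1 / (\<delta>\<^sup>2 + K)" for w
  have lipschitzian_on\<psi>: "lipschitzian_on (cball z \<delta>) (\<lambda>w. 1 / q w + (- (1 / (\<delta>\<^sup>2 + K))))"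
    by (intro lipschitzian_add lipschitzian_const lipschitzian_inverse qpos) (auto simp: q_def quad_lipschitzian)
  have \<psi>: "\<psi> \<in> lipschitz_vanishing z \<delta>"
    using lipschitzian_on\<psi> by (auto simp: lipschitz_vanishing_def \<psi>_def[abs_def] q dist_norm)
  have d\<psi>: "dir_deriv \<psi> e w = - 2 * ((w - z) \<bullet> e) / (q w)\<^sup>2" for e w
  proof -
    have "((\<lambda>t. \<psi> (w + t *\<^sub>R e)) has_real_derivative - (2 * 1 * (w \<bullet> e) + e \<bullet> (- 2 * z)) / (q w)\<^sup>2) (at 0)"
      using quad_derivative[of 1 "- 2 * z" "z \<bullet> z + K" w e, folded q_def] qpos[of w] unfolding \<psi>_def
      by (auto intro!: derivative_eq_intros simp: power2_eq_square)
    then have "dir_deriv \<psi> e w = - (2 * 1 * (w \<bullet> e) + e \<bullet> (- 2 * z)) / (q w)\<^sup>2" by (rule DERIV_imp_deriv)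
    then show ?thesis by (simp add: inner_complex_def algebra_simps)
  qed
  have lipschitzian_on\<phi>: "lipschitzian_on (cball z \<delta>) (\<lambda>w. (w - z) \<bullet> e)" for e
  proof -
    have "lipschitzian_on (cball z \<delta>) (\<lambda>w. w \<bullet> e + - (z \<bullet> e))" by (intro lipschitzian_add lipschitzian_inner lipschitzian_const)
    then show ?thesis by (simp add: inner_diff_left)
  qed
  have d\<phi>: "((\<lambda>t. (w + t *\<^sub>R e - z) \<bullet> e) has_real_derivative e \<bullet> e) (at 0)" for w e :: complex
  proof -
    have "((\<lambda>t. (w - z) \<bullet> e + t * (e \<bullet> e)) has_real_derivative e \<bullet> e) (at 0)"
      by (auto intro!: derivative_eq_intros)
    then show ?thesis by (simp add: inner_add_left inner_diff_left algebra_simps)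
  qed
  have ibp: "(LINT w:ball z \<delta>|lebesgue. dir_deriv \<psi> e w * ((w - z) \<bullet> e)) = - (LINT w:ball z \<delta>|lebesgue. \<psi> w * (e \<bullet> e))" for e
    by (rule integration_by_parts_ball[OF \<psi> lipschitzian_on\<phi> d\<phi>]) (auto intro!: continuous_intros)
  have contq: "continuous_on X q" for X unfolding q_def by (intro continuous_intros)
  have q0: "q w \<noteq> 0" for w using qpos[of w] by simp
  have int\<psi>: "set_integrable lebesgue (ball z \<delta>) \<psi>"
    by (intro set_integrable_ball_continuous lipschitz_vanishing_continuous \<psi>)
  have intd: "set_integrable lebesgue (ball z \<delta>) (\<lambda>w. dir_deriv \<psi> e w * ((w - z) \<bullet> e))" for e
    by (intro set_integrable_dir_deriv_mult \<psi>) (auto intro!: continuous_intros)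
  have intc: "set_integrable lebesgue (ball z \<delta>) (\<lambda>w. 1 / (\<delta>\<^sup>2 + K))"
    by (intro set_integrable_ball_continuous continuous_intros)
  have "(LINT w:ball z \<delta>|lebesgue. K / ((norm (z - w))\<^sup>2 + K)\<^sup>2) =
    (LINT w:ball z \<delta>|lebesgue. (\<psi> w + 1 / (\<delta>\<^sup>2 + K)) +
       (1/2) * (dir_deriv \<psi> 1 w * ((w - z) \<bullet> 1) + dir_deriv \<psi> \<i> w * ((w - z) \<bullet> \<i>)))"
  proof (rule set_lebesgue_integral_cong)
    show "\<forall>w. w \<in> ball z \<delta> \<longrightarrow> K / ((norm (z - w))\<^sup>2 + K)\<^sup>2 = (\<psi> w + 1 / (\<delta>\<^sup>2 + K)) +
       (1/2) * (dir_deriv \<psi> 1 w * ((w - z) \<bullet> 1) + dir_deriv \<psi> \<i> w * ((w - z) \<bullet> \<i>))"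
    proof (intro allI impI)
      fix w
      have "(1/2) * (dir_deriv \<psi> 1 w * ((w - z) \<bullet> 1) + dir_deriv \<psi> \<i> w * ((w - z) \<bullet> \<i>)) =
        - (((w - z) \<bullet> 1) * ((w - z) \<bullet> 1) + ((w - z) \<bullet> \<i>) * ((w - z) \<bullet> \<i>)) / (q w)\<^sup>2"
        unfolding d\<psi> by (simp add: add_divide_distrib diff_divide_distrib algebra_simps)
      also have "\<dots> = - (q w - K) / (q w)\<^sup>2"
        unfolding complex_inner_basis q by (simp add: power2_norm_eq_inner[symmetric] norm_minus_commute)
      finally have 1: "(1/2) * (dir_deriv \<psi> 1 w * ((w - z) \<bullet> 1) + dir_deriv \<psi> \<i> w * ((w - z) \<bullet> \<i>)) = - (q w - K) / (q w)\<^sup>2" .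
      show "K / ((norm (z - w))\<^sup>2 + K)\<^sup>2 = (\<psi> w + 1 / (\<delta>\<^sup>2 + K)) +
         (1/2) * (dir_deriv \<psi> 1 w * ((w - z) \<bullet> 1) + dir_deriv \<psi> \<i> w * ((w - z) \<bullet> \<i>))"
        unfolding 1 unfolding q[symmetric] \<psi>_def using q0[of w]
        by (simp add: power2_eq_square diff_divide_distrib)
    qed
  qed auto
  also have "\<dots> = ((LINT w:ball z \<delta>|lebesgue. \<psi> w) + (LINT w:ball z \<delta>|lebesgue. 1 / (\<delta>\<^sup>2 + K))) +
     (1/2) * ((LINT w:ball z \<delta>|lebesgue. dir_deriv \<psi> 1 w * ((w - z) \<bullet> 1)) + (LINT w:ball z \<delta>|lebesgue. dir_deriv \<psi> \<i> w * ((w - z) \<bullet> \<i>)))"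
    using int\<psi> intd intc
    by (simp only: set_integral_add set_integral_mult_right set_integrable_mult_right)
  also have "\<dots> = pi * \<delta>\<^sup>2 / (\<delta>\<^sup>2 + K)"
    unfolding ibp using \<delta> by (simp add: set_integral_const_ball)
  finally show ?thesis .
qed

text \<open>The segment from \<open>w\<close> to the nearest boundary point has length \<open>1 - norm w\<close>.\<close>
lemma lipschitz_vanishing_bounds:
  assumes lip: "L-lipschitz_on (cball 0 1) u" and zero: "\<forall>z\<in>sphere 0 1. u z = 0"
    and w: "(w::complex) \<in> cball 0 1"
  shows "\<bar>u w\<bar> \<le> L * (1 - norm w)"
proof -
  define b where "b = (if w = 0 then 1 else w / of_real (norm w))"
  have b: "norm b = 1" by (auto simp: b_def norm_divide)
  have "dist w b = 1 - norm w"
  proof (cases "w = 0")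
    case False
    have "w - b = w * of_real (1 - 1 / norm w)" using False by (simp add: b_def field_simps)
    then have "norm (w - b) = norm w * \<bar>1 - 1 / norm w\<bar>" by (simp only: norm_mult norm_of_real)
    also have "\<dots> = \<bar>norm w - 1\<bar>" using False by (simp add: abs_mult[symmetric] field_simps flip: abs_mult_pos')
    finally show ?thesis using w by (simp add: dist_norm)
  qed (simp add: b_def dist_norm)
  moreover have "dist (u w) (u b) \<le> L * dist w b"
    using b w by (intro lipschitz_onD[OF lip]) auto
  ultimately show ?thesis using zero b by (simp add: dist_real_def)
qed

lemma green_density_pos:
  assumes "0 < \<epsilon>" shows "0 \<le> green_density \<epsilon> z w"
  using assms by (simp add: green_density_def)

lemma green_density_continuous:
  assumes "0 < \<epsilon>" "z \<in> ball 0 1"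
  shows "continuous_on (cball 0 1) (green_density \<epsilon> z)"
  unfolding green_density_def
proof (intro continuous_intros ballI)
  show "(norm (z - w))\<^sup>2 + \<epsilon> * (norm (1 - cnj z * w))\<^sup>2 \<noteq> 0" if "w \<in> cball 0 1" for w
    using quad_den_pos[OF assms that] unfolding quad_den_eq by simp
qed

lemma green_density_far:
  assumes \<epsilon>: "0 < \<epsilon>" and z: "z \<in> ball 0 1" and \<delta>: "0 < \<delta>" "\<delta> \<le> norm (z - w)"
  shows "green_density \<epsilon> z w \<le> \<epsilon> / (pi * \<delta> ^ 4)"
proof -
  have m: "0 < 1 - (norm z)\<^sup>2" "1 - (norm z)\<^sup>2 \<le> 1" using z by (auto simp: power_less_one_iff)
  have "\<delta>\<^sup>2 \<le> (norm (z - w))\<^sup>2 + \<epsilon> * (norm (1 - cnj z * w))\<^sup>2"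
    using \<delta> \<epsilon> by (intro order_trans[OF power_mono[of \<delta> "norm (z - w)" 2]]) auto
  then have "(1 - (norm z)\<^sup>2) / ((norm (z - w))\<^sup>2 + \<epsilon> * (norm (1 - cnj z * w))\<^sup>2) \<le> 1 / \<delta>\<^sup>2"
    using m \<delta> by (intro frac_le) auto
  then have "((1 - (norm z)\<^sup>2) / ((norm (z - w))\<^sup>2 + \<epsilon> * (norm (1 - cnj z * w))\<^sup>2))\<^sup>2 \<le> (1 / \<delta>\<^sup>2)\<^sup>2"
    using m \<epsilon> by (intro power_mono) auto
  then have "green_density \<epsilon> z w \<le> \<epsilon> / pi * (1 / \<delta>\<^sup>2)\<^sup>2"
    unfolding green_density_def using \<epsilon> by (intro mult_left_mono) auto
  then show ?thesis by (simp add: power_divide flip: power_mult)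
qed

lemma norm_one_minus_cnj:
  assumes "norm z \<le> 1" "norm (z - w) \<le> \<delta>"
  shows "1 - (norm z)\<^sup>2 - \<delta> \<le> norm (1 - cnj z * w)" "norm (1 - cnj z * w) \<le> 1 - (norm z)\<^sup>2 + \<delta>"
proof -
  have eq: "1 - cnj z * w = of_real (1 - (norm z)\<^sup>2) + cnj z * (z - w)"
    by (simp add: complex_norm_square algebra_simps del: of_real_power)
  have "norm (cnj z * (z - w)) \<le> \<delta>"
    using assms mult_mono[of "norm z" 1 "norm (z - w)" \<delta>] by (simp add: norm_mult)
  moreover have "norm (of_real (1 - (norm z)\<^sup>2) :: complex) = 1 - (norm z)\<^sup>2"
    using assms by (simp only: norm_of_real) (simp add: power_le_one)
  ultimately show "1 - (norm z)\<^sup>2 - \<delta> \<le> norm (1 - cnj z * w)" "norm (1 - cnj z * w) \<le> 1 - (norm z)\<^sup>2 + \<delta>"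
    using norm_triangle_ineq[of "of_real (1 - (norm z)\<^sup>2)" "cnj z * (z - w)"]
      norm_diff_ineq[of "of_real (1 - (norm z)\<^sup>2)" "cnj z * (z - w)"] unfolding eq by linarith+
qed

lemma ball_subset_unit_disk:
  fixes z :: complex
  assumes "\<delta> < 1 - norm z"
  shows "ball z \<delta> \<subseteq> ball 0 1"
proof
  fix w assume "w \<in> ball z \<delta>"
  then have "norm (z - w) < \<delta>" by (simp add: dist_norm)
  then show "w \<in> ball 0 1" using assms norm_triangle_sub[of w z] by (simp add: norm_minus_commute)
qed

lemma set_integral_subball:
  fixes g :: "complex \<Rightarrow> real"
  assumes sub: "ball z \<delta> \<subseteq> ball c r" and contg: "continuous_on (cball z \<delta>) g"
  shows "set_integrable lebesgue (ball c r) (\<lambda>w. indicator (ball z \<delta>) w * g w)"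
    and "(LINT w:ball c r|lebesgue. indicator (ball z \<delta>) w * g w) = (LINT w:ball z \<delta>|lebesgue. g w)"
proof -
  have eq: "(\<lambda>w. indicator (ball c r) w *\<^sub>R (indicator (ball z \<delta>) w * g w)) =
      (\<lambda>w. indicator (ball z \<delta>) w *\<^sub>R g w)"
    using sub by (auto simp: fun_eq_iff indicator_def)
  show "set_integrable lebesgue (ball c r) (\<lambda>w. indicator (ball z \<delta>) w * g w)"
    using set_integrable_ball_continuous[OF contg] unfolding set_integrable_def eq .
  show "(LINT w:ball c r|lebesgue. indicator (ball z \<delta>) w * g w) = (LINT w:ball z \<delta>|lebesgue. g w)"
    unfolding set_lebesgue_integral_def eq ..
qed

lemma lipschitz_vanishing_times_density_far:
  assumes lip: "L-lipschitz_on (cball 0 1) u" and zero: "\<forall>z\<in>sphere 0 1. u z = 0"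
    and w: "w \<in> cball 0 1" and \<epsilon>: "0 < \<epsilon>" and z: "z \<in> ball 0 1"
    and \<delta>: "0 < \<delta>" "\<delta> \<le> norm (z - w)"
  shows "\<bar>u w * green_density \<epsilon> z w\<bar> \<le> L * (\<epsilon> / (pi * \<delta> ^ 4))"
proof -
  have L0: "0 \<le> L" using lip by (rule lipschitz_on_nonneg)
  have "\<bar>u w\<bar> \<le> L * (1 - norm w)" by (rule lipschitz_vanishing_bounds[OF lip zero w])
  also have "\<dots> \<le> L * 1" using L0 by (intro mult_left_mono) auto
  finally have "\<bar>u w\<bar> \<le> L" by simp
  then show ?thesis
    unfolding abs_mult using green_density_pos[OF \<epsilon>] green_density_far[OF \<epsilon> z \<delta>] L0
    by (intro mult_mono) auto
qed

text \<open>Within distance \<open>\<delta>\<close> of \<open>z\<close> the factor \<open>norm (1 - cnj z * w)\<close> differs from \<open>m\<close> by at most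
  \<open>\<delta>\<close>, so the density is bounded below by a radial function with known mass. Outside, the density is
  at most \<open>\<epsilon> / (\<pi> \<delta>\<^sup>4)\<close> and \<open>|u|\<close> is at most \<open>L\<close>. The bound tends to \<open>u z\<close> when first \<open>\<epsilon>\<close> and then \<open>\<delta>\<close> tends
  to zero, and it depends on \<open>z\<close> only through \<open>m\<close> and \<open>u z\<close>.\<close>
lemma green_average_lower:
  assumes lip: "L-lipschitz_on (cball 0 1) u" and zero: "\<forall>z\<in>sphere 0 1. u z = 0"
    and \<epsilon>: "0 < \<epsilon>" and z: "z \<in> ball 0 1" and \<delta>: "0 < \<delta>" "\<delta> < 1 - norm z" "L * \<delta> \<le> u z"
  defines "m \<equiv> 1 - (norm z)\<^sup>2"
  shows "(u z - L * \<delta>) * (m / (m + \<delta>))\<^sup>2 * (\<delta>\<^sup>2 / (\<delta>\<^sup>2 + \<epsilon> * (m + \<delta>)\<^sup>2)) - L * \<epsilon> / \<delta> ^ 4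
    \<le> (LINT w:ball 0 1|lebesgue. u w * green_density \<epsilon> z w)"
proof -
  have L0: "0 \<le> L" using lip by (rule lipschitz_on_nonneg)
  have m: "0 < m" using z by (simp add: m_def power_less_one_iff)
  define K where "K = \<epsilon> * (m + \<delta>)\<^sup>2"
  have K: "0 < K" using \<epsilon> m \<delta> by (simp add: K_def)
  define g where "g w = K / ((norm (z - w))\<^sup>2 + K)\<^sup>2" for w
  define C where "C = (u z - L * \<delta>) * (m / (m + \<delta>))\<^sup>2 / pi"
  have C: "0 \<le> C" using \<delta> by (simp add: C_def)
  have sub: "ball z \<delta> \<subseteq> ball 0 1" using \<delta>(2) by (rule ball_subset_unit_disk)
  have contg: "continuous_on (cball z \<delta>) g"
    unfolding g_def using K
    by (intro continuous_intros) (smt (verit) zero_le_power2 zero_less_power2)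
  note intg = set_integral_subball(1)[OF sub contg]
  have intc: "set_integrable lebesgue (ball (0::complex) 1) (\<lambda>w. L * \<epsilon> / (pi * \<delta> ^ 4))"
    by (intro set_integrable_ball_continuous continuous_intros)
  note eqg = set_integral_subball(2)[OF sub contg]
  have "(u z - L * \<delta>) * (m / (m + \<delta>))\<^sup>2 * (\<delta>\<^sup>2 / (\<delta>\<^sup>2 + K)) - L * \<epsilon> / \<delta> ^ 4 =
    C * (LINT w:ball 0 1|lebesgue. indicator (ball z \<delta>) w * g w)
      - (LINT w:ball (0::complex) 1|lebesgue. L * \<epsilon> / (pi * \<delta> ^ 4))"
    unfolding eqg unfolding g_def using disk_mass[OF \<delta>(1) K, of z]
    by (simp add: set_integral_const_ball C_def)
  also have "\<dots> = (LINT w:ball 0 1|lebesgue. C * (indicator (ball z \<delta>) w * g w) - L * \<epsilon> / (pi * \<delta> ^ 4))"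
    using intg intc by (simp only: set_integral_diff set_integral_mult_right set_integrable_mult_right)
  also have "\<dots> \<le> (LINT w:ball 0 1|lebesgue. u w * green_density \<epsilon> z w)"
  proof (rule set_integral_mono)
    show "set_integrable lebesgue (ball 0 1) (\<lambda>w. C * (indicator (ball z \<delta>) w * g w) - L * \<epsilon> / (pi * \<delta> ^ 4))"
      by (intro set_integral_diff set_integrable_mult_right intg set_integrable_ball_continuous continuous_intros)
    show "set_integrable lebesgue (ball 0 1) (\<lambda>w. u w * green_density \<epsilon> z w)"
      by (intro set_integrable_ball_continuous continuous_on_mult green_density_continuous \<epsilon> z
          lipschitz_on_continuous_on[OF lip])
    fix w :: complex assume w: "w \<in> ball 0 1"
    show "C * (indicator (ball z \<delta>) w * g w) - L * \<epsilon> / (pi * \<delta> ^ 4) \<le> u w * green_density \<epsilon> z w"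
    proof (cases "w \<in> ball z \<delta>")
      case True
      then have d: "norm (z - w) < \<delta>" by (simp add: dist_norm)
      have "\<bar>u z - u w\<bar> \<le> L * norm (z - w)"
        using lipschitz_onD[OF lip, of z w] z w by (simp add: dist_norm)
      also have "\<dots> \<le> L * \<delta>" using d L0 by (intro mult_left_mono) auto
      finally have uw: "u z - L * \<delta> \<le> u w" by linarith
      have "norm (1 - cnj z * w) \<le> m + \<delta>"
        using norm_one_minus_cnj(2)[of z w \<delta>] d z by (simp add: m_def)
      then have "(norm (z - w))\<^sup>2 + \<epsilon> * (norm (1 - cnj z * w))\<^sup>2 \<le> (norm (z - w))\<^sup>2 + K"
        unfolding K_def using \<epsilon> by (intro add_left_mono mult_left_mono power_mono) auto
      then have "m / ((norm (z - w))\<^sup>2 + K) \<le> m / ((norm (z - w))\<^sup>2 + \<epsilon> * (norm (1 - cnj z * w))\<^sup>2)"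
        using m quad_den_pos[OF \<epsilon> z, of w] w unfolding quad_den_eq by (intro frac_le) auto
      then have "\<epsilon> / pi * (m / ((norm (z - w))\<^sup>2 + K))\<^sup>2 \<le> green_density \<epsilon> z w"
        unfolding green_density_def m_def[symmetric] using m K \<epsilon>
        by (intro mult_left_mono power_mono) auto
      also have "\<epsilon> / pi * (m / ((norm (z - w))\<^sup>2 + K))\<^sup>2 = (m / (m + \<delta>))\<^sup>2 / pi * g w"
        unfolding g_def K_def using m \<delta> by (simp add: power_divide)
      finally have gd: "(m / (m + \<delta>))\<^sup>2 / pi * g w \<le> green_density \<epsilon> z w" .
      have "C * g w = (u z - L * \<delta>) * ((m / (m + \<delta>))\<^sup>2 / pi * g w)" by (simp add: C_def)
      also have "\<dots> \<le> (u z - L * \<delta>) * green_density \<epsilon> z w" using gd \<delta> by (intro mult_left_mono) auto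
      also have "\<dots> \<le> u w * green_density \<epsilon> z w"
        using uw green_density_pos[OF \<epsilon>] by (intro mult_right_mono) auto
      finally have "C * g w \<le> u w * green_density \<epsilon> z w" .
      moreover have "0 \<le> L * \<epsilon> / (pi * \<delta> ^ 4)" using L0 \<epsilon> \<delta> by simp
      ultimately show ?thesis using True by simp
    next
      case False
      then have d: "\<delta> \<le> norm (z - w)" by (simp add: dist_norm)
      have "\<bar>u w * green_density \<epsilon> z w\<bar> \<le> L * (\<epsilon> / (pi * \<delta> ^ 4))"
        using w by (intro lipschitz_vanishing_times_density_far[OF lip zero _ \<epsilon> z \<delta>(1) d]) simp
      then show ?thesis using False by (simp add: abs_le_iff)
    qed
  qed
  finally show ?thesis unfolding K_def .
qed

lemma green_average_upper:
  assumes lip: "L-lipschitz_on (cball 0 1) u" and zero: "\<forall>z\<in>sphere 0 1. u z = 0"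
    and \<epsilon>: "0 < \<epsilon>" and z: "z \<in> ball 0 1" and \<delta>: "0 < \<delta>" "\<delta> < 1 - norm z" "0 \<le> u z"
  defines "m \<equiv> 1 - (norm z)\<^sup>2"
  shows "(LINT w:ball 0 1|lebesgue. u w * green_density \<epsilon> z w)
    \<le> (u z + L * \<delta>) * (m / (m - \<delta>))\<^sup>2 + L * \<epsilon> / \<delta> ^ 4"
proof -
  have L0: "0 \<le> L" using lip by (rule lipschitz_on_nonneg)
  have "(norm z)\<^sup>2 \<le> norm z" using z by (simp add: power2_eq_square mult_left_le)
  then have m: "0 < m" "\<delta> < m" using \<delta> by (auto simp: m_def)
  define K where "K = \<epsilon> * (m - \<delta>)\<^sup>2"
  have K: "0 < K" using \<epsilon> m \<delta> by (simp add: K_def)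
  define g where "g w = K / ((norm (z - w))\<^sup>2 + K)\<^sup>2" for w
  define C where "C = (u z + L * \<delta>) * (m / (m - \<delta>))\<^sup>2 / pi"
  have C: "0 \<le> C" using \<delta> L0 by (simp add: C_def)
  have sub: "ball z \<delta> \<subseteq> ball 0 1" using \<delta>(2) by (rule ball_subset_unit_disk)
  have contg: "continuous_on (cball z \<delta>) g"
    unfolding g_def using K
    by (intro continuous_intros) (smt (verit) zero_le_power2 zero_less_power2)
  note intg = set_integral_subball(1)[OF sub contg]
  have intc: "set_integrable lebesgue (ball (0::complex) 1) (\<lambda>w. L * \<epsilon> / (pi * \<delta> ^ 4))"
    by (intro set_integrable_ball_continuous continuous_intros)
  note eqg = set_integral_subball(2)[OF sub contg]
  have "(LINT w:ball 0 1|lebesgue. u w * green_density \<epsilon> z w) \<le>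
     (LINT w:ball 0 1|lebesgue. C * (indicator (ball z \<delta>) w * g w) + L * \<epsilon> / (pi * \<delta> ^ 4))"
  proof (rule set_integral_mono)
    show "set_integrable lebesgue (ball 0 1) (\<lambda>w. C * (indicator (ball z \<delta>) w * g w) + L * \<epsilon> / (pi * \<delta> ^ 4))"
      by (intro set_integral_add set_integrable_mult_right intg set_integrable_ball_continuous continuous_intros)
    show "set_integrable lebesgue (ball 0 1) (\<lambda>w. u w * green_density \<epsilon> z w)"
      by (intro set_integrable_ball_continuous continuous_on_mult green_density_continuous \<epsilon> z
          lipschitz_on_continuous_on[OF lip])
    fix w :: complex assume w: "w \<in> ball 0 1"
    show "u w * green_density \<epsilon> z w \<le> C * (indicator (ball z \<delta>) w * g w) + L * \<epsilon> / (pi * \<delta> ^ 4)"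
    proof (cases "w \<in> ball z \<delta>")
      case True
      then have d: "norm (z - w) < \<delta>" by (simp add: dist_norm)
      have "\<bar>u z - u w\<bar> \<le> L * norm (z - w)"
        using lipschitz_onD[OF lip, of z w] z w by (simp add: dist_norm)
      also have "\<dots> \<le> L * \<delta>" using d L0 by (intro mult_left_mono) auto
      finally have uw: "u w \<le> u z + L * \<delta>" by linarith
      have "m - \<delta> \<le> norm (1 - cnj z * w)"
        using norm_one_minus_cnj(1)[of z w \<delta>] d z by (simp add: m_def)
      then have "(norm (z - w))\<^sup>2 + K \<le> (norm (z - w))\<^sup>2 + \<epsilon> * (norm (1 - cnj z * w))\<^sup>2"
        unfolding K_def using \<epsilon> m by (intro add_left_mono mult_left_mono power_mono) auto
      then have "m / ((norm (z - w))\<^sup>2 + \<epsilon> * (norm (1 - cnj z * w))\<^sup>2) \<le> m / ((norm (z - w))\<^sup>2 + K)"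
        using m K by (intro frac_le) (auto simp: add_nonneg_pos)
      then have "green_density \<epsilon> z w \<le> \<epsilon> / pi * (m / ((norm (z - w))\<^sup>2 + K))\<^sup>2"
        unfolding green_density_def m_def[symmetric] using m K \<epsilon>
        by (intro mult_left_mono power_mono) auto
      also have "\<epsilon> / pi * (m / ((norm (z - w))\<^sup>2 + K))\<^sup>2 = (m / (m - \<delta>))\<^sup>2 / pi * g w"
        unfolding g_def K_def using m \<delta> by (simp add: power_divide)
      finally have gd: "green_density \<epsilon> z w \<le> (m / (m - \<delta>))\<^sup>2 / pi * g w" .
      have "u w * green_density \<epsilon> z w \<le> (u z + L * \<delta>) * green_density \<epsilon> z w"
        using uw green_density_pos[OF \<epsilon>] by (intro mult_right_mono) auto
      also have "\<dots> \<le> (u z + L * \<delta>) * ((m / (m - \<delta>))\<^sup>2 / pi * g w)"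
        using gd \<delta> L0 by (intro mult_left_mono) auto
      also have "\<dots> = C * g w" by (simp add: C_def)
      finally have "u w * green_density \<epsilon> z w \<le> C * g w" .
      moreover have "0 \<le> L * \<epsilon> / (pi * \<delta> ^ 4)" using L0 \<epsilon> \<delta> by simp
      ultimately show ?thesis using True by simp
    next
      case False
      then have d: "\<delta> \<le> norm (z - w)" by (simp add: dist_norm)
      have "\<bar>u w * green_density \<epsilon> z w\<bar> \<le> L * (\<epsilon> / (pi * \<delta> ^ 4))"
        using w by (intro lipschitz_vanishing_times_density_far[OF lip zero _ \<epsilon> z \<delta>(1) d]) simp
      then show ?thesis using False by (simp add: abs_le_iff)
    qed
  qed
  also have "\<dots> = C * (LINT w:ball 0 1|lebesgue. indicator (ball z \<delta>) w * g w)
      + (LINT w:ball (0::complex) 1|lebesgue. L * \<epsilon> / (pi * \<delta> ^ 4))"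
    using intg intc by (simp only: set_integral_add set_integral_mult_right set_integrable_mult_right)
  also have "\<dots> = (u z + L * \<delta>) * (m / (m - \<delta>))\<^sup>2 * (\<delta>\<^sup>2 / (\<delta>\<^sup>2 + K)) + L * \<epsilon> / \<delta> ^ 4"
    unfolding eqg unfolding g_def using disk_mass[OF \<delta>(1) K, of z]
    by (simp add: set_integral_const_ball C_def)
  also have "\<dots> \<le> (u z + L * \<delta>) * (m / (m - \<delta>))\<^sup>2 * 1 + L * \<epsilon> / \<delta> ^ 4"
  proof -
    have "0 < \<delta>\<^sup>2 + K" using K by (simp add: add_nonneg_pos)
    then have "\<delta>\<^sup>2 / (\<delta>\<^sup>2 + K) \<le> 1" using K by (simp only: divide_le_eq_1_pos)
    then show ?thesis using \<delta> L0 by (intro add_right_mono mult_left_mono) auto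
  qed
  finally show ?thesis by simp
qed

text \<open>Superharmonicity of the softened Green function, in integrated form. The kernel increases
  when \<open>\<epsilon>\<close> decreases and the density is nonnegative, so replacing \<open>\<epsilon>\<close> by \<open>\<epsilon>' \<le> \<epsilon>\<close> in the
  first argument increases the left-hand side. By symmetry the result is an average of
  \<open>soft_green \<epsilon> w\<close> against the density with parameter \<open>\<epsilon>'\<close>, which tends to the value at \<open>z\<close> as \<open>\<epsilon>' \<rightarrow> 0\<close>.\<close>
lemma dirichlet_soft_green_le:
  assumes \<epsilon>: "0 < \<epsilon>" and z: "z \<in> ball 0 1" and w: "w \<in> ball 0 1"
  shows "dirichlet (soft_green \<epsilon> z) (soft_green \<epsilon> w) \<le> 2 * pi * soft_green \<epsilon> w z"
proof -
  obtain L where L: "L-lipschitz_on (cball 0 1) (soft_green \<epsilon> w)" "\<forall>x\<in>sphere 0 1. soft_green \<epsilon> w x = 0"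
    using soft_green_lipschitz_vanishing[OF \<epsilon> w] by (auto simp: lipschitz_vanishing_def)
  have L0: "0 \<le> L" using L(1) by (rule lipschitz_on_nonneg)
  define X where "X = dirichlet (soft_green \<epsilon> z) (soft_green \<epsilon> w) / (2 * pi)"
  define m where "m = 1 - (norm z)\<^sup>2"
  have m0: "m > 0" using z by (simp add: m_def power_less_one_iff)
  have 1: "X \<le> (soft_green \<epsilon> w z + L * \<delta>) * (m / (m - \<delta>))\<^sup>2 + L * \<epsilon>' / \<delta> ^ 4"
    if \<epsilon>': "0 < \<epsilon>'" "\<epsilon>' \<le> \<epsilon>" and \<delta>: "0 < \<delta>" "\<delta> < 1 - norm z" for \<epsilon>' \<delta>
  proof -
    have "dirichlet (soft_green \<epsilon> z) (soft_green \<epsilon> w) \<le> dirichlet (soft_green \<epsilon>' z) (soft_green \<epsilon> w)"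
      unfolding dirichlet_soft_green[OF soft_green_lipschitz_vanishing[OF \<epsilon> z] \<epsilon> w]
        dirichlet_soft_green[OF soft_green_lipschitz_vanishing[OF \<epsilon>'(1) z] \<epsilon> w]
    proof (intro mult_left_mono set_integral_mono)
      have "set_integrable lebesgue (ball 0 1) (\<lambda>x. soft_green e z x * green_density \<epsilon> w x)" if "0 < e" for e
        by (intro set_integrable_ball_continuous continuous_on_mult green_density_continuous \<epsilon> w
          lipschitz_vanishing_continuous soft_green_lipschitz_vanishing z that)
      then show "set_integrable lebesgue (ball 0 1) (\<lambda>x. soft_green \<epsilon> z x * green_density \<epsilon> w x)"
        "set_integrable lebesgue (ball 0 1) (\<lambda>x. soft_green \<epsilon>' z x * green_density \<epsilon> w x)"
        using \<epsilon> \<epsilon>' by auto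
      fix x :: complex assume "x \<in> ball 0 1"
      then show "soft_green \<epsilon> z x * green_density \<epsilon> w x \<le> soft_green \<epsilon>' z x * green_density \<epsilon> w x"
        by (intro mult_right_mono soft_green_antimono \<epsilon>' z green_density_pos \<epsilon>)
    qed auto
    also have "\<dots> = 2 * pi * (LINT x:ball 0 1|lebesgue. soft_green \<epsilon> w x * green_density \<epsilon>' z x)"
      unfolding dirichlet_commute[of "soft_green \<epsilon>' z"]
      by (rule dirichlet_soft_green[OF soft_green_lipschitz_vanishing[OF \<epsilon> w] \<epsilon>'(1) z])
    finally have "X \<le> (LINT x:ball 0 1|lebesgue. soft_green \<epsilon> w x * green_density \<epsilon>' z x)"
      by (simp add: X_def field_simps)
    also have "\<dots> \<le> (soft_green \<epsilon> w z + L * \<delta>) * (m / (m - \<delta>))\<^sup>2 + L * \<epsilon>' / \<delta> ^ 4"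
      unfolding m_def
      by (rule green_average_upper[OF L \<epsilon>'(1) z \<delta>]) (use soft_green_pos[OF \<epsilon> w z] in simp)
    finally show ?thesis .
  qed
  have 2: "X \<le> (soft_green \<epsilon> w z + L * \<delta>) * (m / (m - \<delta>))\<^sup>2" if \<delta>: "0 < \<delta>" "\<delta> < 1 - norm z" for \<delta>
  proof (rule tendsto_lowerbound)
    let ?c = "(soft_green \<epsilon> w z + L * \<delta>) * (m / (m - \<delta>))\<^sup>2"
    have "((\<lambda>e. ?c + L * e / \<delta> ^ 4) \<longlongrightarrow> ?c + L * 0 / \<delta> ^ 4) (at_right 0)"
      using \<delta> by (intro tendsto_intros) auto
    then show "((\<lambda>e. ?c + L * e / \<delta> ^ 4) \<longlongrightarrow> ?c) (at_right 0)" by simp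
    show "\<forall>\<^sub>F e in at_right 0. X \<le> ?c + L * e / \<delta> ^ 4"
      using eventually_at_right_real[OF \<epsilon>] by eventually_elim (use 1 \<delta> in auto)
  qed simp
  have "X \<le> soft_green \<epsilon> w z"
  proof (rule tendsto_lowerbound)
    have "((\<lambda>\<delta>. (soft_green \<epsilon> w z + L * \<delta>) * (m / (m - \<delta>))\<^sup>2) \<longlongrightarrow>
       (soft_green \<epsilon> w z + L * 0) * (m / (m - 0))\<^sup>2) (at_right 0)"
      using m0 by (intro tendsto_intros) auto
    then show "((\<lambda>\<delta>. (soft_green \<epsilon> w z + L * \<delta>) * (m / (m - \<delta>))\<^sup>2) \<longlongrightarrow> soft_green \<epsilon> w z) (at_right 0)"
      using m0 by simp
    have "0 < 1 - norm z" using z by simp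
    from eventually_at_right_real[OF this]
    show "\<forall>\<^sub>F \<delta> in at_right 0. X \<le> (soft_green \<epsilon> w z + L * \<delta>) * (m / (m - \<delta>))\<^sup>2"
      by eventually_elim (use 2 in auto)
  qed simp
  then show ?thesis by (simp add: X_def field_simps)
qed

section \<open>Finite charges that are nearly in equilibrium\<close>

text \<open>First variation at a charge whose energy is within \<open>t\<^sup>2\<close> of the infimum: moving a fraction \<open>t\<close> of the charge
  to a point \<open>z\<close> changes the energy by \<open>2 t (V(z) - Q)\<close> up to a term of order \<open>t\<^sup>2\<close>, and it cannot lower
  the energy by more than \<open>t\<^sup>2\<close>. Hence the potential \<open>V(z)\<close> is at least \<open>Q\<close> up to a term of order
  \<open>t\<close>. The charge is only nearly minimal because the infimum over finite charges on an infinite set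
  need not be attained.\<close>
lemma near_equilibrium:
  fixes k :: "'b \<Rightarrow> 'b \<Rightarrow> real"
  assumes ne: "X \<noteq> {}" and \<eta>: "0 < \<eta>"
    and k0: "\<And>x y. x \<in> X \<Longrightarrow> y \<in> X \<Longrightarrow> 0 \<le> k x y"
    and kM: "\<And>x y. x \<in> X \<Longrightarrow> y \<in> X \<Longrightarrow> k x y \<le> M"
    and sym: "\<And>x y. x \<in> X \<Longrightarrow> y \<in> X \<Longrightarrow> k x y = k y x"
  obtains F a where "finite F" "F \<subseteq> X" "\<And>x. 0 \<le> a x" "sum a F = 1"
    "\<And>z. z \<in> X \<Longrightarrow> (\<Sum>x\<in>F. a x * (\<Sum>y\<in>F. a y * k x y)) - \<eta> \<le> (\<Sum>y\<in>F. a y * k z y)"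
proof -
  define P where "P = {(F, a :: 'b \<Rightarrow> real). finite F \<and> F \<subseteq> X \<and> (\<forall>x. 0 \<le> a x) \<and> (\<forall>x. x \<notin> F \<longrightarrow> a x = 0) \<and> sum a F = 1}"
  define Q where "Q = (\<lambda>(F, a :: 'b \<Rightarrow> real). \<Sum>x\<in>F. a x * (\<Sum>y\<in>F. a y * k x y))"
  obtain x0 where x0: "x0 \<in> X" using ne by blast
  have M0: "0 \<le> M" using k0[OF x0 x0] kM[OF x0 x0] by linarith
  have "({x0}, \<lambda>x. if x = x0 then 1 else 0) \<in> P" using x0 by (auto simp: P_def)
  then have Pne: "Q ` P \<noteq> {}" by blast
  have Q0: "0 \<le> Q p" if "p \<in> P" for p
    using that k0 by (auto simp: P_def Q_def intro!: sum_nonneg mult_nonneg_nonneg)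
  have bdd: "bdd_below (Q ` P)" using Q0 by (auto intro!: bdd_belowI2)
(* The error in the first variation comes out as t (2 M + 1) / 2. *)
  define t where "t = min (1/2) (\<eta> / (2 * M + 1))"
  have "0 < t" using \<eta> M0 by (simp add: t_def)
  moreover have "t \<le> 1/2" unfolding t_def by (rule min.cobounded1)
  ultimately have t: "0 < t" "t \<le> 1/2" .
  have "t \<le> \<eta> / (2 * M + 1)" by (simp add: t_def)
  then have t\<eta>: "t * (2 * M + 1) \<le> \<eta>" using M0 by (subst (asm) pos_le_divide_eq) auto
  have "Inf (Q ` P) < Inf (Q ` P) + t\<^sup>2" using t by simp
  then obtain p where p: "p \<in> P" "Q p < Inf (Q ` P) + t\<^sup>2"
    using cInf_lessD[OF Pne] by blast
  obtain F a where Fa: "p = (F, a)" by (cases p)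
  have F: "finite F" "F \<subseteq> X" "\<And>x. 0 \<le> a x" "\<And>x. x \<notin> F \<Longrightarrow> a x = 0" "sum a F = 1"
    using p(1) by (auto simp: P_def Fa)
  show ?thesis
  proof (rule that[OF F(1,2,3,5)])
    fix z assume z: "z \<in> X"
    have FX: "x \<in> X" if "x \<in> F" for x using F(2) that by blast
    define F' where "F' = insert z F"
    define a' where "a' x = (1 - t) * a x + t * (if x = z then 1 else 0)" for x
    have F': "finite F'" "F' \<subseteq> X" "F \<subseteq> F'" using F z by (auto simp: F'_def)
    have ext: "(\<Sum>x\<in>F'. a' x * f x) = (1 - t) * (\<Sum>x\<in>F. a x * f x) + t * f z" for f :: "'b \<Rightarrow> real"
    proof -
      have 1: "(\<Sum>x\<in>F'. a x * f x) = (\<Sum>x\<in>F. a x * f x)"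
        using F F' by (intro sum.mono_neutral_right) auto
      have "(\<Sum>x\<in>F'. t * (if x = z then 1 else 0) * f x) = (\<Sum>x\<in>F'. if x = z then t * f z else 0)"
        by (intro sum.cong) auto
      also have "\<dots> = t * f z" using F' by (simp add: F'_def)
      finally have 2: "(\<Sum>x\<in>F'. t * (if x = z then 1 else 0) * f x) = t * f z" .
      have "(\<Sum>x\<in>F'. a' x * f x) = (\<Sum>x\<in>F'. (1 - t) * (a x * f x) + t * (if x = z then 1 else 0) * f x)"
        by (intro sum.cong) (auto simp: a'_def algebra_simps)
      also have "\<dots> = (1 - t) * (\<Sum>x\<in>F. a x * f x) + t * f z"
        unfolding sum.distrib 2 sum_distrib_left[symmetric] 1 ..
      finally show ?thesis .
    qed
    have "sum a' F' = 1" using ext[of "\<lambda>_. 1"] F(5) by simp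
    then have "(F', a') \<in> P" using F F' t by (auto simp: P_def a'_def F'_def)
    then have InfQ: "Inf (Q ` P) \<le> Q (F', a')" using bdd by (intro cInf_lower) auto
    define V where "V = (\<Sum>y\<in>F. a y * k z y)"
    define q where "q = (\<Sum>x\<in>F. a x * (\<Sum>y\<in>F. a y * k x y))"
    have V': "(\<Sum>x\<in>F. a x * k x z) = V"
      unfolding V_def by (intro sum.cong refl arg_cong2[where f = "(*)"] sym FX z)
    have "Q (F', a') = (1 - t) * (\<Sum>x\<in>F. a x * ((1 - t) * (\<Sum>y\<in>F. a y * k x y) + t * k x z)) + t * ((1 - t) * V + t * k z z)"
      unfolding Q_def prod.case ext V_def ..
    also have "(\<Sum>x\<in>F. a x * ((1 - t) * (\<Sum>y\<in>F. a y * k x y) + t * k x z)) = (1 - t) * q + t * V"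
      unfolding q_def V'[symmetric] sum_distrib_left sum.distrib[symmetric]
      by (intro sum.cong refl) (simp add: algebra_simps sum_distrib_left)
    finally have Q': "Q (F', a') = (1 - t)\<^sup>2 * q + 2 * t * (1 - t) * V + t\<^sup>2 * k z z"
      by (simp add: algebra_simps power2_eq_square)
    have "Q p = q" by (simp add: Fa Q_def q_def)
    with Q' InfQ have *: "q - t\<^sup>2 \<le> (1 - t)\<^sup>2 * q + 2 * t * (1 - t) * V + t\<^sup>2 * k z z"
      using p(2) by linarith
    have V0: "0 \<le> V" unfolding V_def by (intro sum_nonneg mult_nonneg_nonneg F(3) k0 z FX)
    have qM: "q \<le> M"
    proof -
      have "q \<le> (\<Sum>x\<in>F. a x * (\<Sum>y\<in>F. a y * M))"
        unfolding q_def by (intro sum_mono mult_left_mono kM FX F(3))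
      also have "\<dots> = M" by (simp only: sum_distrib_right[symmetric] F(5) mult_1)
      finally show ?thesis .
    qed
    have "t\<^sup>2 * k z z \<le> t\<^sup>2 * M" using kM[OF z z] by (intro mult_left_mono) auto
    moreover have "t\<^sup>2 * q \<le> t\<^sup>2 * M" using qM by (intro mult_left_mono) auto
    moreover have "2 * t * (1 - t) * V \<le> 2 * t * V"
      using t V0 by (intro mult_right_mono) (auto simp: algebra_simps)
    ultimately have "q - t\<^sup>2 - (1 - t)\<^sup>2 * q - t\<^sup>2 * M \<le> 2 * t * V" using * by linarith
    then have "2 * t * q \<le> 2 * t * V + t\<^sup>2 * (2 * M + 1)" using \<open>t\<^sup>2 * q \<le> t\<^sup>2 * M\<close>
      by (simp add: power2_eq_square algebra_simps)
    also have "2 * t * V + t\<^sup>2 * (2 * M + 1) = 2 * t * (V + t * (2 * M + 1) / 2)"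
      by (simp add: power2_eq_square distrib_left)
    finally have "2 * t * q \<le> 2 * t * (V + t * (2 * M + 1) / 2)" .
    then have "q \<le> V + t * (2 * M + 1) / 2" using t by (simp only: mult_le_cancel_left_pos)
    then show "(\<Sum>x\<in>F. a x * (\<Sum>y\<in>F. a y * k x y)) - \<eta> \<le> (\<Sum>y\<in>F. a y * k z y)"
      using t\<eta> \<eta> unfolding q_def V_def by linarith
  qed
qed

text \<open>The charges are indexed by an arbitrary finite set and placed by \<open>p\<close>, so that a charge and its image under a
  map share the same weights even if the map is not injective.\<close>
definition potential :: "real \<Rightarrow> ('b \<Rightarrow> complex) \<Rightarrow> 'b set \<Rightarrow> ('b \<Rightarrow> real) \<Rightarrow> complex \<Rightarrow> real" where
  "potential \<epsilon> p F a w = (\<Sum>x\<in>F. a x * soft_green \<epsilon> (p x) w)"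

lemma potential_lipschitz_vanishing:
  assumes "finite F" "\<And>x. x \<in> F \<Longrightarrow> p x \<in> ball 0 1" "0 < \<epsilon>"
  shows "potential \<epsilon> p F a \<in> lipschitz_vanishing 0 1"
proof -
  have "lipschitzian_on (cball 0 1) (\<lambda>w. \<Sum>x\<in>F. a x * soft_green \<epsilon> (p x) w)"
    using assms
  proof (induction F rule: finite_induct)
    case (insert x F)
    have "lipschitzian_on (cball 0 1) (soft_green \<epsilon> (p x))"
      using soft_green_lipschitz_vanishing[of \<epsilon> "p x"] insert.prems by (auto simp: lipschitz_vanishing_def)
    then have "lipschitzian_on (cball 0 1) (\<lambda>w. a x * soft_green \<epsilon> (p x) w + (\<Sum>x\<in>F. a x * soft_green \<epsilon> (p x) w))"
      using insert by (intro lipschitzian_add lipschitzian_cmult) auto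
    then show ?case using insert.hyps by simp
  qed (simp add: lipschitzian_const)
  moreover have "soft_green \<epsilon> (p x) w = 0" if "x \<in> F" "w \<in> sphere 0 1" for x w
    using soft_green_lipschitz_vanishing[of \<epsilon> "p x"] assms that unfolding lipschitz_vanishing_def by blast
  ultimately show ?thesis by (simp add: lipschitz_vanishing_def potential_def[abs_def])
qed

lemma dirichlet_potential:
  assumes u: "u \<in> lipschitz_vanishing 0 1" and p: "finite F" "\<And>x. x \<in> F \<Longrightarrow> p x \<in> ball 0 1" and \<epsilon>: "0 < \<epsilon>"
  shows "dirichlet u (potential \<epsilon> p F a) = (\<Sum>x\<in>F. a x * dirichlet u (soft_green \<epsilon> (p x)))"
proof -
  have "dirichlet u (potential \<epsilon> p F a) =
    (LINT w:ball 0 1|lebesgue. \<Sum>x\<in>F. a x * (gradient u w \<bullet> gradient (soft_green \<epsilon> (p x)) w))"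
    unfolding dirichlet_def
  proof (rule set_lebesgue_integral_cong)
    show "\<forall>w. w \<in> ball 0 1 \<longrightarrow> gradient u w \<bullet> gradient (potential \<epsilon> p F a) w =
        (\<Sum>x\<in>F. a x * (gradient u w \<bullet> gradient (soft_green \<epsilon> (p x)) w))"
    proof (intro allI impI)
      fix w :: complex assume w: "w \<in> ball 0 1"
      have "dir_deriv (potential \<epsilon> p F a) e w = (\<Sum>x\<in>F. a x * dir_deriv (soft_green \<epsilon> (p x)) e w)" for e
      proof (rule DERIV_imp_deriv)
        show "((\<lambda>t. potential \<epsilon> p F a (w + t *\<^sub>R e)) has_real_derivative
            (\<Sum>x\<in>F. a x * dir_deriv (soft_green \<epsilon> (p x)) e w)) (at 0)"
          unfolding potential_def
        proof (intro DERIV_sum DERIV_cmult)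
          fix x assume "x \<in> F"
          from soft_green_derivative[OF \<epsilon> p(2)[OF this] w, of e]
          show "((\<lambda>t. soft_green \<epsilon> (p x) (w + t *\<^sub>R e)) has_real_derivative dir_deriv (soft_green \<epsilon> (p x)) e w) (at 0)"
            using DERIV_imp_deriv by metis
        qed
      qed
      then show "gradient u w \<bullet> gradient (potential \<epsilon> p F a) w =
        (\<Sum>x\<in>F. a x * (gradient u w \<bullet> gradient (soft_green \<epsilon> (p x)) w))"
        unfolding gradient_inner by (simp add: sum_distrib_left sum.distrib[symmetric] algebra_simps)
    qed
  qed auto
  also have "\<dots> = (\<Sum>x\<in>F. LINT w:ball 0 1|lebesgue. a x * (gradient u w \<bullet> gradient (soft_green \<epsilon> (p x)) w))"
    unfolding set_lebesgue_integral_def scaleR_sum_right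
    using gradient_inner_integrable[OF u soft_green_lipschitz_vanishing[OF \<epsilon> p(2)]] 
    by (intro Bochner_Integration.integral_sum) (auto simp: set_integrable_def mult.left_commute)
  also have "\<dots> = (\<Sum>x\<in>F. a x * dirichlet u (soft_green \<epsilon> (p x)))"
    unfolding dirichlet_def by (simp only: set_integral_mult_right)
  finally show ?thesis .
qed

lemma potential_energy_le:
  assumes p: "finite F" "\<And>x. x \<in> F \<Longrightarrow> p x \<in> ball 0 1" and \<epsilon>: "0 < \<epsilon>" and a: "\<And>x. 0 \<le> a x"
  shows "dirichlet (potential \<epsilon> p F a) (potential \<epsilon> p F a) \<le>
    2 * pi * (\<Sum>x\<in>F. a x * (\<Sum>y\<in>F. a y * soft_green \<epsilon> (p x) (p y)))"
proof -
  have le: "dirichlet (soft_green \<epsilon> (p x)) (soft_green \<epsilon> (p y)) \<le> 2 * pi * soft_green \<epsilon> (p x) (p y)"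
    if "x \<in> F" "y \<in> F" for x y
    using dirichlet_soft_green_le[OF \<epsilon> p(2)[OF that(1)] p(2)[OF that(2)]]
    unfolding soft_green_commute[of \<epsilon> "p y" "p x"] .
  have "dirichlet (potential \<epsilon> p F a) (potential \<epsilon> p F a) =
    (\<Sum>x\<in>F. a x * dirichlet (soft_green \<epsilon> (p x)) (potential \<epsilon> p F a))"
    using dirichlet_potential[OF potential_lipschitz_vanishing[OF p \<epsilon>] p \<epsilon>] by (simp add: dirichlet_commute)
  also have "\<dots> = (\<Sum>x\<in>F. a x * (\<Sum>y\<in>F. a y * dirichlet (soft_green \<epsilon> (p x)) (soft_green \<epsilon> (p y))))"
    by (intro sum.cong refl arg_cong2[where f = "(*)"] dirichlet_potential soft_green_lipschitz_vanishing p \<epsilon>)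
  also have "\<dots> \<le> (\<Sum>x\<in>F. a x * (\<Sum>y\<in>F. a y * (2 * pi * soft_green \<epsilon> (p x) (p y))))"
    by (intro sum_mono mult_left_mono le a)
  also have "\<dots> = 2 * pi * (\<Sum>x\<in>F. a x * (\<Sum>y\<in>F. a y * soft_green \<epsilon> (p x) (p y)))"
    by (simp add: sum_distrib_left mult_ac)
  finally show ?thesis .
qed

section \<open>Capacity under maps that do not decrease hyperbolic distances\<close>

lemma conf_cap_le_dirichlet:
  assumes "v \<in> lipschitz_vanishing 0 1" "\<And>z. z \<in> E \<Longrightarrow> 1 \<le> v z"
  shows "conf_cap E \<le> ennreal (dirichlet v v)"
proof -
  have "v \<in> cap_admissible E" using assms by (auto simp: cap_admissible_def lipschitz_vanishing_def)
  then have "conf_cap E \<le> (\<integral>\<^sup>+ z\<in>ball 0 1. ennreal ((norm (gradient v z))\<^sup>2) \<partial>lebesgue)"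
    unfolding conf_cap_def by (rule INF_lower)
  then show ?thesis using energy_eq_dirichlet[OF assms(1)] by simp
qed

text \<open>The comparison for fixed \<open>\<epsilon>\<close>. A nearly minimal charge on \<open>E\<close> with energy \<open>Q\<close> bounds the
  capacity of \<open>E\<close> from above through its own potential, and bounds the Dirichlet integral of \<open>u\<close> from
  below through the potential of its image under \<open>S\<close>.\<close>
lemma conf_cap_le_of_average:
  assumes E: "E \<subseteq> ball 0 1" "E \<noteq> {}" and S: "\<And>z. z \<in> E \<Longrightarrow> S z \<in> ball 0 1"
    and exp: "\<And>z w. z \<in> E \<Longrightarrow> w \<in> E \<Longrightarrow> pseudo_dist2 z w \<le> pseudo_dist2 (S z) (S w)"
    and u: "u \<in> lipschitz_vanishing 0 1" and \<epsilon>: "0 < \<epsilon>" and \<sigma>: "0 < \<sigma>"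
    and avg: "\<And>z. z \<in> E \<Longrightarrow> \<sigma> \<le> (LINT w:ball 0 1|lebesgue. u w * green_density \<epsilon> (S z) w)"
  shows "conf_cap E \<le> ennreal (dirichlet u u / \<sigma>\<^sup>2)"
proof -
  define D where "D = dirichlet u u"
(* A lower bound for all energies that occur, independent of the error eta. *)
  define \<beta> where "\<beta> = 2 * pi * \<sigma>\<^sup>2 / D"
  have ball: "z \<in> ball 0 1" if "z \<in> E" for z using E that by blast
  have key: "0 < D \<and> (\<eta> < \<beta> \<longrightarrow> conf_cap E \<le> ennreal (D / \<sigma>\<^sup>2 / (1 - \<eta> / \<beta>)\<^sup>2))" if \<eta>: "0 < \<eta>" for \<eta>
  proof -
    obtain F a where F: "finite F" "F \<subseteq> E" "\<And>x. 0 \<le> a x" "sum a F = 1"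
      and V: "\<And>z. z \<in> E \<Longrightarrow> (\<Sum>x\<in>F. a x * (\<Sum>y\<in>F. a y * soft_green \<epsilon> x y)) - \<eta>
          \<le> (\<Sum>y\<in>F. a y * soft_green \<epsilon> z y)"
      by (rule near_equilibrium[OF E(2) \<eta>, of "soft_green \<epsilon>" "ln ((1 + \<epsilon>) / \<epsilon>) / 2"])
        (use ball soft_green_pos[OF \<epsilon>] soft_green_le[OF \<epsilon>] soft_green_commute in \<open>auto intro: less_imp_le\<close>)
    define q where "q = (\<Sum>x\<in>F. a x * (\<Sum>y\<in>F. a y * soft_green \<epsilon> x y))"
    have FS: "S x \<in> ball 0 1" if "x \<in> F" for x using S F that by blast
    have Fb: "x \<in> ball 0 1" if "x \<in> F" for x using ball F that by blast
    have exp': "pseudo_dist2 x y \<le> pseudo_dist2 (S x) (S y)" if "x \<in> F" "y \<in> F" for x y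
      using F(2) that by (intro exp) auto
    define v' where "v' = potential \<epsilon> S F a"
    have v': "v' \<in> lipschitz_vanishing 0 1" unfolding v'_def using F(1) FS \<epsilon> by (rule potential_lipschitz_vanishing)
    have "dirichlet v' v' \<le> 2 * pi * (\<Sum>x\<in>F. a x * (\<Sum>y\<in>F. a y * soft_green \<epsilon> (S x) (S y)))"
      unfolding v'_def using F(1) FS \<epsilon> F(3) by (rule potential_energy_le)
    also have "\<dots> \<le> 2 * pi * q"
      unfolding q_def using F(3) by (intro mult_left_mono sum_mono soft_green_antimono_pseudo_dist2 \<epsilon> exp') auto
    finally have Dv': "dirichlet v' v' \<le> 2 * pi * q" .
    have "dirichlet u v' = (\<Sum>x\<in>F. a x * dirichlet u (soft_green \<epsilon> (S x)))"
      unfolding v'_def using u F(1) FS \<epsilon> by (rule dirichlet_potential)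
    also have "\<dots> = (\<Sum>x\<in>F. a x * (2 * pi * (LINT w:ball 0 1|lebesgue. u w * green_density \<epsilon> (S x) w)))"
      by (intro sum.cong refl arg_cong2[where f = "(*)"] dirichlet_soft_green u \<epsilon> FS)
    also have "\<dots> \<ge> (\<Sum>x\<in>F. a x * (2 * pi * \<sigma>))"
      using F avg by (intro sum_mono mult_left_mono) auto
    also have "(\<Sum>x\<in>F. a x * (2 * pi * \<sigma>)) = 2 * pi * \<sigma>"
      using F(4) by (simp add: sum_distrib_right[symmetric])
    finally have uv': "2 * pi * \<sigma> \<le> dirichlet u v'" .
    have young: "2 * c * (2 * pi * \<sigma>) - c\<^sup>2 * (2 * pi * q) \<le> D" if "0 \<le> c" for c
    proof -
      have "2 * c * (2 * pi * \<sigma>) \<le> 2 * c * dirichlet u v'" using uv' that by (intro mult_left_mono) auto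
      moreover have "c\<^sup>2 * dirichlet v' v' \<le> c\<^sup>2 * (2 * pi * q)" using Dv' by (intro mult_left_mono) auto
      ultimately show ?thesis using dirichlet_young[OF u v', of c] unfolding D_def by linarith
    qed
    have D0: "0 \<le> D" unfolding D_def by (rule dirichlet_nonneg)
    have q: "0 < q"
    proof (rule ccontr)
      assume "\<not> 0 < q"
      define c where "c = (D + 1) / (4 * pi * \<sigma>)"
      have "c\<^sup>2 * (2 * pi * q) \<le> 0" using \<open>\<not> 0 < q\<close> by (intro mult_nonneg_nonpos) auto
      moreover have "2 * c * (2 * pi * \<sigma>) = D + 1" using \<sigma> by (simp add: c_def)
      moreover have "0 \<le> c" using D0 \<sigma> by (simp add: c_def)
      ultimately show False using young[of c] by linarith
    qed
    have "2 * (\<sigma> / q) * (2 * pi * \<sigma>) - (\<sigma> / q)\<^sup>2 * (2 * pi * q) = 2 * pi * \<sigma>\<^sup>2 / q"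
      using q by (simp add: power2_eq_square field_simps)
    then have Dq: "2 * pi * \<sigma>\<^sup>2 / q \<le> D" using young[of "\<sigma> / q"] q \<sigma> by simp
    moreover have "0 < 2 * pi * \<sigma>\<^sup>2 / q" using q \<sigma> by simp
    ultimately have Dpos: "0 < D" by linarith
    have \<beta>q: "\<beta> \<le> q" using Dq q Dpos by (simp add: \<beta>_def field_simps)
    have \<beta>: "0 < \<beta>" using Dpos \<sigma> by (simp add: \<beta>_def)
    have "conf_cap E \<le> ennreal (D / \<sigma>\<^sup>2 / (1 - \<eta> / \<beta>)\<^sup>2)" if \<eta>\<beta>: "\<eta> < \<beta>"
    proof -
      have q\<eta>: "0 < q - \<eta>" using \<eta>\<beta> \<beta>q by simp
      define b where "b x = a x / (q - \<eta>)" for x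
      have b: "0 \<le> b x" for x using F(3) q\<eta> by (simp add: b_def)
      define v where "v = potential \<epsilon> (\<lambda>x. x) F b"
      have v: "v \<in> lipschitz_vanishing 0 1" unfolding v_def using F(1) Fb \<epsilon> by (rule potential_lipschitz_vanishing)
      have "1 \<le> v z" if "z \<in> E" for z
      proof -
        have "v z = (\<Sum>y\<in>F. a y * soft_green \<epsilon> z y) / (q - \<eta>)"
          unfolding v_def potential_def b_def sum_divide_distrib
          by (intro sum.cong refl) (simp add: soft_green_commute[of \<epsilon> z])
        moreover have "q - \<eta> \<le> (\<Sum>y\<in>F. a y * soft_green \<epsilon> z y)" using V[OF that] by (simp add: q_def)
        ultimately show ?thesis using q\<eta> by simp
      qed
      then have "conf_cap E \<le> ennreal (dirichlet v v)" by (intro conf_cap_le_dirichlet v)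
      also have "dirichlet v v \<le> 2 * pi * (\<Sum>x\<in>F. b x * (\<Sum>y\<in>F. b y * soft_green \<epsilon> x y))"
        unfolding v_def using F(1) Fb \<epsilon> b by (rule potential_energy_le)
      also have "\<dots> = 2 * pi * (q / (q - \<eta>)\<^sup>2)"
        unfolding q_def b_def by (simp add: sum_divide_distrib[symmetric] sum_distrib_left[symmetric] power2_eq_square)
      also have "\<dots> = (2 * pi / q) / (1 - \<eta> / q)\<^sup>2"
      proof -
        have "1 - \<eta> / q = (q - \<eta>) / q" using q by (simp add: field_simps)
        then show ?thesis using q q\<eta> by (simp add: power_divide power2_eq_square)
      qed
      also have "\<dots> \<le> (D / \<sigma>\<^sup>2) / (1 - \<eta> / \<beta>)\<^sup>2"
      proof (rule frac_le)
        show "2 * pi / q \<le> D / \<sigma>\<^sup>2" using Dq \<sigma> q by (simp add: field_simps)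
        have "\<eta> / q \<le> \<eta> / \<beta>" using \<beta>q \<beta> \<eta> by (intro divide_left_mono) auto
        moreover have "\<eta> / \<beta> < 1" using \<eta>\<beta> \<beta> by simp
        ultimately show "(1 - \<eta> / \<beta>)\<^sup>2 \<le> (1 - \<eta> / q)\<^sup>2" "0 < (1 - \<eta> / \<beta>)\<^sup>2"
          by (auto intro!: power_mono)
      qed (use D0 in auto)
      finally show ?thesis by (simp add: ennreal_leI)
    qed
    then show ?thesis using Dpos by blast
  qed
  have Dpos: "0 < D" using key[of 1] by simp
  then have \<beta>: "0 < \<beta>" using \<sigma> by (simp add: \<beta>_def)
  have "conf_cap E \<le> ennreal (D / \<sigma>\<^sup>2)"
  proof (rule tendsto_lowerbound)
    have "((\<lambda>\<eta>. ennreal (D / \<sigma>\<^sup>2 / (1 - \<eta> / \<beta>)\<^sup>2)) \<longlongrightarrow> ennreal (D / \<sigma>\<^sup>2 / (1 - 0 / \<beta>)\<^sup>2)) (at_right 0)"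
      using \<beta> \<sigma> by (intro tendsto_ennrealI tendsto_intros) auto
    then show "((\<lambda>\<eta>. ennreal (D / \<sigma>\<^sup>2 / (1 - \<eta> / \<beta>)\<^sup>2)) \<longlongrightarrow> ennreal (D / \<sigma>\<^sup>2)) (at_right 0)" by simp
    show "\<forall>\<^sub>F \<eta> in at_right 0. conf_cap E \<le> ennreal (D / \<sigma>\<^sup>2 / (1 - \<eta> / \<beta>)\<^sup>2)"
      using eventually_at_right_real[OF \<beta>] by eventually_elim (use key in auto)
  qed simp
  then show ?thesis by (simp add: D_def)
qed

text \<open>An admissible \<open>u\<close> with Lipschitz constant \<open>L\<close> is at least \<open>1\<close> on \<open>E'\<close> and zero on the circle, so \<open>E'\<close>
  keeps distance \<open>1 / L\<close> from the circle. This makes the lower bound \<open>\<sigma>\<close> for the averages uniform over \<open>E'\<close>.\<close>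
theorem conf_cap_mono_expansion:
  assumes E: "E \<subseteq> ball 0 1" and E': "E' \<subseteq> ball 0 1" and S: "\<And>z. z \<in> E \<Longrightarrow> S z \<in> E'"
    and exp: "\<And>z w. z \<in> E \<Longrightarrow> w \<in> E \<Longrightarrow> pseudo_dist2 z w \<le> pseudo_dist2 (S z) (S w)"
  shows "conf_cap E \<le> conf_cap E'"
proof (cases "E = {}")
  case True
  then have "cap_admissible E' \<subseteq> cap_admissible E" by (auto simp: cap_admissible_def)
  then show ?thesis unfolding conf_cap_def by (rule INF_superset_mono) simp
next
  case False
  have "conf_cap E \<le> (\<integral>\<^sup>+ z\<in>ball 0 1. ennreal ((norm (gradient u z))\<^sup>2) \<partial>lebesgue)"
    if adm: "u \<in> cap_admissible E'" for u
  proof -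
    obtain L where L: "L-lipschitz_on (cball 0 1) u" "\<forall>z\<in>sphere 0 1. u z = 0"
      and u1: "\<And>z. z \<in> E' \<Longrightarrow> 1 \<le> u z"
      using adm by (auto simp: cap_admissible_def)
    have u: "u \<in> lipschitz_vanishing 0 1" using L by (auto simp: lipschitz_vanishing_def)
    have edge: "1 \<le> L * (1 - norm z)" if "z \<in> E'" for z
      using lipschitz_vanishing_bounds[OF L, of z] u1[OF that] E' that by (force simp: subset_eq)
    have L1: "1 \<le> L"
    proof -
      obtain z where z: "z \<in> E'" using False S by blast
      have "L * (1 - norm z) \<le> L * 1"
        using lipschitz_on_nonneg[OF L(1)] by (intro mult_left_mono) auto
      then show ?thesis using edge[OF z] by simp
    qed
    define \<sigma> where "\<sigma> \<epsilon> \<delta> = (1 - L * \<delta>) * (1 / (1 + L * \<delta>))\<^sup>2 * (\<delta>\<^sup>2 / (\<delta>\<^sup>2 + 4 * \<epsilon>)) - L * \<epsilon> / \<delta> ^ 4" for \<epsilon> \<delta>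
    have avg: "\<sigma> \<epsilon> \<delta> \<le> (LINT w:ball 0 1|lebesgue. u w * green_density \<epsilon> z w)"
      if z: "z \<in> E'" and \<epsilon>: "0 < \<epsilon>" and \<delta>: "0 < \<delta>" "\<delta> < 1 / L" for z \<epsilon> \<delta>
    proof -
      have zb: "z \<in> ball 0 1" using E' z by blast
      have L\<delta>: "L * \<delta> < 1" using \<delta> L1 by (simp add: field_simps)
      have "1 / L \<le> 1 - norm z" using edge[OF z] L1 by (simp add: field_simps)
      then have \<delta>z: "\<delta> < 1 - norm z" using \<delta> by linarith
      define m where "m = 1 - (norm z)\<^sup>2"
      have "(norm z)\<^sup>2 \<le> norm z" using zb by (simp add: power2_eq_square mult_left_le)
      then have "1 - norm z \<le> m" by (simp add: m_def)
      then have "L * (1 - norm z) \<le> L * m" using L1 by (intro mult_left_mono) auto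
      then have Lm: "1 \<le> L * m" using edge[OF z] by linarith
      have m: "0 < m" "m \<le> 1" using zb by (auto simp: m_def power_less_one_iff)
      have "\<delta> \<le> 1" using \<delta>z norm_ge_zero[of z] by linarith
      then have "(m + \<delta>)\<^sup>2 \<le> 2\<^sup>2" using m \<delta> by (intro power_mono) auto
      then have a1: "\<delta>\<^sup>2 / (\<delta>\<^sup>2 + 4 * \<epsilon>) \<le> \<delta>\<^sup>2 / (\<delta>\<^sup>2 + \<epsilon> * (m + \<delta>)\<^sup>2)"
        using \<epsilon> \<delta> m by (intro divide_left_mono add_left_mono mult_pos_pos) (auto intro!: add_pos_pos)
      have "1 * \<delta> \<le> (L * m) * \<delta>" using Lm \<delta> by (intro mult_right_mono) auto
      then have "1 / (1 + L * \<delta>) \<le> m / (m + \<delta>)"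
        using m \<delta> L1 by (simp add: field_simps add_pos_pos)
      then have a2: "(1 / (1 + L * \<delta>))\<^sup>2 \<le> (m / (m + \<delta>))\<^sup>2"
        using L1 \<delta> by (intro power_mono) auto
      have "\<sigma> \<epsilon> \<delta> \<le> (u z - L * \<delta>) * (m / (m + \<delta>))\<^sup>2 * (\<delta>\<^sup>2 / (\<delta>\<^sup>2 + \<epsilon> * (m + \<delta>)\<^sup>2)) - L * \<epsilon> / \<delta> ^ 4"
        unfolding \<sigma>_def using u1[OF z] L\<delta> a1 a2 \<epsilon>
        by (intro diff_right_mono mult_mono) auto
      also have "\<dots> \<le> (LINT w:ball 0 1|lebesgue. u w * green_density \<epsilon> z w)"
        unfolding m_def
        by (rule green_average_lower[OF L \<epsilon> zb \<delta>(1) \<delta>z]) (use L\<delta> u1[OF z] in linarith)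
      finally show ?thesis .
    qed
    have cap\<sigma>: "conf_cap E \<le> ennreal (dirichlet u u / (\<sigma> \<epsilon> \<delta>)\<^sup>2)"
      if "0 < \<epsilon>" "0 < \<delta>" "\<delta> < 1 / L" "0 < \<sigma> \<epsilon> \<delta>" for \<epsilon> \<delta>
    proof (rule conf_cap_le_of_average[where S = S, OF E False _ exp u])
      show "S z \<in> ball 0 1" if "z \<in> E" for z using S[OF that] E' by blast
      show "\<sigma> \<epsilon> \<delta> \<le> (LINT w:ball 0 1|lebesgue. u w * green_density \<epsilon> (S z) w)" if "z \<in> E" for z
        using S[OF that] \<open>0 < \<epsilon>\<close> \<open>0 < \<delta>\<close> \<open>\<delta> < 1 / L\<close> by (rule avg)
    qed (use that in auto)
    have cap\<delta>: "conf_cap E \<le> ennreal (dirichlet u u / ((1 - L * \<delta>) * (1 / (1 + L * \<delta>))\<^sup>2)\<^sup>2)"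
      if \<delta>: "0 < \<delta>" "\<delta> < 1 / L" for \<delta>
    proof (rule tendsto_lowerbound)
      let ?\<sigma> = "(1 - L * \<delta>) * (1 / (1 + L * \<delta>))\<^sup>2"
      have "L * \<delta> < 1" "0 < 1 + L * \<delta>" using \<delta> L1 by (auto simp: field_simps add_pos_pos)
      then have \<sigma>0: "0 < ?\<sigma>" by simp
      have "((\<lambda>\<epsilon>. \<sigma> \<epsilon> \<delta>) \<longlongrightarrow> ?\<sigma> * (\<delta>\<^sup>2 / (\<delta>\<^sup>2 + 4 * 0)) - L * 0 / \<delta> ^ 4) (at_right 0)"
        unfolding \<sigma>_def using \<delta> by (intro tendsto_intros) auto
      then have lim: "((\<lambda>\<epsilon>. \<sigma> \<epsilon> \<delta>) \<longlongrightarrow> ?\<sigma>) (at_right 0)" using \<delta> by simp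
      then show "((\<lambda>\<epsilon>. ennreal (dirichlet u u / (\<sigma> \<epsilon> \<delta>)\<^sup>2)) \<longlongrightarrow> ennreal (dirichlet u u / ?\<sigma>\<^sup>2)) (at_right 0)"
        using \<sigma>0 by (intro tendsto_ennrealI tendsto_divide tendsto_power tendsto_const) auto
      show "\<forall>\<^sub>F \<epsilon> in at_right 0. conf_cap E \<le> ennreal (dirichlet u u / (\<sigma> \<epsilon> \<delta>)\<^sup>2)"
        using order_tendstoD(1)[OF lim \<sigma>0] eventually_at_right_real[of 0 1, OF zero_less_one]
        by eventually_elim (use cap\<sigma> \<delta> in auto)
    qed simp
    have "conf_cap E \<le> ennreal (dirichlet u u)"
    proof (rule tendsto_lowerbound)
      have "((\<lambda>\<delta>. ennreal (dirichlet u u / ((1 - L * \<delta>) * (1 / (1 + L * \<delta>))\<^sup>2)\<^sup>2)) \<longlongrightarrow>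
          ennreal (dirichlet u u / ((1 - L * 0) * (1 / (1 + L * 0))\<^sup>2)\<^sup>2)) (at_right 0)"
        by (intro tendsto_ennrealI tendsto_intros) auto
      then show "((\<lambda>\<delta>. ennreal (dirichlet u u / ((1 - L * \<delta>) * (1 / (1 + L * \<delta>))\<^sup>2)\<^sup>2)) \<longlongrightarrow>
          ennreal (dirichlet u u)) (at_right 0)" by simp
      have "0 < 1 / L" using L1 by simp
      from eventually_at_right_real[OF this]
      show "\<forall>\<^sub>F \<delta> in at_right 0. conf_cap E \<le> ennreal (dirichlet u u / ((1 - L * \<delta>) * (1 / (1 + L * \<delta>))\<^sup>2)\<^sup>2)"
        by eventually_elim (use cap\<delta> in auto)
    qed simp
    then show ?thesis using energy_eq_dirichlet[OF u] by simp
  qed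
  then show ?thesis unfolding conf_cap_def[of E'] by (rule INF_greatest)
qed

section \<open>Hyperbolic polar coordinates\<close>

lemma tanh_artanh:
  fixes x :: real
  assumes "\<bar>x\<bar> < 1"
  shows "tanh (artanh x) = x"
proof -
  define q where "q = (1 + x) / (1 - x)"
  have q: "q > 0" using assms by (auto simp: q_def)
  then have "artanh x = ln (sqrt q)" by (simp add: artanh_def q_def[symmetric] ln_sqrt)
  then have "tanh (artanh x) = (q - 1) / (q + 1)" using q by (simp add: tanh_ln_real)
  also have "q - 1 = 2 * x / (1 - x)" using assms by (auto simp: q_def field_simps)
  also have "q + 1 = 2 / (1 - x)" using assms by (auto simp: q_def field_simps)
  also have "2 * x / (1 - x) / (2 / (1 - x)) = x" using assms by auto
  finally show ?thesis .
qed

lemma abs_affine_less_1: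
  fixes r s t :: real
  assumes "0 \<le> r" "r \<le> s" "s < 1" "t \<in> {0..1}"
  shows "\<bar>r + t * (s - r)\<bar> < 1"
  using mult_right_mono[of t 1 "s - r"] mult_nonneg_nonneg[of t "s - r"] assms by auto

lemma has_integral_hyperbolic_density:
  fixes r s :: real
  assumes "0 \<le> r" "r \<le> s" "s < 1"
  shows "((\<lambda>t. 2 * (s - r) / (1 - (r + t * (s - r))\<^sup>2)) has_integral 2 * (artanh s - artanh r)) {0..1}"
proof -
  have "((\<lambda>t. 2 * (s - r) / (1 - (r + t * (s - r))\<^sup>2)) has_integral
      2 * artanh (r + 1 * (s - r)) - 2 * artanh (r + 0 * (s - r))) {0..1}"
  proof (rule fundamental_theorem_of_calculus)
    fix t :: real assume t: "t \<in> {0..1}"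
    have "\<bar>r + t * (s - r)\<bar> < 1" using assms t by (rule abs_affine_less_1)
    then have "(artanh has_real_derivative 1 / (1 - (r + t * (s - r))\<^sup>2)) (at (r + t * (s - r)))"
      by (rule artanh_real_has_field_derivative)
    moreover have "((\<lambda>t. r + t * (s - r)) has_real_derivative (s - r)) (at t within {0..1})"
      by (auto intro!: derivative_eq_intros)
    ultimately have "((\<lambda>t. 2 * artanh (r + t * (s - r))) has_real_derivative
        2 * (1 / (1 - (r + t * (s - r))\<^sup>2) * (s - r))) (at t within {0..1})"
      by (intro DERIV_cmult DERIV_chain2)
    then have "((\<lambda>t. 2 * artanh (r + t * (s - r))) has_real_derivative
        2 * (s - r) / (1 - (r + t * (s - r))\<^sup>2)) (at t within {0..1})" by simp
    then show "((\<lambda>t. 2 * artanh (r + t * (s - r))) has_vector_derivative 2 * (s - r) / (1 - (r + t * (s - r))\<^sup>2)) (at t within {0..1})"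
      by (simp add: has_real_derivative_iff_has_vector_derivative)
  qed simp
  then show ?thesis by (simp add: algebra_simps)
qed

lemma hyp_length_segment_radial:
  fixes r s :: real
  assumes "0 \<le> r" "r \<le> s" "s < 1"
  shows "hyp_length_segment (of_real r) (of_real s) = 2 * (artanh s - artanh r)"
proof -
  let ?f = "\<lambda>t. 2 * (s - r) / (1 - (r + t * (s - r))\<^sup>2)"
  have lp: "linepath (of_real r) (of_real s) t = complex_of_real (r + t * (s - r))" for t
    by (simp add: linepath_def scaleR_conv_of_real algebra_simps)
  have S: "{t \<in> {0..1}. linepath (of_real r) (of_real s :: complex) t \<in> closed_segment (of_real r) (of_real s)} = {0..1}"
    by (auto simp: linepath_in_path)
  have "hyp_length_segment (of_real r) (of_real s) = (LINT t:{0..1}|lebesgue. ?f t)"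
    unfolding hyp_length_def S
  proof (rule set_lebesgue_integral_cong)
    show "\<forall>t. t \<in> {0..1} \<longrightarrow> 2 * norm (vector_derivative (linepath (of_real r) (of_real s :: complex)) (at t within {0..1}))
        / (1 - (norm (linepath (of_real r) (of_real s :: complex) t))\<^sup>2) = ?f t"
    proof (intro allI impI)
      fix t :: real assume t: "t \<in> {0..1}"
      have "vector_derivative (linepath (of_real r) (of_real s)) (at t within {0..1}) = complex_of_real (s - r)"
        using t by (simp add: vector_derivative_linepath_within)
      then show "2 * norm (vector_derivative (linepath (of_real r) (of_real s :: complex)) (at t within {0..1}))
        / (1 - (norm (linepath (of_real r) (of_real s :: complex) t))\<^sup>2) = ?f t"
        using assms(2) by (simp only: lp norm_of_real power2_abs abs_of_nonneg diff_ge_0_iff_ge)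
    qed
  qed auto
  also have "\<dots> = integral {0..1} ?f"
  proof (rule set_lebesgue_integral_eq_integral)
    have "1 - (r + t * (s - r))\<^sup>2 \<noteq> 0" if t: "t \<in> {0..1}" for t
    proof -
      have "\<bar>r + t * (s - r)\<bar> < 1" using assms t by (rule abs_affine_less_1)
      then show ?thesis by (simp add: abs_square_eq_1)
    qed
    then have "continuous_on {0..1} ?f" by (intro continuous_intros) auto
    then show "?f absolutely_integrable_on {0..1}" by (rule absolutely_integrable_continuous_real)
  qed
  also have "\<dots> = 2 * (artanh s - artanh r)"
    using has_integral_hyperbolic_density[OF assms] by (rule integral_unique)
  finally show ?thesis .
qed

text \<open>The hyperbolic distance from the origin to \<open>s\<close> is \<open>2 artanh s\<close>, so \<open>artanh\<close> is the natural
  coordinate on a radius: in it, prescribing the length of the segment means adding \<open>l / 2\<close>.\<close>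
lemma radial_end_tanh:
  assumes r: "0 \<le> r" "r < 1" and l: "0 \<le> l"
  shows "radial_end r l = tanh (artanh r + l / 2)"
  unfolding radial_end_def
proof (rule the_equality)
  have rt: "r = tanh (artanh r)" using r by (simp add: tanh_artanh)
  let ?s = "tanh (artanh r + l / 2)"
  have s: "r \<le> ?s" "?s < 1"
    by (subst rt) (use l in \<open>auto simp: tanh_real_lt_1\<close>)
  then show "r \<le> ?s \<and> ?s < 1 \<and> hyp_length_segment (of_real r) (of_real ?s) = l"
    using hyp_length_segment_radial[OF r(1) s] by (simp add: artanh_tanh_real)
  fix s assume "r \<le> s \<and> s < 1 \<and> hyp_length_segment (of_real r) (of_real s) = l"
  then have s: "r \<le> s" "s < 1" "hyp_length_segment (of_real r) (of_real s) = l" by auto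
  then have "artanh s = artanh r + l / 2" using hyp_length_segment_radial[OF r(1) s(1,2)] by simp
  then have "tanh (artanh s) = ?s" by simp
  then show "s = ?s" using s r by (simp add: tanh_artanh)
qed

text \<open>The hyperbolic law of cosines for points at hyperbolic distances \<open>2a\<close> and \<open>2b\<close> from the origin; the
  left-hand side is \<open>cosh\<^sup>2(d/2)\<close>.\<close>
lemma pseudo_dist2_polar:
  assumes "norm e = 1" "norm f = 1"
  shows "1 / (1 - pseudo_dist2 (of_real (tanh a) * e) (of_real (tanh b) * f)) =
    (cosh (a - b))\<^sup>2 + 2 * (1 - e \<bullet> f) * (sinh a * cosh a * (sinh b * cosh b))"
proof -
  let ?z = "of_real (tanh a) * e" and ?w = "of_real (tanh b) * f"
  have ca: "cosh a > 0" "cosh b > 0" by (auto simp: cosh_real_pos)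
  have nz: "norm ?z = \<bar>tanh a\<bar>" "norm ?w = \<bar>tanh b\<bar>" using assms by (auto simp: norm_mult)
  have lt: "\<bar>tanh x\<bar> < 1" for x :: real using tanh_real_lt_1[of x] tanh_real_gt_neg1[of x] by auto
  have in_ball: "?z \<in> ball 0 1" "?w \<in> ball 0 1" using nz lt by auto
  have sech: "1 - (tanh x)\<^sup>2 = 1 / (cosh x)\<^sup>2" for x :: real
  proof -
    have "(cosh x)\<^sup>2 - (sinh x)\<^sup>2 = 1" by (rule hyperbolic_pythagoras)
    moreover have "1 - (tanh x)\<^sup>2 = ((cosh x)\<^sup>2 - (sinh x)\<^sup>2) / (cosh x)\<^sup>2"
      using cosh_real_pos[of x] by (simp add: tanh_def power_divide diff_divide_distrib)
    ultimately show ?thesis by simp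
  qed
  have n1: "norm (1 - cnj ?z * ?w) ^ 2 = 1 - 2 * tanh a * tanh b * (e \<bullet> f) + (tanh a * tanh b)\<^sup>2"
  proof -
    have "(norm (cnj e * f))\<^sup>2 = 1" using assms by (simp add: norm_mult)
    then have ef: "(Re (cnj e * f))\<^sup>2 + (Im (cnj e * f))\<^sup>2 = 1" by (simp only: cmod_power2)
    have re: "Re (cnj e * f) = e \<bullet> f" by (simp add: inner_complex_def)
    have "1 - cnj ?z * ?w = 1 - of_real (tanh a * tanh b) * (cnj e * f)" by simp
    then have "norm (1 - cnj ?z * ?w) ^ 2 =
      (1 - tanh a * tanh b * Re (cnj e * f))\<^sup>2 + (tanh a * tanh b * Im (cnj e * f))\<^sup>2"
      by (simp only: cmod_power2) (simp only: minus_complex.sel one_complex.sel times_complex.sel Re_complex_of_real Im_complex_of_real mult_zero_left diff_zero add_0_right diff_0 power2_minus)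
    also have "\<dots> = 1 - 2 * tanh a * tanh b * Re (cnj e * f)
       + (tanh a * tanh b)\<^sup>2 * ((Re (cnj e * f))\<^sup>2 + (Im (cnj e * f))\<^sup>2)"
      by (simp only: power2_eq_square) (simp only: algebra_simps)
    finally show ?thesis unfolding ef unfolding re by (simp only: mult_1_right)
  qed
  have "1 / (1 - pseudo_dist2 ?z ?w) = norm (1 - cnj ?z * ?w) ^ 2 * ((cosh a)\<^sup>2 * (cosh b)\<^sup>2)"
    using one_minus_pseudo_dist2[OF in_ball(1), of ?w] in_ball ca unfolding nz power2_abs sech
    by simp
  also have "\<dots> = (cosh (a - b))\<^sup>2 + 2 * (1 - e \<bullet> f) * (sinh a * cosh a * (sinh b * cosh b))"
    unfolding n1 cosh_diff using ca by (simp add: tanh_def power2_eq_square field_simps)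
  finally show ?thesis .
qed

text \<open>A common shift leaves \<open>a - b\<close> unchanged and increases \<open>sinh(2a)\<close> and \<open>sinh(2b)\<close>.\<close>
lemma pseudo_dist2_shift_le:
  assumes "norm e = 1" "norm f = 1" "0 \<le> a" "0 \<le> b" "0 \<le> d"
  shows "pseudo_dist2 (of_real (tanh a) * e) (of_real (tanh b) * f) \<le>
    pseudo_dist2 (of_real (tanh (a + d)) * e) (of_real (tanh (b + d)) * f)" (is "?p \<le> ?p'")
proof -
  have in_ball: "of_real (tanh x) * g \<in> ball 0 1" if "norm g = 1" for x and g :: complex
    using tanh_real_lt_1[of x] tanh_real_gt_neg1[of x] that by (auto simp: norm_mult)
  have lt: "?p < 1" "?p' < 1" using assms by (auto intro!: pseudo_dist2_less_1 in_ball)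
  have "e \<bullet> f \<le> norm e * norm f" by (rule norm_cauchy_schwarz)
  then have ef: "0 \<le> 1 - e \<bullet> f" using assms by simp
  have sc: "0 \<le> sinh x * cosh x \<and> sinh x * cosh x \<le> sinh (x + d) * cosh (x + d)" if "0 \<le> x" for x :: real
    using that assms(5) by (auto intro!: mult_mono mult_nonneg_nonneg simp: cosh_real_nonneg_le_iff)
  have "1 / (1 - ?p) \<le> 1 / (1 - ?p')"
    unfolding pseudo_dist2_polar[OF assms(1,2)] using ef sc[OF assms(3)] sc[OF assms(4)] assms(3-5)
    by (auto intro!: mult_mono mult_nonneg_nonneg)
  then have "1 - ?p' \<le> 1 - ?p" using lt by (simp add: field_simps)
  then show ?thesis by simp
qed

lemma radial_set_eq:
  assumes "0 \<le> r" "r < 1" "\<And>w. w \<in> E\<^sub>0 \<Longrightarrow> 0 \<le> \<rho> w"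
  shows "radial_set E\<^sub>0 \<rho> r = {of_real (tanh a) * w | a w. w \<in> E\<^sub>0 \<and> artanh r \<le> a \<and> a \<le> artanh r + \<rho> w / 2}"
proof -
  have rt: "tanh (artanh r) = r" using assms by (simp add: tanh_artanh)
  have seg: "closed_segment (of_real r * w) (of_real s * w) = (\<lambda>x. of_real x * w) ` {r..s}"
    if "r \<le> s" for s and w :: complex
  proof -
    have "(\<lambda>x. of_real x * w) ` closed_segment r s = closed_segment (of_real r * w) (of_real s * w)"
      by (rule closed_segment_linear_image[symmetric]) (auto intro!: linearI simp: algebra_simps scaleR_conv_of_real)
    then show ?thesis using that by (simp add: closed_segment_eq_real_ivl)
  qed
  have "closed_segment (of_real r * w) (of_real (radial_end r (\<rho> w)) * w) =
     {of_real (tanh a) * w | a. artanh r \<le> a \<and> a \<le> artanh r + \<rho> w / 2}" if w: "w \<in> E\<^sub>0" for w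
  proof -
    let ?A = "artanh r"
    have end_eq: "radial_end r (\<rho> w) = tanh (?A + \<rho> w / 2)" using assms w by (intro radial_end_tanh)
    have "tanh ?A \<le> tanh (?A + \<rho> w / 2)" using assms(3)[OF w] by simp
    then have "r \<le> radial_end r (\<rho> w)" using end_eq rt by simp
    from seg[OF this, of w] have "closed_segment (of_real r * w) (of_real (radial_end r (\<rho> w)) * w) =
        (\<lambda>x. of_real x * w) ` {tanh ?A..tanh (?A + \<rho> w / 2)}" unfolding end_eq rt .
    also have "{tanh ?A..tanh (?A + \<rho> w / 2)} = tanh ` {?A..?A + \<rho> w / 2}"
    proof (intro equalityI subsetI)
      fix x assume x: "x \<in> {tanh ?A..tanh (?A + \<rho> w / 2)}"
      have "\<bar>x\<bar> < 1" using x rt assms(1) tanh_real_lt_1[of "?A + \<rho> w / 2"] by auto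
      then have xt: "x = tanh (artanh x)" by (simp add: tanh_artanh)
      then have "tanh ?A \<le> tanh (artanh x)" "tanh (artanh x) \<le> tanh (?A + \<rho> w / 2)" using x by auto
      then have "artanh x \<in> {?A..?A + \<rho> w / 2}" by simp
      then show "x \<in> tanh ` {?A..?A + \<rho> w / 2}" using xt by blast
    qed auto
    finally show ?thesis by auto
  qed
  then show ?thesis unfolding radial_set_def by auto
qed

theorem theorem3p45:
  fixes E\<^sub>0 :: "complex set" and \<rho> :: "complex \<Rightarrow> real"
  assumes "compact E\<^sub>0" and "E\<^sub>0 \<subseteq> sphere 0 1"
    and "\<And>w. w \<in> E\<^sub>0 \<Longrightarrow> 0 \<le> \<rho> w"
    and "upper_semicontinuous_on E\<^sub>0 \<rho>"
  shows "mono_on {0..<1} (\<lambda>r. conf_cap (radial_set E\<^sub>0 \<rho> r))"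
proof (rule mono_onI)
  fix r r' :: real assume rr: "r \<in> {0..<1}" "r' \<in> {0..<1}" "r \<le> r'"
  define d where "d = artanh r' - artanh r"
  have tanh_r: "tanh (artanh r) = r" "tanh (artanh r') = r'" using rr by (auto intro!: tanh_artanh)
  then have "tanh (artanh r) \<le> tanh (artanh r')" "tanh 0 \<le> tanh (artanh r)" using rr by simp_all
  then have ar: "0 \<le> artanh r" "0 \<le> d" by (simp_all add: d_def)
  have unit: "norm w = 1" if "w \<in> E\<^sub>0" for w using assms(2) that by auto
  have polar: "radial_set E\<^sub>0 \<rho> s =
      {of_real (tanh a) * w | a w. w \<in> E\<^sub>0 \<and> artanh s \<le> a \<and> a \<le> artanh s + \<rho> w / 2}"
    if "s \<in> {0..<1}" for s
    using that assms(3) by (intro radial_set_eq) auto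
  have in_ball: "radial_set E\<^sub>0 \<rho> s \<subseteq> ball 0 1" if s: "s \<in> {0..<1}" for s
  proof
    fix z assume "z \<in> radial_set E\<^sub>0 \<rho> s"
    then obtain a w where "z = of_real (tanh a) * w" "w \<in> E\<^sub>0"
      unfolding polar[OF s] by blast
    then show "z \<in> ball 0 1"
      using unit[of w] tanh_real_lt_1[of a] tanh_real_gt_neg1[of a] by (auto simp: norm_mult)
  qed
  (* The origin lies on every ray, so the polar coordinates of a point have to be chosen. *)
  have "\<forall>z\<in>radial_set E\<^sub>0 \<rho> r. \<exists>a w. z = of_real (tanh a) * w \<and> w \<in> E\<^sub>0 \<and>
      artanh r \<le> a \<and> a \<le> artanh r + \<rho> w / 2"
    unfolding polar[OF rr(1)] by blast
  then obtain a w where aw: "\<And>z. z \<in> radial_set E\<^sub>0 \<rho> r \<Longrightarrow> z = of_real (tanh (a z)) * w z \<and> w z \<in> E\<^sub>0 \<and>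
      artanh r \<le> a z \<and> a z \<le> artanh r + \<rho> (w z) / 2"
    by metis
  define S where "S z = of_real (tanh (a z + d)) * w z" for z
  show "conf_cap (radial_set E\<^sub>0 \<rho> r) \<le> conf_cap (radial_set E\<^sub>0 \<rho> r')"
  proof (rule conf_cap_mono_expansion[where S = S])
    show "radial_set E\<^sub>0 \<rho> r \<subseteq> ball 0 1" "radial_set E\<^sub>0 \<rho> r' \<subseteq> ball 0 1" using in_ball rr by auto
    fix z assume z: "z \<in> radial_set E\<^sub>0 \<rho> r"
    have "artanh r' \<le> a z + d" "a z + d \<le> artanh r' + \<rho> (w z) / 2" "w z \<in> E\<^sub>0"
      using aw[OF z] by (auto simp: d_def)
    then show "S z \<in> radial_set E\<^sub>0 \<rho> r'" unfolding S_def polar[OF rr(2)] by blast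
    fix z' assume z': "z' \<in> radial_set E\<^sub>0 \<rho> r"
    have "pseudo_dist2 (of_real (tanh (a z)) * w z) (of_real (tanh (a z')) * w z') \<le> pseudo_dist2 (S z) (S z')"
      unfolding S_def using aw[OF z] aw[OF z'] ar by (intro pseudo_dist2_shift_le unit) auto
    moreover have "of_real (tanh (a z)) * w z = z" "of_real (tanh (a z')) * w z' = z'"
      using aw[OF z] aw[OF z'] by simp_all
    ultimately show "pseudo_dist2 z z' \<le> pseudo_dist2 (S z) (S z')" by (simp only:)
  qed
qed

end
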